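(* Let $\chi:(1/4,1/2)\to\mathbb R$ be the function given by the explicit formulas (i)--(iv) in the context. Then $$\{(a,b)\in(0,1/2)\times(1/2,1) : \dim_H\mathcal J(a,b)>0\}=\{(a,b)\in(1/4,1/2)\times(1/2,1) : b<\chi(a)\}.$$
   Context: Doubling map: $T:[0,1]\to[0,1]$, $Tx=2x$ for $x\in[0,1/2]$, $Tx=2x-1$ for $x\in(1/2,1]$. For $0<a<b<1$ put $\mathcal J(a,b)=\{x\in[0,1]: T^nx\notin(a,b)\text{ for all }n\ge0\}$. $\dim_H$ is Hausdorff dimension. Words have letters in $\{0,1\}$; concatenation is juxtaposition, $u^\infty=uuu\cdots$, $|u|$ is the length of $u$ and $|u|_1$ the number of 1s. An infinite word $w_1w_2\dots$ is identified with the real number $\pi(w)=\sum_{n\ge1}w_n2^{-n}$; in arithmetic expressions a finite word $w_1\dots w_m$ stands for $\sum_{n=1}^m w_n2^{-n}$. A word is balanced if any two of its factors $u,v$ of equal length satisfy $||u|_1-|v|_1|\le1$; a finite word $w$ is cyclically balanced if $w^2$ is balanced. For $r=p/q\in\mathbb Q\cap(0,1)$ in lowest terms, $\omega_r^-$ is the lexicographically largest cyclically balanced word of length $q$ with exactly $p$ ones beginning with 0, and $\omega_r^+$ is the lexicographically smallest cyclically balanced word of length $q$ with exactly $p$ ones beginning with 1. The substitution $\rho_r$ sends $0\mapsto\omega_r^-$, $1\mapsto\omega_r^+$ and extends to words by concatenation. For $r_1,\dots,r_n\in\mathbb Q\cap(0,1)$, $r_i=p_i/q_i$ in lowest terms,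 put $s_n=\rho_{r_1}\cdots\rho_{r_n}(0)$, $t_n=\rho_{r_1}\cdots\rho_{r_n}(1)$ (compositions), $Q_n=q_1\cdots q_n=|s_n|=|t_n|$, $$\Delta(r_1,\dots,r_n)=[s_n^\infty,s_nt_n^\infty],\qquad \widetilde\Delta(r_1,\dots,r_n)=[s_nt_ns_n^\infty,s_nt_n^\infty].$$ Put $\mathcal S=(1/4,1/2)\setminus\bigcup_{r\in\mathbb Q\cap(0,1)}\Delta(r)$ and, for $n\ge2$, $\mathcal S_n(r_1,\dots,r_{n-1})=\widetilde\Delta(r_1,\dots,r_{n-1})\setminus\bigcup_{r_n\in\mathbb Q\cap(0,1)}\Delta(r_1,\dots,r_n)$. For an infinite sequence $\boldsymbol r=(r_1,r_2,\dots)\in(\mathbb Q\cap(0,1))^{\mathbb N}$ put $\mathfrak s(\boldsymbol r)=\lim_n\rho_{r_1}\cdots\rho_{r_n}(0)$ and $\mathfrak t(\boldsymbol r)=\lim_n\rho_{r_1}\cdots\rho_{r_n}(1)$ (coordinatewise limits). The function $\chi$ on $(1/4,1/2)$ is given by (every $a\in(1/4,1/2)$ falls under at least one case, and overlapping cases agree): (i) $\chi(a)=t_ns_n^\infty$ if $a\in[s_n^\infty,s_nt_ns_n^\infty]$ for some $n\ge1$ and $r_1,\dots,r_n$; (ii) $\chi(a)=a+1/4$ if $a\in\mathcal S$; (iii) $\chi(a)=a+(1-2^{-Q_{n-1}})(t_{n-1}-s_{n-1})$ if $a\in\mathcal S_n(r_1,\dots,r_{n-1})$, $n\ge2$; (iv)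 $\chi(a)=\mathfrak t(\boldsymbol r)$ if $a=\mathfrak s(\boldsymbol r)$. *)

theory Defs
  imports
    "HOL-Analysis.Analysis"
    "HOL-Library.Stream"
    "HOL-Library.Sublist"
    "HOL-Library.List_Lexorder"
begin

section \<open>Hausdorff dimension\<close>

text \<open>
  The contribution of one covering set to the \<open>s\<close>-dimensional Hausdorff sum, with the convention
  that nonempty sets contribute \<open>1\<close> when \<open>s = 0\<close> (whereas \<open>0 powr 0 = 0\<close>).
\<close>
definition hausdorff_weight :: "real \<Rightarrow> 'a::metric_space set \<Rightarrow> ennreal" where
  "hausdorff_weight s U =
     (if U = {} then 0 else if s = 0 then 1 else ennreal (diameter U powr s))"

text \<open>The value of \<^const>\<open>diameter\<close> is meaningless on unbounded sets, hence the boundedness condition.\<close>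
definition fine_covers :: "real \<Rightarrow> 'a::metric_space set \<Rightarrow> (nat \<Rightarrow> 'a set) set" where
  "fine_covers \<delta> A = {U. A \<subseteq> (\<Union>i. U i) \<and> (\<forall>i. bounded (U i) \<and> diameter (U i) \<le> \<delta>)}"

definition hausdorff_measure :: "real \<Rightarrow> 'a::metric_space set \<Rightarrow> ennreal" where
  "hausdorff_measure s A =
     (SUP \<delta>\<in>{0<..}. INF U\<in>fine_covers \<delta> A. \<Sum>i. hausdorff_weight s (U i))"

definition hausdorff_dim :: "'a::metric_space set \<Rightarrow> ennreal" where
  "hausdorff_dim A = (INF s\<in>{s. 0 \<le> s \<and> hausdorff_measure s A = 0}. ennreal s)"

section \<open>The doubling map with a hole\<close>

definition doubling :: "real \<Rightarrow> real" where
  "doubling x = (if x \<le> 1/2 then 2 * x else 2 * x - 1)"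

definition survivor_set :: "real \<Rightarrow> real \<Rightarrow> real set" where
  "survivor_set a b = {x \<in> {0..1}. \<forall>n. (doubling ^^ n) x \<notin> {a<..<b}}"

section \<open>Words\<close>

text \<open>
  The letters \<open>0\<close> and \<open>1\<close> are \<^const>\<open>False\<close> and \<^const>\<open>True\<close>. Finite words are lists and infinite
  words are streams, indexed from \<open>0\<close>; \<open>u\<^sup>\<infinity>\<close> is \<open>cycle u\<close>, and \<open>@-\<close> puts a finite word in front
  of an infinite one. Finite words are ordered lexicographically with \<^term>\<open>False < True\<close>.
\<close>

definition inf_val :: "bool stream \<Rightarrow> real" where
  "inf_val w = (\<Sum>n. of_bool (w !! n) / 2 ^ Suc n)"

definition fin_val :: "bool list \<Rightarrow> real" where
  "fin_val w = (\<Sum>n<length w. of_bool (w ! n) / 2 ^ Suc n)"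

abbreviation ones :: "bool list \<Rightarrow> nat" where
  "ones w \<equiv> count_list w True"

definition balanced :: "bool list \<Rightarrow> bool" where
  "balanced w \<longleftrightarrow> (\<forall>u v. sublist u w \<longrightarrow> sublist v w \<longrightarrow> length u = length v \<longrightarrow>
     \<bar>int (ones u) - int (ones v)\<bar> \<le> 1)"

definition cyclically_balanced :: "bool list \<Rightarrow> bool" where
  "cyclically_balanced w \<longleftrightarrow> balanced (w @ w)"

definition unit_rats :: "rat set" where
  "unit_rats = {0<..<1}"

text \<open>Numerator and denominator in lowest terms of a positive rational.\<close>
definition numer :: "rat \<Rightarrow> nat" where
  "numer r = nat (fst (quotient_of r))"

definition denom :: "rat \<Rightarrow> nat" where
  "denom r = nat (snd (quotient_of r))"

definition omega_minus :: "rat \<Rightarrow> bool list" where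
  "omega_minus r = Max {w. cyclically_balanced w \<and> length w = denom r \<and> ones w = numer r \<and> hd w = False}"

definition omega_plus :: "rat \<Rightarrow> bool list" where
  "omega_plus r = Min {w. cyclically_balanced w \<and> length w = denom r \<and> ones w = numer r \<and> hd w = True}"

definition rho :: "rat \<Rightarrow> bool list \<Rightarrow> bool list" where
  "rho r w = concat (map (\<lambda>c. if c then omega_plus r else omega_minus r) w)"

text \<open>
  For \<open>rs = [r\<^sub>1, \<dots>, r\<^sub>n]\<close>, \<open>foldr rho rs\<close> is the composition \<open>\<rho>\<^bsub>r\<^sub>1\<^esub> \<circ> \<dots> \<circ> \<rho>\<^bsub>r\<^sub>n\<^esub>\<close>, so that the outermost
  substitution is the one of the head of the list.
\<close>
definition s_word :: "rat list \<Rightarrow> bool list" where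
  "s_word rs = foldr rho rs [False]"

definition t_word :: "rat list \<Rightarrow> bool list" where
  "t_word rs = foldr rho rs [True]"

definition Q_len :: "rat list \<Rightarrow> nat" where
  "Q_len rs = prod_list (map denom rs)"

definition Delta :: "rat list \<Rightarrow> real set" where
  "Delta rs = {inf_val (cycle (s_word rs)) .. inf_val (s_word rs @- cycle (t_word rs))}"

definition Delta_tilde :: "rat list \<Rightarrow> real set" where
  "Delta_tilde rs =
     {inf_val (s_word rs @- t_word rs @- cycle (s_word rs)) .. inf_val (s_word rs @- cycle (t_word rs))}"

definition S_first :: "real set" where
  "S_first = {1/4<..<1/2} - (\<Union>r\<in>unit_rats. Delta [r])"

text \<open>\<open>S_next [r\<^sub>1, \<dots>, r\<^bsub>n-1\<^esub>]\<close> is the set \<open>S\<^sub>n(r\<^sub>1, \<dots>, r\<^bsub>n-1\<^esub>)\<close>, for \<open>n \<ge> 2\<close>.\<close>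
definition S_next :: "rat list \<Rightarrow> real set" where
  "S_next rs = Delta_tilde rs - (\<Union>r\<in>unit_rats. Delta (rs @ [r]))"

definition word_tendsto :: "(nat \<Rightarrow> bool list) \<Rightarrow> bool stream \<Rightarrow> bool" where
  "word_tendsto u w \<longleftrightarrow> (\<forall>k. \<forall>\<^sub>F n in sequentially. k < length (u n) \<and> u n ! k = w !! k)"

definition s_limit :: "(nat \<Rightarrow> rat) \<Rightarrow> bool stream" where
  "s_limit r = (THE w. word_tendsto (\<lambda>n. s_word (map r [0..<n])) w)"

definition t_limit :: "(nat \<Rightarrow> rat) \<Rightarrow> bool stream" where
  "t_limit r = (THE w. word_tendsto (\<lambda>n. t_word (map r [0..<n])) w)"

section \<open>The function \<open>\<chi>\<close>\<close>

text \<open>\<open>chi_graph a y\<close> says that one of the four cases applies to \<open>a\<close> and prescribes the value \<open>y\<close>.\<close>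
inductive chi_graph :: "real \<Rightarrow> real \<Rightarrow> bool" where
  plateau: "chi_graph a (inf_val (t_word rs @- cycle (s_word rs)))"
    if "rs \<noteq> []" "set rs \<subseteq> unit_rats"
       "a \<in> {inf_val (cycle (s_word rs)) .. inf_val (s_word rs @- t_word rs @- cycle (s_word rs))}"
| first: "chi_graph a (a + 1/4)"
    if "a \<in> S_first"
| next_level: "chi_graph a (a + (1 - 1 / 2 ^ Q_len rs) * (fin_val (t_word rs) - fin_val (s_word rs)))"
    if "rs \<noteq> []" "set rs \<subseteq> unit_rats" "a \<in> S_next rs"
| limit: "chi_graph a (inf_val (t_limit r))"
    if "range r \<subseteq> unit_rats" "a = inf_val (s_limit r)"

text \<open>Only the values on \<open>(1/4, 1/2)\<close> are meaningful.\<close>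
definition chi :: "real \<Rightarrow> real" where
  "chi a = (THE y. chi_graph a y)"

end

(* A word avoids the hole (a, b) iff all its shifts starting with 0 are at most the expansion of a and
   all shifts starting with 1 are at least that of b. If the bounds are images under the substitution
   0 -> u, 1 -> v of the bounds of another hole, then up to countably many words such a word is a finite
   prefix followed by the image of a word avoiding that hole; so everything can be renormalized. This
   holds for the three substitutions (0, 10), (01, 1), (01, 10), hence for all compositions, and every
   rho_r is a composition of the first two (the Euclidean algorithm for r) followed by the third.
   Above the threshold the dimension vanishes: on a plateau only eventually periodic words survive; off
   the plateaus at most one word of each length extends to the left in both ways, so the complexity is
   at most n + 1; in the limit case the surviving words are images under substitutions of arbitrarily
   large length. Below the threshold one finds a pair (u, v) such that all concatenations of u and v
   survive. In particular every value prescribed by chi_graph is the threshold, so chi is well defined. *)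
theory Submission
  imports Defs
begin

text \<open>The statement concerns real numbers, while renormalization needs words. The two orders
  disagree only at dyadic rationals, and these do no harm: the hole contains 1/2, so no orbit of a
  survivor meets 1/2. For a renormalizing pair, u v^\<infinity> and v u^\<infinity> are the images
  of 01^\<infinity> and 10^\<infinity>, the largest word beginning with 0 and the smallest beginning
  with 1. By the property \<open>pres\<close>, every concatenation of u and v avoids the hole
  between them. So positive dimension only asks for a pair with u v^\<infinity> at most a and v
  u^\<infinity> at least b, and each threshold is a limit of such upper ends over pairs whose lower
  ends stay at most a. Formulas (ii) and (iii) have one source: if a = s t \<gamma>, the threshold
  is t s \<gamma>, and exchanging two blocks of length Q adds (1 - 2^-Q)(t - s). Formula (ii) is the
  case of the empty sequence, with s = 0, t = 1, Q = 1.\<close>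

section \<open>The lexicographic order on infinite words\<close>

instantiation stream :: (linorder) linorder
begin

definition less_stream :: "'a stream \<Rightarrow> 'a stream \<Rightarrow> bool" where
  "x < y \<longleftrightarrow> (\<exists>n. stake n x = stake n y \<and> x !! n < y !! n)"

definition less_eq_stream :: "'a stream \<Rightarrow> 'a stream \<Rightarrow> bool" where
  "x \<le> y \<longleftrightarrow> x < y \<or> x = (y :: 'a stream)"

lemma stake_eq_mono: "stake n x = stake n y \<Longrightarrow> m \<le> n \<Longrightarrow> stake m x = stake m y"
  by (metis min_def take_stake)

lemma stake_eq_nth: "stake n x = stake n y \<Longrightarrow> m < n \<Longrightarrow> x !! m = y !! m"
  by (metis stake_nth)

lemma less_stream_trans: "x < y \<Longrightarrow> y < z \<Longrightarrow> x < (z :: 'a stream)"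
proof -
  assume "x < y" "y < z"
  then obtain m n where m: "stake m x = stake m y" "x !! m < y !! m"
    and n: "stake n y = stake n z" "y !! n < z !! n"
    by (auto simp: less_stream_def)
  consider "m < n" | "m = n" | "n < m" by linarith
  then show "x < z"
  proof cases
    case 1
    then show ?thesis unfolding less_stream_def
      using m n(1) stake_eq_mono[OF n(1), of m] stake_eq_nth[OF n(1), of m]
      by (intro exI[of _ m]) auto
  next
    case 2
    then show ?thesis unfolding less_stream_def using m n
      by (intro exI[of _ m]) (auto intro: less_trans)
  next
    case 3
    then show ?thesis unfolding less_stream_def
      using n m(1) stake_eq_mono[OF m(1), of n] stake_eq_nth[OF m(1), of n]
      by (intro exI[of _ n]) auto
  qed
qed

instance
proof
  have irr: "\<not> x < x" for x :: "'a stream"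
    by (auto simp: less_stream_def)
  show "x < y \<longleftrightarrow> x \<le> y \<and> \<not> y \<le> x" for x y :: "'a stream"
    using less_stream_trans[of x y x] irr by (auto simp: less_eq_stream_def)
  show "x \<le> x" for x :: "'a stream"
    by (simp add: less_eq_stream_def)
  show "x \<le> y \<Longrightarrow> y \<le> z \<Longrightarrow> x \<le> z" for x y z :: "'a stream"
    using less_stream_trans by (auto simp: less_eq_stream_def)
  show "x \<le> y \<Longrightarrow> y \<le> x \<Longrightarrow> x = y" for x y :: "'a stream"
    using less_stream_trans[of x y x] irr by (auto simp: less_eq_stream_def)
  show "x \<le> y \<or> y \<le> x" for x y :: "'a stream"
  proof (cases "x = y")
    case False
    then have ex: "\<exists>n. x !! n \<noteq> y !! n"
      by (metis smap_alt stream.map_ident)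
    define n where "n = (LEAST n. x !! n \<noteq> y !! n)"
    have n: "x !! n \<noteq> y !! n" unfolding n_def using ex by (rule LeastI_ex)
    have "\<And>m. m < n \<Longrightarrow> x !! m = y !! m" unfolding n_def using not_less_Least by blast
    then have "stake n x = stake n y" by (intro nth_equalityI) auto
    with n show ?thesis unfolding less_eq_stream_def less_stream_def
      by (metis linorder_neqE)
  qed (simp add: less_eq_stream_def)
qed

end

lemma less_stream_Cons [simp]: "a ## x < b ## y \<longleftrightarrow> a < b \<or> a = b \<and> x < y"
proof
  assume "a ## x < b ## y"
  then obtain n where n: "stake n (a ## x) = stake n (b ## y)" "(a ## x) !! n < (b ## y) !! n"
    by (auto simp: less_stream_def)
  then show "a < b \<or> a = b \<and> x < y"
    by (cases n) (auto simp: less_stream_def)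
next
  assume "a < b \<or> a = b \<and> x < y"
  then show "a ## x < b ## y"
  proof
    assume "a < b"
    then show ?thesis unfolding less_stream_def by (intro exI[of _ 0]) simp
  next
    assume "a = b \<and> x < y"
    then obtain n where "a = b" "stake n x = stake n y" "x !! n < y !! n"
      by (auto simp: less_stream_def)
    then show ?thesis unfolding less_stream_def by (intro exI[of _ "Suc n"]) simp
  qed
qed

lemma le_stream_Cons [simp]: "a ## x \<le> b ## y \<longleftrightarrow> a < b \<or> a = b \<and> x \<le> y"
  by (auto simp: order.order_iff_strict)

lemma less_stream_shift [simp]: "w @- x < w @- y \<longleftrightarrow> x < y"
  by (induction w) auto

lemma le_stream_shift [simp]: "w @- x \<le> w @- y \<longleftrightarrow> x \<le> y"
  by (induction w) auto

lemma less_streamE: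
  fixes x y :: "bool stream"
  assumes "x < y"
  obtains w x' y' where "x = w @- False ## x'" "y = w @- True ## y'"
proof -
  from assms obtain n where n: "stake n x = stake n y" "x !! n < y !! n"
    by (auto simp: less_stream_def)
  then have "x = stake n x @- False ## sdrop (Suc n) x" "y = stake n x @- True ## sdrop (Suc n) y"
    by (metis id_stake_snth_sdrop less_bool_def)+
  then show ?thesis using that by blast
qed

lemma sconst_eq: "sconst a = a ## sconst a"
  by (subst siterate.ctr) simp

lemma sconst_False_le [simp]: "sconst False \<le> x"
proof (rule ccontr)
  assume "\<not> ?thesis"
  then have "x < sconst False" by simp
  then obtain n where "x !! n < sconst False !! n" unfolding less_stream_def by blast
  then show False by simp
qed

lemma le_sconst_True [simp]: "x \<le> sconst True"
proof (rule ccontr)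
  assume "\<not> ?thesis"
  then have "sconst True < x" by simp
  then obtain n where "sconst True !! n < x !! n" unfolding less_stream_def by blast
  then show False by simp
qed

text \<open>Up to a first difference each letter of \<open>x\<close> repeats the one before it,
  starting from the added 0. So these letters are all 0, and the difference cannot go the wrong way.
  This serves to compare a shift starting inside a block with one at a block boundary.\<close>

lemma False_Cons_le [simp]: "False ## x \<le> (x :: bool stream)"
proof (rule ccontr)
  assume "\<not> ?thesis"
  then have *: "x < False ## x" by simp
  have "\<not> x !! n" for n
  proof (induction n rule: less_induct)
    case (less n)
    from * obtain m where m: "stake m x = stake m (False ## x)" "x !! m < (False ## x) !! m"
      unfolding less_stream_def by blast
    then have m': "\<not> x !! m" "(False ## x) !! m" by auto
    show ?case
    proof (cases "n < m")
      case True
      have "x !! n = (False ## x) !! n" using stake_eq_nth[OF m(1) True] .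
      then show ?thesis using less by (cases n) auto
    next
      case False
      from m' obtain k where "m = Suc k" "x !! k" by (cases m) auto
      with less False show ?thesis by auto
    qed
  qed
  moreover from * obtain m where "(False ## x) !! m" unfolding less_stream_def by auto
  then obtain k where "x !! k" by (cases m) auto
  ultimately show False by blast
qed

lemma le_True_Cons [simp]: "x \<le> True ## (x :: bool stream)"
proof (rule ccontr)
  assume "\<not> ?thesis"
  then have *: "True ## x < x" by simp
  have "x !! n" for n
  proof (induction n rule: less_induct)
    case (less n)
    from * obtain m where m: "stake m (True ## x) = stake m x" "(True ## x) !! m < x !! m"
      unfolding less_stream_def by blast
    then have m': "x !! m" "\<not> (True ## x) !! m" by auto
    show ?case
    proof (cases "n < m")
      case True
      have "x !! n = (True ## x) !! n" using stake_eq_nth[OF m(1) True] by simp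
      then show ?thesis using less by (cases n) auto
    next
      case False
      from m' obtain k where "m = Suc k" "\<not> x !! k" by (cases m) auto
      with less False show ?thesis by auto
    qed
  qed
  moreover from * obtain m where "\<not> (True ## x) !! m" unfolding less_stream_def by auto
  then obtain k where "\<not> x !! k" by (cases m) auto
  ultimately show False by blast
qed

lemma stream_eqI_stake: "(\<And>n. stake n x = stake n y) \<Longrightarrow> x = y"
  by (subst stream.map_ident[symmetric], subst smap_alt) (use stake_eq_nth lessI in blast)

lemma stream_eq_cycleI:
  assumes "u \<noteq> []" "x = u @- x" shows "x = cycle u"
proof (rule stream_eqI_stake)
  fix n show "stake n x = stake n (cycle u)"
  proof (induction n rule: less_induct)
    case (less n)
    have "stake n x = take n u @ stake (n - length u) x"
      by (subst assms(2)) (rule stake_shift)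
    also have "stake (n - length u) x = stake (n - length u) (cycle u)"
      using less assms(1) by (cases "n = 0") auto
    also have "take n u @ \<dots> = stake n (cycle u)"
      by (subst (2) cycle_decomp[OF assms(1)]) (rule stake_shift[symmetric])
    finally show ?case .
  qed
qed

section \<open>Values of words\<close>

lemma summable_inf_val: "summable (\<lambda>n. of_bool (w !! n) / 2 ^ Suc n :: real)"
proof (rule summable_comparison_test')
  show "summable (\<lambda>n. (1/2) ^ n :: real)" by (simp add: summable_geometric)
  show "norm (of_bool (w !! n) / 2 ^ Suc n :: real) \<le> (1/2) ^ n" for n
    by (auto simp: power_one_over field_simps)
qed

lemma inf_val_Cons [simp]: "inf_val (b ## x) = (of_bool b + inf_val x) / 2"
proof -
  have "inf_val (b ## x) = of_bool b / 2 + (\<Sum>n. of_bool (x !! n) / 2 ^ Suc (Suc n))"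
    unfolding inf_val_def using suminf_split_head[OF summable_inf_val[of "b ## x"]] by simp
  also have "(\<Sum>n. of_bool (x !! n) / 2 ^ Suc (Suc n)) = (\<Sum>n. (of_bool (x !! n) / 2 ^ Suc n) / 2 :: real)"
    by simp
  also have "\<dots> = inf_val x / 2"
    unfolding inf_val_def by (rule suminf_divide[OF summable_inf_val])
  finally show ?thesis by (simp add: add_divide_distrib)
qed

lemma inf_val_nonneg [simp]: "0 \<le> inf_val x"
  unfolding inf_val_def by (intro suminf_nonneg summable_inf_val) simp

lemma inf_val_le_1 [simp]: "inf_val x \<le> 1"
proof -
  have "inf_val x \<le> (\<Sum>n. (1/2) ^ Suc n)"
    unfolding inf_val_def
    by (intro suminf_le summable_inf_val sums_summable[OF power_half_series])
       (auto simp: power_one_over field_simps)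
  also have "\<dots> = 1" using power_half_series sums_unique by fastforce
  finally show ?thesis .
qed

lemma fin_val_Nil [simp]: "fin_val [] = 0"
  by (simp add: fin_val_def)

lemma fin_val_Cons [simp]: "fin_val (b # w) = (of_bool b + fin_val w) / 2"
proof -
  have "fin_val (b # w) = (\<Sum>n<Suc (length w). of_bool ((b # w) ! n) / 2 ^ Suc n)"
    by (simp add: fin_val_def)
  also have "\<dots> = of_bool b / 2 + (\<Sum>n<length w. of_bool (w ! n) / 2 ^ Suc n / 2)"
    by (subst sum.lessThan_Suc_shift) (simp add: ac_simps)
  finally show ?thesis by (simp add: fin_val_def sum_divide_distrib add_divide_distrib)
qed

lemma inf_val_shift: "inf_val (w @- x) = fin_val w + inf_val x / 2 ^ length w"
  by (induction w) (simp_all add: add_divide_distrib ac_simps)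

lemma inf_val_sconst [simp]: "inf_val (sconst False) = 0" "inf_val (sconst True) = 1"
proof -
  show "inf_val (sconst False) = 0" using inf_val_Cons[of False "sconst False"] by (simp flip: sconst_eq)
  show "inf_val (sconst True) = 1" using inf_val_Cons[of True "sconst True"] by (simp flip: sconst_eq)
qed

lemma inf_val_mono: "x \<le> y \<Longrightarrow> inf_val x \<le> inf_val (y :: bool stream)"
proof -
  assume "x \<le> y"
  then consider "x = y" | "x < y" by force
  then show ?thesis
  proof cases
    case 2
    then obtain w x' y' where "x = w @- False ## x'" "y = w @- True ## y'" by (rule less_streamE)
    moreover have "inf_val x' \<le> 1 + inf_val y'"
      using inf_val_le_1[of x'] inf_val_nonneg[of y'] by linarith
    ultimately show ?thesis by (simp add: inf_val_shift divide_le_cancel)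
  qed simp
qed

text \<open>The order on words and the order of their values only disagree at the two expansions of a
  dyadic rational, that is, at words with a shift of value \<open>1/2\<close>.\<close>

lemma inf_val_eq_half:
  fixes x y :: "bool stream"
  assumes "x < y" "inf_val y \<le> inf_val x"
  shows "\<exists>n. inf_val (sdrop n x) = 1/2" "\<exists>n. inf_val (sdrop n y) = 1/2"
proof -
  from assms(1) obtain w x' y' where w: "x = w @- False ## x'" "y = w @- True ## y'"
    by (rule less_streamE)
  with assms(2) have "1 + inf_val y' \<le> inf_val x'" by (simp add: inf_val_shift divide_le_cancel)
  then have "inf_val x' = 1" "inf_val y' = 0"
    using inf_val_le_1[of x'] inf_val_nonneg[of y'] by linarith+
  then have "inf_val (sdrop (length w) x) = 1/2" "inf_val (sdrop (length w) y) = 1/2"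
    using w by (auto simp: sdrop_shift)
  then show "\<exists>n. inf_val (sdrop n x) = 1/2" "\<exists>n. inf_val (sdrop n y) = 1/2" by blast+
qed

lemma inf_val_dist_prefix: "\<bar>inf_val (w @- x) - inf_val (w @- y)\<bar> \<le> 1 / 2 ^ length w"
proof -
  have "\<bar>inf_val x - inf_val y\<bar> \<le> 1"
    using inf_val_le_1[of x] inf_val_le_1[of y] inf_val_nonneg[of x] inf_val_nonneg[of y] by linarith
  then have "\<bar>inf_val x - inf_val y\<bar> / 2 ^ length w \<le> 1 / 2 ^ length w"
    by (rule divide_right_mono) simp
  moreover have "inf_val (w @- x) - inf_val (w @- y) = (inf_val x - inf_val y) / 2 ^ length w"
    by (simp add: inf_val_shift diff_divide_distrib)
  ultimately show ?thesis by (simp add: abs_divide)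
qed

lemma doubling_bounds: "x \<in> {0..1} \<Longrightarrow> doubling x \<in> {0..1}"
  by (auto simp: doubling_def)

text \<open>The digit at 1/2 is 0, in accordance with the branch that \<open>doubling\<close> takes
  there. So dropping a digit always amounts to applying \<open>doubling\<close>; positive dyadic
  rationals get the expansion ending in 1s.\<close>

definition expansion :: "real \<Rightarrow> bool stream" where
  "expansion x = smap (\<lambda>y. y > 1/2) (siterate doubling x)"

lemma sdrop_expansion: "sdrop n (expansion x) = expansion ((doubling ^^ n) x)"
  by (simp add: expansion_def)

lemma expansion_eq: "expansion x = (x > 1/2) ## expansion (doubling x)"
  unfolding expansion_def by (subst siterate.ctr) simp

text \<open>Both sides lie in \<open>{0..1}\<close>, and removing one digit doubles their
  difference.\<close>

lemma inf_val_expansion: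
  assumes "x \<in> {0..1}" shows "inf_val (expansion x) = x"
proof -
  have *: "\<bar>inf_val (expansion x) - x\<bar> \<le> 1 / 2 ^ n" if "x \<in> {0..1}" for n x
    using that
  proof (induction n arbitrary: x)
    case 0
    then show ?case using inf_val_le_1[of "expansion x"] inf_val_nonneg[of "expansion x"]
      by (auto simp: abs_le_iff simp del: inf_val_le_1 inf_val_nonneg)
  next
    case (Suc n)
    have "inf_val (expansion x) - x = (inf_val (expansion (doubling x)) - doubling x) / 2"
      by (subst expansion_eq) (auto simp: doubling_def field_simps)
    with Suc.IH[OF doubling_bounds[OF Suc.prems]] show ?case by (simp add: abs_divide)
  qed
  have "(\<lambda>n. 1 / 2 ^ n :: real) \<longlonglongrightarrow> 0"
    using LIMSEQ_realpow_zero[of "1/2 :: real"] by (simp add: power_one_over)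
  then have "\<bar>inf_val (expansion x) - x\<bar> \<le> 0"
    by (rule LIMSEQ_le_const) (use *[OF assms] in auto)
  then show ?thesis by simp
qed

section \<open>Substitutions\<close>

definition lmor :: "'a list \<Rightarrow> 'a list \<Rightarrow> bool list \<Rightarrow> 'a list" where
  "lmor u v w = concat (map (\<lambda>c. if c then v else u) w)"

definition smor :: "'a list \<Rightarrow> 'a list \<Rightarrow> bool stream \<Rightarrow> 'a stream" where
  "smor u v x = flat (smap (\<lambda>c. if c then v else u) x)"

lemma lmor_simps [simp]:
  "lmor u v [] = []"
  "lmor u v (c # w) = (if c then v else u) @ lmor u v w"
  "lmor u v (w @ w') = lmor u v w @ lmor u v w'"
  by (auto simp: lmor_def)

lemma lmor_id [simp]: "lmor [False] [True] w = w"
  by (induction w) auto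

lemma lmor_lmor: "lmor u v (lmor u' v' w) = lmor (lmor u v u') (lmor u v v') w"
  by (induction w) auto

lemma lmor_eq_Nil_iff: "u \<noteq> [] \<Longrightarrow> v \<noteq> [] \<Longrightarrow> lmor u v w = [] \<longleftrightarrow> w = []"
  by (cases w) auto

lemma foldr_lmor:
  "foldr (\<lambda>d. lmor (U d) (V d)) ds w =
   lmor (foldr (\<lambda>d. lmor (U d) (V d)) ds [False]) (foldr (\<lambda>d. lmor (U d) (V d)) ds [True]) w"
proof (induction ds arbitrary: w)
  case (Cons d ds)
  let ?f = "\<lambda>w. foldr (\<lambda>d. lmor (U d) (V d)) ds w"
  have "?f w = lmor (?f [False]) (?f [True]) w" by (rule Cons.IH)
  then show ?case by (simp only: foldr_Cons o_apply lmor_lmor)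
qed simp

lemma length_lmor_ge:
  assumes "Q \<le> length u" "Q \<le> length v"
  shows "Q * length w \<le> length (lmor u v w)"
proof (induction w)
  case (Cons c w)
  with assms show ?case by (cases c) auto
qed simp

lemma smor_Cons [simp]:
  "u \<noteq> [] \<Longrightarrow> v \<noteq> [] \<Longrightarrow> smor u v (c ## x) = (if c then v else u) @- smor u v x"
  by (simp add: smor_def)

lemma smor_shift: "u \<noteq> [] \<Longrightarrow> v \<noteq> [] \<Longrightarrow> smor u v (w @- x) = lmor u v w @- smor u v x"
  by (induction w) auto

lemma smor_cycle:
  assumes "u \<noteq> []" "v \<noteq> []" "w \<noteq> []"
  shows "smor u v (cycle w) = cycle (lmor u v w)"
proof (rule stream_eq_cycleI)
  show "lmor u v w \<noteq> []" using assms by (simp add: lmor_eq_Nil_iff)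
  show "smor u v (cycle w) = lmor u v w @- smor u v (cycle w)"
    by (subst cycle_decomp[OF assms(3)]) (rule smor_shift[OF assms(1,2)])
qed

lemma smor_sconst:
  assumes "u \<noteq> []" "v \<noteq> []"
  shows "smor u v (sconst c) = cycle (if c then v else u)"
  using smor_cycle[OF assms, of "[c]"] by (simp add: sconst_cycle)

lemma stream_eqI_chain:
  assumes "\<And>n. \<exists>w x' y'. n \<le> length w \<and> x = w @- x' \<and> y = w @- y'"
  shows "x = y"
proof (rule stream_eqI_stake)
  fix n
  from assms obtain w x' y' where "n \<le> length w" "x = w @- x'" "y = w @- y'" by blast
  then show "stake n x = stake n y" by (simp add: stake_shift)
qed

lemma smor_split:
  assumes "u \<noteq> []" "v \<noteq> []"
  shows "smor u v x = lmor u v (stake n x) @- smor u v (sdrop n x)"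
  using smor_shift[OF assms, of "stake n x" "sdrop n x"] by (simp add: stake_sdrop)

lemma length_lmor_stake:
  assumes "u \<noteq> []" "v \<noteq> []"
  shows "n \<le> length (lmor u v (stake n x))"
proof -
  have "1 \<le> length u" "1 \<le> length v" using assms by (auto simp: Suc_le_eq)
  from length_lmor_ge[OF this, of "stake n x"] show ?thesis by simp
qed

lemma smor_smor:
  assumes "u \<noteq> []" "v \<noteq> []" "u' \<noteq> []" "v' \<noteq> []"
  shows "smor u v (smor u' v' x) = smor (lmor u v u') (lmor u v v') x"
proof (rule stream_eqI_chain)
  fix n
  have ne: "lmor u v u' \<noteq> []" "lmor u v v' \<noteq> []" using assms by (simp_all add: lmor_eq_Nil_iff)
  have "smor u v (smor u' v' x) = lmor u v (lmor u' v' (stake n x)) @- smor u v (smor u' v' (sdrop n x))"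
    by (subst smor_split[OF assms(3,4), of x n]) (simp add: smor_shift assms)
  moreover have "smor (lmor u v u') (lmor u v v') x =
      lmor (lmor u v u') (lmor u v v') (stake n x) @- smor (lmor u v u') (lmor u v v') (sdrop n x)"
    by (rule smor_split[OF ne])
  ultimately show "\<exists>w x' y'. n \<le> length w \<and> smor u v (smor u' v' x) = w @- x' \<and>
      smor (lmor u v u') (lmor u v v') x = w @- y'"
    using length_lmor_stake[OF ne, of n x] by (auto simp: lmor_lmor)
qed

lemma smor_id [simp]: "smor [False] [True] x = x"
proof (rule stream_eqI_chain)
  fix n
  have "smor [False] [True] x = stake n x @- smor [False] [True] (sdrop n x)"
    by (subst smor_split[of _ _ x n]) simp_all
  moreover have "x = stake n x @- sdrop n x" by (rule stake_sdrop[symmetric])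
  ultimately show "\<exists>w x' y'. n \<le> length w \<and> smor [False] [True] x = w @- x' \<and> x = w @- y'"
    by (metis length_stake order_refl)
qed

text \<open>These first letters make the substitution strictly monotone on infinite words: the first
  difference of two words becomes the first difference of their images.\<close>

locale ordered_sub =
  fixes u v :: "bool list"
  assumes hd_u: "\<exists>w. u = False # w" and hd_v: "\<exists>w. v = True # w"
begin

lemma ne [simp]: "u \<noteq> []" "v \<noteq> []"
  using hd_u hd_v by auto

lemma smor_less [simp]: "smor u v x < smor u v y \<longleftrightarrow> x < y"
proof -
  have *: "smor u v x < smor u v y" if "x < y" for x y
    using that
  proof (rule less_streamE)
    fix w x' y' assume "x = w @- False ## x'" "y = w @- True ## y'"
    with hd_u hd_v show "smor u v x < smor u v y" by (auto simp: smor_shift)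
  qed
  show ?thesis using * by (metis linorder_less_linear order_less_imp_not_less)
qed

lemma smor_le [simp]: "smor u v x \<le> smor u v y \<longleftrightarrow> x \<le> y"
  using smor_less[of y x] by (simp only: not_less[symmetric])

lemma shd_smor [simp]: "shd (smor u v x) = shd x"
  using hd_u hd_v by (cases x) auto

lemma snth_0_smor: "smor u v x = shd x ## stl (smor u v x)"
proof -
  have "smor u v x = shd (smor u v x) ## stl (smor u v x)" by (rule stream.collapse[symmetric])
  then show ?thesis unfolding shd_smor .
qed

lemma lmor_hd: "\<exists>w'. lmor u v (c # w) = c # w'"
  using hd_u hd_v by auto

end

lemma ordered_sub_comp:
  assumes "ordered_sub u v" "ordered_sub u' v'"
  shows "ordered_sub (lmor u v u') (lmor u v v')"
proof -
  interpret ordered_sub u v by fact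
  interpret o': ordered_sub u' v' by fact
  show ?thesis using o'.hd_u o'.hd_v lmor_hd by (auto simp: ordered_sub_def simp del: lmor_simps)
qed

text \<open>These words absorb the exceptions of every renormalization step. They are countably
  many, hence invisible to the dimension.\<close>

definition evper :: "'a stream \<Rightarrow> bool" where
  "evper x \<longleftrightarrow> (\<exists>w c. c \<noteq> [] \<and> x = w @- cycle c)"

lemma evper_shift: "evper x \<Longrightarrow> evper (w @- x)"
  unfolding evper_def by (metis shift_append)

lemma evper_sdropD: "evper (sdrop n x) \<Longrightarrow> evper x"
  using evper_shift[of "sdrop n x" "stake n x"] by (simp add: stake_sdrop)

lemma evper_cycle: "c \<noteq> [] \<Longrightarrow> evper (cycle c)"
  unfolding evper_def by (intro exI[of _ "[]"] exI[of _ c]) auto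

lemma evper_sconst [simp]: "evper (sconst c)"
  by (simp add: sconst_cycle evper_cycle)

lemma evper_smor:
  assumes "evper x" "u \<noteq> []" "v \<noteq> []" shows "evper (smor u v x)"
proof -
  from assms(1) obtain w c where "c \<noteq> []" "x = w @- cycle c" by (auto simp: evper_def)
  then show ?thesis using assms by (simp add: smor_shift smor_cycle evper_shift evper_cycle lmor_eq_Nil_iff)
qed

lemma countable_evper: "countable {x :: 'a :: countable stream. evper x}"
proof -
  have "{x :: 'a stream. evper x} \<subseteq> (\<lambda>(w, c). w @- cycle c) ` UNIV"
    by (auto simp: evper_def)
  then show ?thesis by (rule countable_subset) simp
qed

text \<open>The ends of the hole are words, and the first letter of a shift decides which end it is
  compared with. Avoidance thus becomes a pair of one-sided bounds, which monotone substitutions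
  carry along.\<close>

definition avoids :: "bool stream \<Rightarrow> bool stream \<Rightarrow> bool stream \<Rightarrow> bool" where
  "avoids \<alpha> \<beta> x \<longleftrightarrow> (\<forall>n. if x !! n then \<beta> \<le> sdrop n x else sdrop n x \<le> \<alpha>)"

lemma avoids_mono: "avoids \<alpha> \<beta> x \<Longrightarrow> \<alpha> \<le> \<alpha>' \<Longrightarrow> \<beta>' \<le> \<beta> \<Longrightarrow> avoids \<alpha>' \<beta>' x"
  unfolding avoids_def by (meson order_trans)

lemma avoids_sdrop: "avoids \<alpha> \<beta> x \<Longrightarrow> avoids \<alpha> \<beta> (sdrop n x)"
  unfolding avoids_def by (simp add: sdrop_snth)

lemma avoids_shiftD: "avoids \<alpha> \<beta> (w @- x) \<Longrightarrow> avoids \<alpha> \<beta> x"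
  using avoids_sdrop[of \<alpha> \<beta> "w @- x" "length w"] by (simp add: sdrop_shift)

lemma avoids_False: "avoids \<alpha> \<beta> (False ## x) \<Longrightarrow> False ## x \<le> \<alpha>"
  unfolding avoids_def by (drule spec[of _ 0]) simp

lemma avoids_True: "avoids \<alpha> \<beta> (True ## x) \<Longrightarrow> \<beta> \<le> True ## x"
  unfolding avoids_def by (drule spec[of _ 0]) simp

text \<open>Shifts of the image at block boundaries are images of shifts of \<open>x\<close> with
  the same first letters, and monotonicity reflects the bounds.\<close>

lemma (in ordered_sub) avoids_smorD:
  assumes "avoids (smor u v \<alpha>) (smor u v \<beta>) (smor u v x)" shows "avoids \<alpha> \<beta> x"
  unfolding avoids_def
proof
  fix n
  have *: "avoids (smor u v \<alpha>) (smor u v \<beta>) (smor u v (sdrop n x))"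
    using assms unfolding smor_split[OF ne, of x n] by (rule avoids_shiftD)
  show "if x !! n then \<beta> \<le> sdrop n x else sdrop n x \<le> \<alpha>"
    using *[unfolded avoids_def, rule_format, of 0] by (simp split: if_splits)
qed

text \<open>The two properties of a substitution which make it a renormalization: it maps words with all
  shifts in \<open>[\<beta>, \<alpha>]\<close> to such words for the renormalized bounds, and conversely all words
  avoiding the renormalization of the hole \<open>(01\<^sup>\<infinity>, 10\<^sup>\<infinity>)\<close>, which every word avoids, are
  eventually periodic or, up to a finite prefix, in its image.\<close>

locale renorm = ordered_sub +
  assumes pres: "(\<And>n. \<beta> \<le> sdrop n x \<and> sdrop n x \<le> \<alpha>) \<Longrightarrow>
      stl (smor u v (True ## \<beta>)) \<le> sdrop n (smor u v x) \<and>
      sdrop n (smor u v x) \<le> stl (smor u v (False ## \<alpha>))"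
    and desub: "avoids (smor u v (False ## sconst True)) (smor u v (True ## sconst False)) x \<Longrightarrow>
      evper x \<or> (\<exists>w y. x = w @- smor u v y)"

text \<open>The inner substitution does not increase 01^\<infinity> and does not decrease
  10^\<infinity>, so the composed hole contains the outer one. A word avoiding it can be
  desubstituted by the outer pair; the preimage avoids the inner hole and can be desubstituted
  again.\<close>

lemma renorm_comp:
  assumes "renorm u v" "renorm u' v'"
  shows "renorm (lmor u v u') (lmor u v v')"
proof -
  interpret renorm u v by fact
  interpret r': renorm u' v' by fact
  interpret c: ordered_sub "lmor u v u'" "lmor u v v'"
    by (intro ordered_sub_comp) (unfold_locales)
  have comp: "smor (lmor u v u') (lmor u v v') x = smor u v (smor u' v' x)" for x
    by (simp add: smor_smor)
  show ?thesis
  proof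
    fix \<alpha> \<beta> x :: "bool stream" and n :: nat
    assume bd: "\<And>m. \<beta> \<le> sdrop m x \<and> sdrop m x \<le> \<alpha>"
    let ?\<alpha> = "stl (smor u' v' (False ## \<alpha>))" and ?\<beta> = "stl (smor u' v' (True ## \<beta>))"
    have "?\<beta> \<le> sdrop m (smor u' v' x) \<and> sdrop m (smor u' v' x) \<le> ?\<alpha>" for m
      by (rule r'.pres) (rule bd)
    then have "stl (smor u v (True ## ?\<beta>)) \<le> sdrop n (smor u v (smor u' v' x)) \<and>
      sdrop n (smor u v (smor u' v' x)) \<le> stl (smor u v (False ## ?\<alpha>))"
      by (rule pres)
    \<comment> \<open>The leading letter is kept by \<open>smor u' v'\<close>, so putting it back in
      front of a tail restores a full image. The tails in \<open>pres\<close> are what makes the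
      property compose.\<close>
    moreover have "True ## ?\<beta> = smor u' v' (True ## \<beta>)" "False ## ?\<alpha> = smor u' v' (False ## \<alpha>)"
      by (subst (2) r'.snth_0_smor, simp only: stream.sel)+
    ultimately show "stl (smor (lmor u v u') (lmor u v v') (True ## \<beta>)) \<le> sdrop n (smor (lmor u v u') (lmor u v v') x) \<and>
      sdrop n (smor (lmor u v u') (lmor u v v') x) \<le> stl (smor (lmor u v u') (lmor u v v') (False ## \<alpha>))"
      unfolding comp by (simp only:)
  next
    fix x assume *: "avoids (smor (lmor u v u') (lmor u v v') (False ## sconst True))
      (smor (lmor u v u') (lmor u v v') (True ## sconst False)) x"
    have "smor u' v' (False ## sconst True) \<le> False ## sconst True"
      by (subst r'.snth_0_smor) (simp only: stream.sel le_stream_Cons le_sconst_True simp_thms)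
    moreover have "True ## sconst False \<le> smor u' v' (True ## sconst False)"
      by (subst r'.snth_0_smor) (simp only: stream.sel le_stream_Cons sconst_False_le simp_thms)
    ultimately have "avoids (smor u v (False ## sconst True)) (smor u v (True ## sconst False)) x"
      unfolding comp by (intro avoids_mono[OF *[unfolded comp]]) (simp_all only: smor_le)
    from desub[OF this] consider "evper x" | w y where "x = w @- smor u v y" by blast
    then show "evper x \<or> (\<exists>w y. x = w @- smor (lmor u v u') (lmor u v v') y)"
    proof cases
      case 2
      have "avoids (smor u' v' (False ## sconst True)) (smor u' v' (True ## sconst False)) y"
        using * unfolding 2 comp by (rule avoids_smorD[OF avoids_shiftD])
      from r'.desub[OF this] show ?thesis
      proof
        assume "evper y"
        then show ?thesis unfolding 2 by (simp add: evper_shift evper_smor)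
      next
        assume "\<exists>w' y'. y = w' @- smor u' v' y'"
        then obtain w' y' where "y = w' @- smor u' v' y'" by blast
        then have "x = (w @ lmor u v w') @- smor (lmor u v u') (lmor u v v') y'"
          unfolding 2 comp by (simp add: smor_shift)
        then show ?thesis by blast
      qed
    qed simp
  qed
qed

lemma renorm_id: "renorm [False] [True]"
proof
  fix \<alpha> \<beta> x :: "bool stream" and n :: nat
  assume "\<And>m. \<beta> \<le> sdrop m x \<and> sdrop m x \<le> \<alpha>"
  then show "stl (smor [False] [True] (True ## \<beta>)) \<le> sdrop n (smor [False] [True] x) \<and>
      sdrop n (smor [False] [True] x) \<le> stl (smor [False] [True] (False ## \<alpha>))"
    by (simp only: smor_id stream.sel)
next
  fix x :: "bool stream"
  have "x = [] @- smor [False] [True] x" by simp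
  then show "evper x \<or> (\<exists>w y. x = w @- smor [False] [True] y)" by blast
qed simp_all

section \<open>Shifts of images, and recognizing a word as an image\<close>

lemma sdrop_smor_cases:
  assumes "u \<noteq> []" "v \<noteq> []"
  obtains k m where "k < length (if x !! m then v else u)"
    "sdrop n (smor u v x) = drop k (if x !! m then v else u) @- smor u v (sdrop (Suc m) x)"
proof -
  have "\<exists>k m. k < length (if x !! m then v else u) \<and>
    sdrop n (smor u v x) = drop k (if x !! m then v else u) @- smor u v (sdrop (Suc m) x)"
  proof (induction n)
    case 0
    show ?case using assms smor_Cons[OF assms, of "shd x" "stl x"]
      by (intro exI[of _ 0]) auto
  next
    case (Suc n)
    then obtain k m where km: "k < length (if x !! m then v else u)"
      "sdrop n (smor u v x) = drop k (if x !! m then v else u) @- smor u v (sdrop (Suc m) x)" by blast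
    let ?b = "if x !! m then v else u"
    have "sdrop (Suc n) (smor u v x) = stl (sdrop n (smor u v x))" by simp
    also have "\<dots> = drop (Suc k) ?b @- smor u v (sdrop (Suc m) x)"
      using km by (simp add: drop_Suc tl_drop)
    finally have *: "sdrop (Suc n) (smor u v x) = drop (Suc k) ?b @- smor u v (sdrop (Suc m) x)" .
    show ?case
    proof (cases "Suc k < length ?b")
      case True
      with * show ?thesis by blast
    next
      case False
      with * have "sdrop (Suc n) (smor u v x) = smor u v (sdrop (Suc m) x)" by simp
      also have "\<dots> = smor u v (x !! Suc m ## sdrop (Suc (Suc m)) x)"
        by (metis sdrop_simps stream.collapse)
      finally show ?thesis using assms by (intro exI[of _ 0] exI[of _ "Suc m"]) auto
    qed
  qed
  then show ?thesis using that by blast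
qed

text \<open>Coinduction: cutting off one block at a time never leaves \<open>Z\<close>, and the
  sequence of the choices made spells the preimage.\<close>

lemma smor_ex:
  assumes "u \<noteq> []" "v \<noteq> []" "z \<in> Z"
    and "\<And>z. z \<in> Z \<Longrightarrow> \<exists>c. \<exists>z'\<in>Z. z = (if c then v else u) @- z'"
  shows "\<exists>y. z = smor u v y"
proof -
  from assms(4) obtain c f where cf: "\<And>z. z \<in> Z \<Longrightarrow> f z \<in> Z \<and> z = (if c z then v else u) @- f z"
    by metis
  have "z = smor u v (smap c (siterate f z))"
  proof (rule stream_eqI_chain)
    fix n
    have *: "\<exists>z'. z = lmor u v (stake n (smap c (siterate f z))) @- z'" if "z \<in> Z" for z
      using that
    proof (induction n arbitrary: z)
      case (Suc n)
      from Suc.IH[of "f z"] cf[OF Suc.prems]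
      obtain z' where z': "f z = lmor u v (stake n (smap c (siterate f (f z)))) @- z'" by blast
      have "z = (if c z then v else u) @- f z" using cf[OF Suc.prems] by blast
      also have "\<dots> = lmor u v (stake (Suc n) (smap c (siterate f z))) @- z'"
        by (subst z') (simp del: stake_siterate)
      finally show ?case by blast
    qed simp
    from *[OF assms(3)] obtain z' where "z = lmor u v (stake n (smap c (siterate f z))) @- z'" by blast
    with smor_split[OF assms(1,2), of "smap c (siterate f z)" n]
      length_lmor_stake[OF assms(1,2), of n "smap c (siterate f z)"]
    show "\<exists>w x' y'. n \<le> length w \<and> z = w @- x' \<and> smor u v (smap c (siterate f z)) = w @- y'"
      by blast
  qed
  then show ?thesis by blast
qed

section \<open>The generating substitutions\<close>

lemma sdrop_Cons_eq: "sdrop m x = x !! m ## sdrop (Suc m) x"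
  by (metis sdrop_simps stream.collapse)

lemma cycle_FT: "cycle [False, True] = False ## True ## cycle [False, True]"
  using cycle_decomp[of "[False, True]"] by simp

lemma cycle_TF: "cycle [True, False] = True ## False ## cycle [True, False]"
  using cycle_decomp[of "[True, False]"] by simp

text \<open>The lower end 0(10)^\<infinity> of the hole forbids the factor 011. So after its first 0
  a word has no two adjacent 1s and splits into the blocks 0 and 10; a word without 0 is
  constant.\<close>

lemma renorm_tau0: "renorm [False] [True, False]"
proof -
  interpret ordered_sub "[False]" "[True, False]" by unfold_locales auto
  let ?S = "smor [False] [True, False]"
  show ?thesis
  proof
    fix \<alpha> \<beta> x :: "bool stream" and n :: nat
    assume bd: "\<And>m. \<beta> \<le> sdrop m x \<and> sdrop m x \<le> \<alpha>"
    have low: "False ## ?S \<beta> \<le> ?S y" if "\<beta> \<le> y" for y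
      using that order_trans[OF False_Cons_le, of "?S \<beta>" "?S y"] by simp
    obtain k m where km: "k < length (if x !! m then [True, False] else [False])"
      "sdrop n (?S x) = drop k (if x !! m then [True, False] else [False]) @- ?S (sdrop (Suc m) x)"
      by (rule sdrop_smor_cases[of "[False]" "[True, False]"]) simp_all
    have x: "sdrop m x = x !! m ## sdrop (Suc m) x" by (rule sdrop_Cons_eq)
    show "stl (?S (True ## \<beta>)) \<le> sdrop n (?S x) \<and> sdrop n (?S x) \<le> stl (?S (False ## \<alpha>))"
    proof (cases "k = 0")
      case True
      then have "sdrop n (?S x) = ?S (sdrop m x)" using km by (subst x) simp
      then show ?thesis using bd[of m] low by simp
    next
      case False
      then have "sdrop n (?S x) = False ## ?S (sdrop (Suc m) x)"
        using km by (cases "x !! m"; cases k) auto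
      moreover have "?S (sdrop (Suc m) x) \<le> ?S \<alpha>" using bd[of "Suc m"] by simp
      then have "False ## ?S (sdrop (Suc m) x) \<le> ?S \<alpha>" by (rule order_trans[OF False_Cons_le])
      ultimately show ?thesis using bd[of "Suc m"] by simp
    qed
  next
    fix x assume av: "avoids (?S (False ## sconst True)) (?S (True ## sconst False)) x"
    have S: "?S (False ## sconst True) = False ## True ## False ## cycle [True, False]"
      using cycle_TF by (simp add: smor_sconst)
    have no: "\<not> (\<not> x !! n \<and> x !! Suc n \<and> x !! Suc (Suc n))" for n
    proof
      assume n: "\<not> x !! n \<and> x !! Suc n \<and> x !! Suc (Suc n)"
      then have "sdrop n x = False ## True ## True ## sdrop (Suc (Suc (Suc n))) x"
        by (metis sdrop_Cons_eq)
      with av n show False unfolding avoids_def S by (auto dest!: spec[of _ n])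
    qed
    show "evper x \<or> (\<exists>w y. x = w @- ?S y)"
    proof (cases "\<exists>k. \<not> x !! k")
      case False
      then have "x = sconst True" by (intro stream_eqI_stake nth_equalityI) auto
      then show ?thesis by simp
    next
      case True
      then obtain k where k: "\<not> x !! k" by blast
      define Z where "Z = {z :: bool stream. \<forall>n. \<not> (z !! n \<and> z !! Suc n)}"
      have "\<not> (x !! (k + n) \<and> x !! Suc (k + n))" for n
      proof (induction n)
        case (Suc n)
        then show ?case using no[of "k + n"] by auto
      qed (use k in simp)
      then have "sdrop k x \<in> Z" by (simp add: Z_def sdrop_snth)
      then have "\<exists>y. sdrop k x = ?S y"
      proof (rule smor_ex[rotated 2])
        fix z assume z: "z \<in> Z"
        have z0: "z = shd z ## stl z" by simp
        show "\<exists>c. \<exists>z'\<in>Z. z = (if c then [True, False] else [False]) @- z'"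
        proof (cases "shd z")
          case False
          have "stl z \<in> Z" using z by (auto simp: Z_def dest: spec[of _ "Suc _"])
          with False z0 show ?thesis by (intro exI[of _ False]) (auto intro!: bexI[of _ "stl z"])
        next
          case True
          then have "\<not> shd (stl z)" using z by (auto simp: Z_def dest: spec[of _ 0])
          moreover have "stl (stl z) \<in> Z" using z by (auto simp: Z_def dest: spec[of _ "Suc (Suc _)"])
          moreover have "z = shd z ## shd (stl z) ## stl (stl z)" by simp
          ultimately show ?thesis using True
            by (intro exI[of _ True]) (auto intro!: bexI[of _ "stl (stl z)"])
        qed
      qed simp_all
      then show ?thesis by (metis stake_sdrop)
    qed
  qed
qed

text \<open>This mirrors the pair (0, 10) under exchange of the letters: the upper end
  1(01)^\<infinity> forbids 100, so there are no two adjacent 0s after the first 1.\<close>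

lemma renorm_tau1: "renorm [False, True] [True]"
proof -
  interpret ordered_sub "[False, True]" "[True]" by unfold_locales auto
  let ?S = "smor [False, True] [True]"
  show ?thesis
  proof
    fix \<alpha> \<beta> x :: "bool stream" and n :: nat
    assume bd: "\<And>m. \<beta> \<le> sdrop m x \<and> sdrop m x \<le> \<alpha>"
    have up: "?S y \<le> True ## ?S \<alpha>" if "y \<le> \<alpha>" for y
      using that order_trans[OF _ le_True_Cons, of "?S y" "?S \<alpha>"] by simp
    obtain k m where km: "k < length (if x !! m then [True] else [False, True])"
      "sdrop n (?S x) = drop k (if x !! m then [True] else [False, True]) @- ?S (sdrop (Suc m) x)"
      by (rule sdrop_smor_cases[of "[False, True]" "[True]"]) simp_all
    have x: "sdrop m x = x !! m ## sdrop (Suc m) x" by (rule sdrop_Cons_eq)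
    show "stl (?S (True ## \<beta>)) \<le> sdrop n (?S x) \<and> sdrop n (?S x) \<le> stl (?S (False ## \<alpha>))"
    proof (cases "k = 0")
      case True
      then have "sdrop n (?S x) = ?S (sdrop m x)" using km by (subst x) simp
      then show ?thesis using bd[of m] up by simp
    next
      case False
      then have "sdrop n (?S x) = True ## ?S (sdrop (Suc m) x)"
        using km by (cases "x !! m"; cases k) auto
      moreover have "?S \<beta> \<le> ?S (sdrop (Suc m) x)" using bd[of "Suc m"] by simp
      then have "?S \<beta> \<le> True ## ?S (sdrop (Suc m) x)" by (rule order_trans[OF _ le_True_Cons])
      ultimately show ?thesis using bd[of "Suc m"] by simp
    qed
  next
    fix x assume av: "avoids (?S (False ## sconst True)) (?S (True ## sconst False)) x"
    have S: "?S (True ## sconst False) = True ## False ## True ## cycle [False, True]"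
      using cycle_FT by (simp add: smor_sconst)
    have no: "\<not> (x !! n \<and> \<not> x !! Suc n \<and> \<not> x !! Suc (Suc n))" for n
    proof
      assume n: "x !! n \<and> \<not> x !! Suc n \<and> \<not> x !! Suc (Suc n)"
      then have "sdrop n x = True ## False ## False ## sdrop (Suc (Suc (Suc n))) x"
        by (metis sdrop_Cons_eq)
      with av n show False unfolding avoids_def S by (auto dest!: spec[of _ n])
    qed
    show "evper x \<or> (\<exists>w y. x = w @- ?S y)"
    proof (cases "\<exists>k. x !! k")
      case False
      then have "x = sconst False" by (intro stream_eqI_stake nth_equalityI) auto
      then show ?thesis by simp
    next
      case True
      then obtain k where k: "x !! k" by blast
      define Z where "Z = {z :: bool stream. \<forall>n. z !! n \<or> z !! Suc n}"
      have "x !! (k + n) \<or> x !! Suc (k + n)" for n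
      proof (induction n)
        case (Suc n)
        then show ?case using no[of "k + n"] by auto
      qed (use k in simp)
      then have "sdrop k x \<in> Z" by (simp add: Z_def sdrop_snth)
      then have "\<exists>y. sdrop k x = ?S y"
      proof (rule smor_ex[rotated 2])
        fix z assume z: "z \<in> Z"
        have z0: "z = shd z ## stl z" by simp
        show "\<exists>c. \<exists>z'\<in>Z. z = (if c then [True] else [False, True]) @- z'"
        proof (cases "shd z")
          case True
          have "stl z \<in> Z" using z by (auto simp: Z_def dest: spec[of _ "Suc _"])
          with True z0 show ?thesis by (intro exI[of _ True]) (auto intro!: bexI[of _ "stl z"])
        next
          case False
          then have "shd (stl z)" using z by (auto simp: Z_def dest: spec[of _ 0])
          moreover have "stl (stl z) \<in> Z" using z by (auto simp: Z_def dest: spec[of _ "Suc (Suc _)"])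
          moreover have "z = shd z ## shd (stl z) ## stl (stl z)" by simp
          ultimately show ?thesis using False
            by (intro exI[of _ False]) (auto intro!: bexI[of _ "stl (stl z)"])
        qed
      qed simp_all
      then show ?thesis by (metis stake_sdrop)
    qed
  qed
qed

lemma evper_alternating:
  assumes "\<And>n. k \<le> n \<Longrightarrow> x !! Suc n \<noteq> x !! n" shows "evper (x :: bool stream)"
proof -
  have "sdrop k x = [x !! k, x !! Suc k] @- sdrop k x"
  proof -
    have "sdrop (k + 2) x !! m = sdrop k x !! m" for m
      using assms[of "k + m"] assms[of "Suc (k + m)"] by (simp add: sdrop_snth) 
    then have "sdrop (k + 2) x = sdrop k x" by (intro stream_eqI_stake nth_equalityI) simp_all
    then show ?thesis using sdrop_Cons_eq[of k x] sdrop_Cons_eq[of "Suc k" x] by simp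
  qed
  then have "sdrop k x = cycle [x !! k, x !! Suc k]" by (intro stream_eq_cycleI) auto
  then have "evper (sdrop k x)" by (simp add: evper_cycle)
  then show ?thesis by (rule evper_sdropD)
qed

lemma replicate_shift_cycle: "concat (replicate j u) @- cycle u = cycle u" if "u \<noteq> []"
proof (induction j)
  case (Suc j)
  then show ?case using cycle_decomp[OF that] by simp
qed simp

text \<open>The set \<open>Z\<close> records that a block boundary has been reached: on its left are a block and a
  run of copies of the other block, which rules out \<open>00\<close> and \<open>11\<close> as the next two letters.\<close>

lemma renorm_half: "renorm [False, True] [True, False]"
proof -
  interpret ordered_sub "[False, True]" "[True, False]" by unfold_locales auto
  let ?u = "[False, True]" and ?v = "[True, False]"
  let ?S = "smor ?u ?v"
  show ?thesis
  proof
    fix \<alpha> \<beta> x :: "bool stream" and n :: nat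
    assume bd: "\<And>m. \<beta> \<le> sdrop m x \<and> sdrop m x \<le> \<alpha>"
    have low: "False ## ?S \<beta> \<le> ?S y" if "\<beta> \<le> y" for y
      using that order_trans[OF False_Cons_le, of "?S \<beta>" "?S y"] by simp
    have up: "?S y \<le> True ## ?S \<alpha>" if "y \<le> \<alpha>" for y
      using that order_trans[OF _ le_True_Cons, of "?S y" "?S \<alpha>"] by simp
    obtain k m where km: "k < length (if x !! m then ?v else ?u)"
      "sdrop n (?S x) = drop k (if x !! m then ?v else ?u) @- ?S (sdrop (Suc m) x)"
      by (rule sdrop_smor_cases[of ?u ?v]) simp_all
    have x: "sdrop m x = x !! m ## sdrop (Suc m) x" by (rule sdrop_Cons_eq)
    show "stl (?S (True ## \<beta>)) \<le> sdrop n (?S x) \<and> sdrop n (?S x) \<le> stl (?S (False ## \<alpha>))"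
    proof (cases "k = 0")
      case True
      then have "sdrop n (?S x) = ?S (sdrop m x)" using km by (subst x) simp
      then show ?thesis using bd[of m] up low by simp
    next
      case False
      then have "sdrop n (?S x) = (\<not> x !! m) ## ?S (sdrop (Suc m) x)"
        using km by (cases "x !! m"; cases k) auto
      then show ?thesis using bd[of "Suc m"] by (cases "x !! m") auto
    qed
  next
    fix x assume "avoids (?S (False ## sconst True)) (?S (True ## sconst False)) x"
    then have av: "avoids (?u @- cycle ?v) (?v @- cycle ?u) x" by (simp add: smor_sconst)
    let ?av = "avoids (?u @- cycle ?v) (?v @- cycle ?u)"
    \<comment> \<open>A word without the factors 011 and 100 is constant, or alternates from its
      first change of letter on.\<close>
    show "evper x \<or> (\<exists>w y. x = w @- ?S y)"
    proof (cases "\<exists>k. x !! k \<noteq> x !! Suc k \<and> x !! Suc k = x !! Suc (Suc k)")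
      case False
      show ?thesis
      proof (cases "\<exists>k. x !! k \<noteq> x !! Suc k")
        case True
        then obtain k where k: "x !! k \<noteq> x !! Suc k" by blast
        have "x !! Suc n \<noteq> x !! n" if "k \<le> n" for n
          using that
        proof (induction rule: dec_induct)
          case (step m)
          with False show ?case by metis
        qed (use k in simp)
        then show ?thesis using evper_alternating by blast
      next
        case False
        then have "x !! n = x !! 0" for n by (induction n) auto
        then have "x = sconst (x !! 0)" by (intro stream_eqI_stake nth_equalityI) auto
        then show ?thesis by (metis evper_sconst)
      qed
    next
      case True
      define Z where "Z = {z. \<exists>j. ?av (?u @- concat (replicate (Suc j) ?v) @- z) \<or>
        ?av (?v @- concat (replicate (Suc j) ?u) @- z)}"
      from True obtain k where k: "x !! k \<noteq> x !! Suc k" "x !! Suc k = x !! Suc (Suc k)" by blast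
      have xk: "sdrop k x = x !! k ## (\<not> x !! k) ## (\<not> x !! k) ## x !! (k + 3) ## sdrop (k + 4) x"
        using k sdrop_Cons_eq[of k x] sdrop_Cons_eq[of "Suc k" x] sdrop_Cons_eq[of "k + 2" x]
          sdrop_Cons_eq[of "k + 3" x] by (auto simp: numeral_eq_Suc)
      have avk: "?av (sdrop k x)" using av by (rule avoids_sdrop)
      \<comment> \<open>After 100 or 011, a further equal letter would give 1000, which is below
        10(01)^\<infinity>, or 0111, which is above 01(10)^\<infinity>. So two different complete
        blocks have been read.\<close>
      have "x !! (k + 3) = x !! k"
      proof (cases "x !! k")
        case True
        show ?thesis
        proof (rule ccontr)
          assume "x !! (k + 3) \<noteq> x !! k"
          with True xk have "sdrop k x = True ## False ## False ## False ## sdrop (k + 4) x" by simp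
          with avk have "?v @- cycle ?u \<le> True ## False ## False ## False ## sdrop (k + 4) x"
            by (metis avoids_True)
          then show False by (subst (asm) cycle_FT) simp
        qed
      next
        case False
        show ?thesis
        proof (rule ccontr)
          assume "x !! (k + 3) \<noteq> x !! k"
          with False xk have "sdrop k x = False ## True ## True ## True ## sdrop (k + 4) x" by simp
          with avk have "False ## True ## True ## True ## sdrop (k + 4) x \<le> ?u @- cycle ?v"
            by (metis avoids_False)
          then show False by (subst (asm) cycle_TF) simp
        qed
      qed
      with xk have "sdrop (k + 4) x \<in> Z"
        using avk unfolding Z_def by (cases "x !! k") (auto intro!: exI[of _ 0])
      then have "\<exists>y. sdrop (k + 4) x = ?S y"
      proof (rule smor_ex[rotated 2])
        fix z assume "z \<in> Z"
        then obtain j where j: "?av (?u @- concat (replicate (Suc j) ?v) @- z) \<or>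
           ?av (?v @- concat (replicate (Suc j) ?u) @- z)" unfolding Z_def by blast
        have rep: "concat (replicate (Suc i) w) @- y = concat (replicate i w) @- w @- y" for w :: "bool list" and i y
          by (subst replicate_Suc, subst replicate_append_same[symmetric]) simp
        \<comment> \<open>One bound on \<open>z\<close> comes from the whole factor, by cancelling
          the run against the periodic end of the hole. The other comes from the last block of the
          run alone. Together they exclude 00 and 11.\<close>
        have "cycle ?u \<le> z \<and> z \<le> cycle ?v \<and> (?av (?v @- z) \<or> ?av (?u @- z))"
          using j
        proof
          assume j: "?av (?u @- concat (replicate (Suc j) ?v) @- z)"
          then have "?u @- concat (replicate (Suc j) ?v) @- z \<le> ?u @- concat (replicate (Suc j) ?v) @- cycle ?v"
            using avoids_False[of "?u @- cycle ?v" "?v @- cycle ?u" "True ## concat (replicate (Suc j) ?v) @- z"]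
            by (simp only: replicate_shift_cycle shift.simps list.distinct not_False_eq_True)
          then have "z \<le> cycle ?v" by (simp only: le_stream_shift)
          moreover have v: "?av (?v @- z)"
            using j unfolding rep by (blast dest: avoids_shiftD)
          then have "?v @- cycle ?u \<le> ?v @- z"
            using avoids_True[of _ "?v @- cycle ?u" "False ## z"] by simp
          ultimately show ?thesis using v by simp
        next
          assume j: "?av (?v @- concat (replicate (Suc j) ?u) @- z)"
          then have "?v @- concat (replicate (Suc j) ?u) @- cycle ?u \<le> ?v @- concat (replicate (Suc j) ?u) @- z"
            using avoids_True[of "?u @- cycle ?v" "?v @- cycle ?u" "False ## concat (replicate (Suc j) ?u) @- z"]
            by (simp only: replicate_shift_cycle shift.simps list.distinct not_False_eq_True)
          then have "cycle ?u \<le> z" by (simp only: le_stream_shift)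
          moreover have v: "?av (?u @- z)"
            using j unfolding rep by (blast dest: avoids_shiftD)
          then have "?u @- z \<le> ?u @- cycle ?v"
            using avoids_False[of "?u @- cycle ?v" _ "True ## z"] by simp
          ultimately show ?thesis using v by simp
        qed
        then have bds: "cycle ?u \<le> z" "z \<le> cycle ?v" by auto
        define a b z' where "a = shd z" and "b = shd (stl z)" and "z' = stl (stl z)"
        then have z: "z = a ## b ## z'" by simp
        have "a \<noteq> b"
          using bds unfolding z by (subst (asm) cycle_TF, subst (asm) cycle_FT) auto
        then consider "z = ?v @- z'" | "z = ?u @- z'" using z by (cases a; cases b) auto
        then show "\<exists>c. \<exists>z'\<in>Z. z = (if c then ?v else ?u) @- z'"
        proof cases
          case 1
          \<comment> \<open>A block equal to those of the run prolongs it. Otherwise the last block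
            of the run and the new block start a fresh run of length one.\<close>
          have "z' \<in> Z"
          proof (cases "?av (?u @- concat (replicate (Suc j) ?v) @- z)")
            case True
            then have "?av (?u @- concat (replicate (Suc (Suc j)) ?v) @- z')"
              unfolding rep[of "Suc j"] 1 .
            then show ?thesis unfolding Z_def by blast
          next
            case False
            with j have "?av (?u @- z)" unfolding rep by (blast dest: avoids_shiftD)
            then show ?thesis unfolding Z_def 1 by (auto intro!: exI[of _ 0])
          qed
          with 1 show ?thesis by (intro exI[of _ True]) auto
        next
          case 2
          have "z' \<in> Z"
          proof (cases "?av (?v @- concat (replicate (Suc j) ?u) @- z)")
            case True
            then have "?av (?v @- concat (replicate (Suc (Suc j)) ?u) @- z')"
              unfolding rep[of "Suc j"] 2 .
            then show ?thesis unfolding Z_def by blast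
          next
            case False
            with j have "?av (?v @- z)" unfolding rep by (blast dest: avoids_shiftD)
            then show ?thesis unfolding Z_def 2 by (auto intro!: exI[of _ 0])
          qed
          with 2 show ?thesis by (intro exI[of _ False]) auto
        qed
      qed simp_all
      then show ?thesis by (metis stake_sdrop)
    qed
  qed
qed

section \<open>Cyclically balanced words\<close>

text \<open>For \<open>r = p / (m + p)\<close>, both words \<open>\<omega>\<^sub>r\<^sup>\<plusminus>\<close> are codings of the rotation by \<open>m\<close> on
  \<open>{0..<m + p}\<close>, started at \<open>p\<close> and at \<open>p - 1\<close>.\<close>

fun walk :: "nat \<Rightarrow> nat \<Rightarrow> nat \<Rightarrow> nat \<Rightarrow> bool list" where
  "walk m p f 0 = []"
| "walk m p f (Suc n) = (if p \<le> f then False # walk m p (f - p) n else True # walk m p (f + m) n)"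

lemma length_walk [simp]: "length (walk m p f n) = n"
  by (induction n arbitrary: f) auto

text \<open>A letter 0 lowers the position by \<open>p\<close>, and a letter 1 changes it by
  \<open>m + p\<close> minus \<open>p\<close>. So the positions at both ends determine the number of
  1s in between.\<close>

lemma walk_split:
  assumes "f < m + p"
  shows "\<exists>g<m + p. f + (m + p) * ones (walk m p f n) = g + p * n \<and>
    (\<forall>k. walk m p f (n + k) = walk m p f n @ walk m p g k)"
  using assms
proof (induction n arbitrary: f)
  case (Suc n)
  show ?case
  proof (cases "p \<le> f")
    case True
    with Suc.prems have "f - p < m + p" by linarith
    from Suc.IH[OF this] True show ?thesis by auto
  next
    case False
    then have "f + m < m + p" by linarith
    from Suc.IH[OF this] False show ?thesis by auto
  qed
qed auto

lemma div_mod_unique_nat: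
  fixes f g q x y :: nat
  assumes "f < q" "g < q" "f + q * x = g + q * y"
  shows "x = y \<and> g = f"
proof -
  have "(f + q * x) div q = x" "(g + q * y) div q = y" using assms(1,2) by simp_all
  then have "x = y" using assms(3) by simp
  with assms(3) show ?thesis by simp
qed

text \<open>After \<open>m + p\<close> steps the position is congruent to the initial one modulo
  \<open>m + p\<close>, hence equal to it.\<close>

lemma walk_period:
  assumes "f < m + p"
  shows "ones (walk m p f (m + p)) = p" "walk m p f (m + p + k) = walk m p f (m + p) @ walk m p f k"
proof -
  from walk_split[OF assms, of "m + p"] obtain g where g: "g < m + p"
    "f + (m + p) * ones (walk m p f (m + p)) = g + p * (m + p)"
    "\<And>k. walk m p f (m + p + k) = walk m p f (m + p) @ walk m p g k" by blast
  have "ones (walk m p f (m + p)) = p \<and> g = f"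
    using div_mod_unique_nat[OF assms g(1), of _ p] g(2) unfolding mult.commute[of p "m + p"] by blast
  with g(3) show "ones (walk m p f (m + p)) = p"
    "walk m p f (m + p + k) = walk m p f (m + p) @ walk m p f k" by blast+
qed

lemma sublist_walk:
  assumes "f < m + p" "sublist u (walk m p f n)"
  shows "\<exists>g<m + p. u = walk m p g (length u)"
proof -
  from assms(2) obtain a b where ab: "walk m p f n = a @ u @ b" by (auto simp: sublist_def)
  then have n: "n = length a + (length u + length b)" by (metis length_append length_walk)
  from walk_split[OF assms(1), of "length a"] obtain g where g: "g < m + p"
    "\<And>k. walk m p f (length a + k) = walk m p f (length a) @ walk m p g k" by blast
  have "a @ u @ b = walk m p f (length a) @ walk m p g (length u + length b)"
    using ab g(2) n by simp
  then have ub: "u @ b = walk m p g (length u + length b)" by (metis append_eq_append_conv length_walk)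
  from walk_split[OF g(1), of "length u"] obtain h where
    "\<And>k. walk m p g (length u + k) = walk m p g (length u) @ walk m p h k" by blast
  with ub have "u = walk m p g (length u)" by (metis append_eq_append_conv length_walk)
  with g(1) show ?thesis by blast
qed

text \<open>For factors of equal length, \<open>m + p\<close> times the difference of their numbers
  of 1s is a signed sum of four positions in \<open>{0..<m + p}\<close>, two of each sign. It is
  therefore smaller than \<open>2 * (m + p)\<close> in absolute value.\<close>

lemma balanced_walk:
  assumes "f < m + p" shows "balanced (walk m p f n)"
  unfolding balanced_def
proof (intro allI impI)
  fix u v assume "sublist u (walk m p f n)" "sublist v (walk m p f n)" and l: "length u = length v"
  then obtain g h where gh: "g < m + p" "h < m + p" "u = walk m p g (length u)" "v = walk m p h (length u)"
    using sublist_walk[OF assms] by metis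
  from walk_split[OF gh(1), of "length u"] gh(3) obtain g' where
    g': "g' < m + p" "g + (m + p) * ones u = g' + p * length u" by metis
  from walk_split[OF gh(2), of "length u"] gh(4) obtain h' where
    h': "h' < m + p" "h + (m + p) * ones v = h' + p * length u" by metis
  define q where "q = int (m + p)"
  have "int g + q * int (ones u) = int g' + int p * int (length u)"
    "int h + q * int (ones v) = int h' + int p * int (length u)"
    using g'(2) h'(2) unfolding q_def by (metis of_nat_add of_nat_mult)+
  then have "q * (int (ones u) - int (ones v)) = int g' - int g + int h - int h'"
    by (simp add: algebra_simps)
  moreover have "int g' - int g + int h - int h' < q * 2" "- (q * 2) < int g' - int g + int h - int h'"
  proof -
    have "int g' < q" "int h' < q" "int g < q" "int h < q"
      using g'(1) h'(1) gh(1,2) unfolding q_def by simp_all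
    then show "int g' - int g + int h - int h' < q * 2" "- (q * 2) < int g' - int g + int h - int h'"
      by linarith+
  qed
  ultimately have "q * (int (ones u) - int (ones v)) < q * 2" "q * (- 2) < q * (int (ones u) - int (ones v))"
    by auto
  moreover have "0 < q" using assms unfolding q_def by linarith
  ultimately show "\<bar>int (ones u) - int (ones v)\<bar> \<le> 1"
    unfolding mult_less_cancel_left_pos[OF \<open>0 < q\<close>] by linarith
qed

lemma cyclically_balanced_walk:
  assumes "f < m + p" shows "cyclically_balanced (walk m p f (m + p))"
  unfolding cyclically_balanced_def walk_period(2)[OF assms, symmetric] by (rule balanced_walk[OF assms])

section \<open>Prefix counts and the extremal cyclically balanced words\<close>

lemma ones_eq_sum: "ones w = (\<Sum>i<length w. of_bool (w ! i))"
  by (induction w) (simp_all add: sum.lessThan_Suc_shift del: sum.lessThan_Suc)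

text \<open>Double counting: every letter of the cyclic word lies in exactly \<open>k\<close> of the
  windows. After exchanging the sums, the inner ones count the 1s of rotations of
  \<open>w\<close>.\<close>

lemma sum_windows:
  assumes "k \<le> length w"
  shows "(\<Sum>i<length w. ones (take k (drop i (w @ w)))) = k * ones w"
proof -
  let ?W = "w @ w" and ?q = "length w"
  have win: "ones (take l (drop i ?W)) = (\<Sum>j<l. of_bool (?W ! (i + j)))" if "i \<le> ?q" "l \<le> ?q" for i l
  proof -
    have "length (take l (drop i ?W)) = l" using that by simp
    then show ?thesis unfolding ones_eq_sum using that
      by (intro sum.cong) (simp_all del: drop_append take_append)
  qed
  have "(\<Sum>i<?q. ones (take k (drop i ?W))) = (\<Sum>i<?q. \<Sum>j<k. of_bool (?W ! (i + j)))"
    using assms by (intro sum.cong) (auto simp: win simp del: drop_append take_append)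
  also have "\<dots> = (\<Sum>j<k. \<Sum>i<?q. of_bool (?W ! (j + i)))"
    by (subst sum.swap) (simp add: add.commute)
  also have "\<dots> = (\<Sum>j<k. ones (take ?q (drop j ?W)))"
    using assms by (intro sum.cong) (auto simp: win simp del: drop_append take_append)
  also have "\<dots> = (\<Sum>j<k. ones w)"
  proof (intro sum.cong refl)
    fix j assume "j \<in> {..<k}"
    then have "j \<le> ?q" using assms by simp
    then have "take ?q (drop j ?W) = drop j w @ take j w" by simp
    then show "ones (take ?q (drop j ?W)) = ones w"
      using append_take_drop_id[of j w] by (metis add.commute count_list_append)
  qed
  finally show ?thesis by simp
qed

text \<open>The mean count over all windows is \<open>k * ones w\<close> divided by the length, and
  any two counts differ by at most 1. The inequalities are strict because the window
  \<open>x\<close> itself contributes no difference.\<close>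

lemma cyclically_balanced_window:
  assumes "cyclically_balanced w" "i < length w" "k \<le> length w"
  defines "x \<equiv> take k (drop i (w @ w))"
  shows "length w * ones x < k * ones w + length w" "k * ones w < length w * ones x + length w"
proof -
  let ?q = "length w" and ?c = "\<lambda>j. ones (take k (drop j (w @ w)))"
  have near: "?c j \<le> ones x + 1" "ones x \<le> ?c j + 1" if "j < ?q" for j
  proof -
    have sub: "sublist (take k (drop j (w @ w))) (w @ w)" "sublist x (w @ w)"
      unfolding x_def by (meson sublist_drop sublist_order.order_trans sublist_take)+
    moreover have "length (take k (drop j (w @ w))) = length x"
      using that assms(2,3) unfolding x_def by simp
    ultimately have "\<bar>int (?c j) - int (ones x)\<bar> \<le> 1"
      using assms(1) unfolding cyclically_balanced_def balanced_def by blast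
    then show "?c j \<le> ones x + 1" "ones x \<le> ?c j + 1" by linarith+
  qed
  have card: "(\<Sum>j\<in>{..<?q} - {i}. c) = (?q - 1) * c" for c :: nat
    using assms(2) by simp
  have tot: "k * ones w = ones x + (\<Sum>j\<in>{..<?q} - {i}. ?c j)"
    unfolding sum_windows[OF assms(3), symmetric] x_def using assms(2) by (subst sum.remove[of _ i]) auto
  have q: "?q * ones x = ones x + (?q - 1) * ones x" using assms(2) by (cases w) auto
  have "(\<Sum>j\<in>{..<?q} - {i}. ones x) \<le> (\<Sum>j\<in>{..<?q} - {i}. ?c j + 1)"
    by (intro sum_mono near(2)) auto
  then have "(?q - 1) * ones x \<le> (\<Sum>j\<in>{..<?q} - {i}. ?c j) + (?q - 1)"
    unfolding sum.distrib card by simp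
  then show "?q * ones x < k * ones w + ?q" using q tot assms(2) by linarith
  have "(\<Sum>j\<in>{..<?q} - {i}. ?c j) \<le> (\<Sum>j\<in>{..<?q} - {i}. ones x + 1)"
    by (intro sum_mono near(1)) auto
  then have "(\<Sum>j\<in>{..<?q} - {i}. ?c j) \<le> (?q - 1) * ones x + (?q - 1)"
    unfolding card by simp
  then show "k * ones w < ?q * ones x + ?q" using q tot assms(2) by linarith
qed

lemma le_list_if_ones_le:
  fixes w u :: "bool list"
  assumes "length w = length u" "\<And>n. n \<le> length w \<Longrightarrow> ones (take n w) \<le> ones (take n u)"
  shows "w \<le> u"
  using assms
proof (induction w u rule: list_induct2)
  case (Cons a w b u)
  from Cons.prems[of 1] have "a \<le> b" by (auto split: if_splits)
  show ?case
  proof (cases "a = b")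
    case True
    have "w \<le> u"
    proof (rule Cons.IH)
      fix n assume "n \<le> length w"
      then show "ones (take n w) \<le> ones (take n u)" using Cons.prems[of "Suc n"] True by (auto split: if_splits)
    qed
    with True show ?thesis by simp
  qed (use \<open>a \<le> b\<close> in auto)
qed simp

lemma take_walk:
  assumes "f < m + p" "n \<le> k" shows "take n (walk m p f k) = walk m p f n"
proof -
  from walk_split[OF assms(1), of n] obtain g where
    "\<And>k. walk m p f (n + k) = walk m p f n @ walk m p g k" by blast
  from this[of "k - n"] assms(2) show ?thesis by simp
qed

lemma finite_cyclically_balanced:
  "finite {w. cyclically_balanced w \<and> length w = q \<and> ones w = p \<and> hd w = b}"
proof (rule finite_subset)
  show "finite {w. set w \<subseteq> (UNIV :: bool set) \<and> length w = q}" by (rule finite_lists_length_eq) simp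
qed auto

text \<open>Write q = m + p. In a word 0w', the first k letters of w' contain fewer than kp/q + 1
  ones. The walk from \<open>p\<close> reads 0, arrives at position 0, and from there its counts are
  the ceilings of kp/q, the largest values allowed.\<close>

lemma Max_cyclically_balanced:
  assumes "0 < m" "0 < p"
  shows "Max {w. cyclically_balanced w \<and> length w = m + p \<and> ones w = p \<and> hd w = False} =
    walk m p p (m + p)"
proof (rule Max_eqI[OF finite_cyclically_balanced])
  have lt: "p < m + p" using assms by simp
  show "walk m p p (m + p) \<in> {w. cyclically_balanced w \<and> length w = m + p \<and> ones w = p \<and> hd w = False}"
    using lt assms walk_period(1)[OF lt] by (auto simp: cyclically_balanced_walk) (cases "m + p"; simp)
  fix w assume "w \<in> {w. cyclically_balanced w \<and> length w = m + p \<and> ones w = p \<and> hd w = False}"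
  then have w: "cyclically_balanced w" "length w = m + p" "ones w = p" "hd w = False" by auto
  then obtain w' where w': "w = False # w'" using assms by (cases w) auto
  show "w \<le> walk m p p (m + p)"
  proof (rule le_list_if_ones_le)
    fix n assume n: "n \<le> length w"
    show "ones (take n w) \<le> ones (take n (walk m p p (m + p)))"
    proof (cases n)
      case (Suc k)
      have "take k (drop 1 (w @ w)) = take k w'" using n Suc w' by simp
      moreover have "1 < length w" using w(2) assms by simp
      ultimately have "(m + p) * ones (take k w') < k * p + (m + p)"
        using cyclically_balanced_window(1)[OF w(1), of 1 k] n Suc w(2,3) by simp
      moreover from walk_split[OF lt, of n] obtain g where
        "p + (m + p) * ones (walk m p p n) = g + p * n" by blast
      ultimately have "(m + p) * ones (take k w') < (m + p) * ones (walk m p p n) + (m + p)"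
        using Suc by (simp add: algebra_simps)
      then have "(m + p) * ones (take k w') < (m + p) * (ones (walk m p p n) + 1)" by simp
      then have "ones (take k w') \<le> ones (walk m p p n)" by (subst (asm) mult_less_cancel1) simp
      then show ?thesis using n w(2) w' Suc take_walk[OF lt, of n "m + p"] by (simp del: walk.simps)
    qed simp
  qed (use w in simp)
qed

text \<open>Dually, for a prefix of length k + 1 the walk from \<open>p - 1\<close> has 1 plus the
  floor of kp/q ones, the smallest value that the window bound allows for a word beginning with
  1.\<close>

lemma Min_cyclically_balanced:
  assumes "0 < m" "0 < p"
  shows "Min {w. cyclically_balanced w \<and> length w = m + p \<and> ones w = p \<and> hd w = True} =
    walk m p (p - 1) (m + p)"
proof (rule Min_eqI[OF finite_cyclically_balanced])
  have lt: "p - 1 < m + p" using assms by simp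
  show "walk m p (p - 1) (m + p) \<in> {w. cyclically_balanced w \<and> length w = m + p \<and> ones w = p \<and> hd w = True}"
    using lt assms walk_period(1)[OF lt] by (auto simp: cyclically_balanced_walk) (cases "m + p"; simp)
  fix w assume "w \<in> {w. cyclically_balanced w \<and> length w = m + p \<and> ones w = p \<and> hd w = True}"
  then have w: "cyclically_balanced w" "length w = m + p" "ones w = p" "hd w = True" by auto
  then obtain w' where w': "w = True # w'" using assms by (cases w) auto
  show "walk m p (p - 1) (m + p) \<le> w"
  proof (rule le_list_if_ones_le)
    fix n assume "n \<le> length (walk m p (p - 1) (m + p))"
    then have n: "n \<le> length w" using w(2) by simp
    show "ones (take n (walk m p (p - 1) (m + p))) \<le> ones (take n w)"
    proof (cases n)
      case (Suc k)
      have "take k (drop 1 (w @ w)) = take k w'" using n Suc w' by simp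
      moreover have "1 < length w" using w(2) assms by simp
      ultimately have "k * p < (m + p) * ones (take k w') + (m + p)"
        using cyclically_balanced_window(2)[OF w(1), of 1 k] n Suc w(2,3) by simp
      moreover from walk_split[OF lt, of n] obtain g where
        "g < m + p" "p - 1 + (m + p) * ones (walk m p (p - 1) n) = g + p * n" by blast
      moreover from this(2) have "(m + p) * ones (walk m p (p - 1) n) = g + k * p + 1"
        using Suc assms by (simp add: algebra_simps del: walk.simps)
      ultimately have "(m + p) * ones (walk m p (p - 1) n) < (m + p) * ones (take k w') + (m + p) + (m + p)"
        by linarith
      then have "(m + p) * ones (walk m p (p - 1) n) < (m + p) * (ones (take k w') + 2)" by simp
      then have "ones (walk m p (p - 1) n) \<le> ones (take n w)"
        using w' Suc by (subst (asm) mult_less_cancel1) simp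
      then show ?thesis using n w(2) take_walk[OF lt, of n "m + p"] by simp
    qed simp
  qed (use w in simp)
qed

text \<open>A Euclidean step. The rotation for \<open>(m, p)\<close> leaves \<open>{0..<m}\<close>
  only by a letter 1, and the letter 0 that must follow brings it back. The first return map is the
  rotation for \<open>(m - p, p)\<close>, with a return of two steps exactly at a 1.\<close>

lemma walk_tau0:
  assumes "0 < p" "p < m" "f < m"
  shows "lmor [False] [True, False] (walk (m - p) p f n) = walk m p f (n + ones (walk (m - p) p f n))"
  using assms(3)
proof (induction n arbitrary: f)
  case (Suc n)
  show ?case
  proof (cases "p \<le> f")
    case True
    with Suc.prems Suc.IH[of "f - p"] show ?thesis by simp
  next
    case False
    from assms(2) obtain d where d: "m = p + d" by (metis less_imp_le le_Suc_ex)
    from False have "f + d < m" unfolding d by linarith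
    note IH = Suc.IH[OF this]
    have "walk m p f (Suc (Suc k)) = True # False # walk m p (f + d) k" for k
      using False unfolding d by simp
    moreover have "walk (m - p) p f (Suc n) = True # walk (m - p) p (f + d) n"
      using False unfolding d by simp
    ultimately show ?thesis using IH by simp
  qed
qed simp

text \<open>The other Euclidean step, by first returns to the upper positions
  \<open>{m..<m + p}\<close>; the shift by \<open>m\<close> in the starting point renumbers them
  from 0.\<close>

lemma walk_tau1:
  assumes "0 < m" "m < p" "f < p"
  shows "lmor [False, True] [True] (walk m (p - m) f n) =
    walk m p (f + m) (n + count_list (walk m (p - m) f n) False)"
  using assms(3)
proof (induction n arbitrary: f)
  case (Suc n)
  show ?case
  proof (cases "p - m \<le> f")
    case True
    then obtain g where f: "f = g + (p - m)" by (metis add.commute le_Suc_ex)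
    have g: "g < m" "g < p" "\<not> p \<le> g" "g + (p - m) + m = g + p"
      using Suc.prems assms(2) unfolding f by linarith+
    have "walk m p (f + m) (Suc (Suc k)) = False # True # walk m p (g + m) k" for k
      using g unfolding f by simp
    moreover have "walk m (p - m) f (Suc n) = False # walk m (p - m) g n"
      using f by simp
    ultimately show ?thesis using Suc.IH[OF g(2)] by simp
  next
    case False
    then have "f + m < p" using assms(2) by linarith
    with False Suc.IH[of "f + m"] show ?thesis by simp
  qed
qed simp

text \<open>\<open>sb ds\<close> is the substitution at the node of the Stern--Brocot tree reached by the path \<open>ds\<close>.\<close>

definition sb_step0 :: "bool \<Rightarrow> bool list" where
  "sb_step0 d = (if d then [False, True] else [False])"

definition sb_step1 :: "bool \<Rightarrow> bool list" where
  "sb_step1 d = (if d then [True] else [True, False])"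

definition sb :: "bool list \<Rightarrow> bool list \<Rightarrow> bool list" where
  "sb ds = foldr (\<lambda>d. lmor (sb_step0 d) (sb_step1 d)) ds"

lemma sb_Nil [simp]: "sb [] w = w"
  by (simp add: sb_def)

lemma sb_Cons: "sb (d # ds) w = lmor (sb_step0 d) (sb_step1 d) (sb ds w)"
  by (simp add: sb_def)

lemma sb_append: "sb (ds @ ds') w = sb ds (sb ds' w)"
  by (simp add: sb_def)

lemma sb_eq_lmor: "sb ds w = lmor (sb ds [False]) (sb ds [True]) w"
  unfolding sb_def by (rule foldr_lmor)

lemma count_list_False: "count_list w False = length w - ones w"
proof -
  have "count_list w False + ones w = length w" by (induction w) auto
  then show ?thesis by simp
qed

lemma walk_step0:
  assumes "0 < p" "p < m" "f < m"
  shows "walk m p f (m + p) = lmor (sb_step0 False) (sb_step1 False) (walk (m - p) p f m)"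
proof -
  have "m - p + p = m" "f < m - p + p" using assms by auto
  then have "ones (walk (m - p) p f m) = p" using walk_period(1)[of f "m - p" p] by metis
  then show ?thesis
    unfolding sb_step0_def sb_step1_def if_False walk_tau0[OF assms] by (simp only:)
qed

lemma walk_step1:
  assumes "0 < m" "m < p" "f < p"
  shows "walk m p (f + m) (m + p) = lmor (sb_step0 True) (sb_step1 True) (walk m (p - m) f p)"
proof -
  have "m + (p - m) = p" "f < m + (p - m)" using assms by auto
  then have "ones (walk m (p - m) f p) = p - m" using walk_period(1)[of f m "p - m"] by metis
  then have "count_list (walk m (p - m) f p) False = m"
    using assms(2) unfolding count_list_False length_walk by linarith
  then show ?thesis
    unfolding sb_step0_def sb_step1_def if_True walk_tau1[OF assms] by (simp only: add.commute)
qed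

text \<open>The subtractive Euclidean algorithm ends at (1, 1), where the two codings are 01 and
  10.\<close>

lemma walk_eq_sb:
  assumes "0 < m" "0 < p" "coprime m p"
  shows "\<exists>ds. walk m p p (m + p) = sb ds [False, True] \<and> walk m p (p - 1) (m + p) = sb ds [True, False]"
  using assms
proof (induction "m + p" arbitrary: m p rule: less_induct)
  case less
  consider "m = p" | "p < m" | "m < p" by linarith
  then show ?case
  proof cases
    case 1
    with less.prems have "m = 1" "p = 1" by auto
    then show ?thesis by (intro exI[of _ "[]"]) (simp add: numeral_2_eq_2)
  next
    case 2
    have "coprime (m - p) p" using less.prems(3) 2 by (simp add: coprime_diff_one_left_nat gcd_diff1_nat coprime_iff_gcd_eq_1)
    with less.hyps[of "m - p" p] 2 less.prems obtain ds where
      "walk (m - p) p p m = sb ds [False, True]" "walk (m - p) p (p - 1) m = sb ds [True, False]" by auto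
    then show ?thesis using 2 less.prems
      by (intro exI[of _ "False # ds"]) (simp add: walk_step0 sb_Cons)
  next
    case 3
    have "coprime m (p - m)" using less.prems(3) 3 
      by (metis coprime_commute coprime_iff_gcd_eq_1 gcd_diff1_nat less_imp_le)
    with less.hyps[of m "p - m"] 3 less.prems obtain ds where
      "walk m (p - m) (p - m) p = sb ds [False, True]" "walk m (p - m) (p - m - 1) p = sb ds [True, False]" by auto
    then show ?thesis using 3 less.prems walk_step1[of m p "p - m"] walk_step1[of m p "p - m - 1"]
      by (intro exI[of _ "True # ds"]) (simp add: sb_Cons)
  qed
qed

text \<open>A path read backwards is a run of the Euclidean algorithm, so no node is missed. This
  direction is what identifies every gap met in the descent below as an interval
  \<open>Delta\<close>.\<close>

lemma sb_eq_walk: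
  "\<exists>m p. 0 < m \<and> 0 < p \<and> coprime m p \<and> walk m p p (m + p) = sb ds [False, True] \<and>
    walk m p (p - 1) (m + p) = sb ds [True, False]"
proof (induction ds)
  case Nil
  show ?case by (intro exI[of _ 1]) (simp add: numeral_2_eq_2)
next
  case (Cons d ds)
  then obtain m p where mp: "0 < m" "0 < p" "coprime m p" "walk m p p (m + p) = sb ds [False, True]"
    "walk m p (p - 1) (m + p) = sb ds [True, False]" by blast
  show ?case
  proof (cases d)
    case False
    moreover have "p - 1 < m + p" using mp by linarith
    ultimately have "walk (m + p) p p (m + p + p) = sb (d # ds) [False, True]"
      "walk (m + p) p (p - 1) (m + p + p) = sb (d # ds) [True, False]"
      using walk_step0[of p "m + p" p] walk_step0[of p "m + p" "p - 1"] mp by (simp_all add: sb_Cons)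
    moreover have "coprime (m + p) p" using mp(3) unfolding coprime_iff_gcd_eq_1 gcd_add1 .
    ultimately show ?thesis using mp(1,2) by (intro exI[of _ "m + p"] exI[of _ p] conjI) simp_all
  next
    case True
    have e: "m + p - m = p" "p + m = m + p" "p - 1 + m = m + p - 1" using mp(2) by linarith+
    have "m < m + p" "p < m + p" "p - 1 < m + p" using mp by linarith+
    have "walk m (m + p) (p + m) (m + (m + p)) = sb (d # ds) [False, True]"
      unfolding walk_step1[OF mp(1) \<open>m < m + p\<close> \<open>p < m + p\<close>] e(1) mp(4) sb_Cons using True by simp
    moreover have "walk m (m + p) (p - 1 + m) (m + (m + p)) = sb (d # ds) [True, False]"
      unfolding walk_step1[OF mp(1) \<open>m < m + p\<close> \<open>p - 1 < m + p\<close>] e(1) mp(5) sb_Cons using True by simp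
    moreover have "coprime m (m + p)" using mp(3) unfolding coprime_iff_gcd_eq_1 gcd_add2 .
    ultimately show ?thesis using mp(1,2) unfolding e(2,3)
      by (intro exI[of _ m] exI[of _ "m + p"] conjI) simp_all
  qed
qed

lemma omega_eq_walk:
  assumes "r \<in> unit_rats"
  obtains m p where "0 < m" "0 < p" "coprime m p" "omega_minus r = walk m p p (m + p)"
    "omega_plus r = walk m p (p - 1) (m + p)" "denom r = m + p"
proof -
  obtain a b where ab: "quotient_of r = (a, b)" by fastforce
  have r: "r = of_int a / of_int b" and b: "0 < b" and c: "coprime a b"
    using quotient_of_div[OF ab] quotient_of_denom_pos[OF ab] quotient_of_coprime[OF ab] by auto
  have "0 < a" "a < b" using assms b unfolding unit_rats_def r by (simp_all add: zero_less_divide_iff)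
  define p m where "p = nat a" and "m = nat (b - a)"
  have 1: "numer r = p" "denom r = m + p" using ab \<open>0 < a\<close> \<open>a < b\<close>
    by (auto simp: numer_def denom_def p_def m_def nat_add_distrib[symmetric])
  have "gcd (b - a) a = 1" using c gcd_diff1[of b a] by (simp add: gcd.commute coprime_imp_gcd_eq_1)
  moreover have "int m = b - a" "int p = a" using \<open>0 < a\<close> \<open>a < b\<close> by (simp_all add: m_def p_def)
  ultimately have "coprime (int m) (int p)" by (simp only: coprime_iff_gcd_eq_1)
  then have 2: "coprime m p" by (simp only: coprime_int_iff)
  have 3: "0 < m" "0 < p" using \<open>0 < a\<close> \<open>a < b\<close> by (auto simp: m_def p_def)
  from that[OF 3 2 _ _ 1(2)] show ?thesis
    unfolding omega_minus_def omega_plus_def 1 using Max_cyclically_balanced[OF 3] Min_cyclically_balanced[OF 3] by blast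
qed

lemma length_omega:
  assumes "r \<in> unit_rats"
  shows "length (omega_minus r) = denom r" "length (omega_plus r) = denom r" "2 \<le> denom r"
proof -
  obtain m p where "0 < m" "0 < p" "omega_minus r = walk m p p (m + p)"
    "omega_plus r = walk m p (p - 1) (m + p)" "denom r = m + p" by (rule omega_eq_walk[OF assms])
  then show "length (omega_minus r) = denom r" "length (omega_plus r) = denom r" "2 \<le> denom r"
    by simp_all
qed

lemma omega_eq_sb:
  assumes "r \<in> unit_rats"
  obtains ds where "omega_minus r = sb ds [False, True]" "omega_plus r = sb ds [True, False]"
proof -
  obtain m p where mp: "0 < m" "0 < p" "coprime m p" "omega_minus r = walk m p p (m + p)"
    "omega_plus r = walk m p (p - 1) (m + p)" by (rule omega_eq_walk[OF assms])
  from walk_eq_sb[OF mp(1-3)] show ?thesis using that mp(4,5) by metis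
qed

lemma sb_eq_omega:
  obtains r where "r \<in> unit_rats" "omega_minus r = sb ds [False, True]" "omega_plus r = sb ds [True, False]"
proof -
  from sb_eq_walk[of ds] obtain m p where mp: "0 < m" "0 < p" "coprime m p"
    "walk m p p (m + p) = sb ds [False, True]" "walk m p (p - 1) (m + p) = sb ds [True, False]" by blast
  define r where "r = Fract (int p) (int (m + p))"
  have "coprime p (m + p)" using mp(3)
    unfolding coprime_iff_gcd_eq_1 gcd.commute[of p "m + p"] gcd_add1 .
  then have "coprime (int p) (int (m + p))" by (simp only: coprime_int_iff)
  then have q: "quotient_of r = (int p, int (m + p))"
    unfolding r_def using mp by (simp add: quotient_of_Fract Rat.normalize_def coprime_imp_gcd_eq_1 del: of_nat_add)
  have 1: "numer r = p" "denom r = m + p" using q by (auto simp: numer_def denom_def simp del: of_nat_add)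
  have "r = of_int (int p) / of_int (int (m + p))" using quotient_of_div[OF q] .
  then have "r \<in> unit_rats" using mp by (auto simp: unit_rats_def)
  then show ?thesis using that[of r] mp(4,5)
    unfolding omega_minus_def omega_plus_def 1 Max_cyclically_balanced[OF mp(1,2)] Min_cyclically_balanced[OF mp(1,2)]
    by blast
qed

section \<open>Hausdorff dimension of sets of expansions\<close>

text \<open>The words beginning with \<open>w\<close> have values in an interval of length 2^-|w|,
  whose s-th power is the weight of \<open>w\<close>. Packing the weights into a measure provides
  countable subadditivity.\<close>

definition word_measure :: "real \<Rightarrow> bool list measure" where
  "word_measure s = density (count_space UNIV) (\<lambda>w. ennreal (2 powr (- (s * real (length w)))))"

text \<open>Hausdorff measure zero at the level of words. No fineness of the cover is demanded: for
  positive \<open>s\<close>, a small total weight makes every single cylinder small.\<close>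

definition thin :: "real \<Rightarrow> bool stream set \<Rightarrow> bool" where
  "thin s A \<longleftrightarrow> (\<forall>\<epsilon>>0. \<exists>F. (\<forall>x\<in>A. \<exists>w\<in>F. \<exists>y. x = w @- y) \<and>
     emeasure (word_measure s) F \<le> ennreal \<epsilon>)"

lemma sets_word_measure [simp]: "sets (word_measure s) = UNIV"
  by (simp add: word_measure_def)

lemma emeasure_word_measure:
  "emeasure (word_measure s) F =
    (\<integral>\<^sup>+ w. ennreal (2 powr (- (s * real (length w)))) * indicator F w \<partial>count_space UNIV)"
  unfolding word_measure_def by (subst emeasure_density) auto

lemma emeasure_word_measure_singleton:
  "emeasure (word_measure s) {w} = ennreal (2 powr (- (s * real (length w))))"
  unfolding emeasure_word_measure by (subst nn_integral_indicator_singleton) auto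

lemma emeasure_word_measure_finite:
  assumes "finite F" "\<And>w. w \<in> F \<Longrightarrow> L \<le> length w" "0 \<le> s"
  shows "emeasure (word_measure s) F \<le> ennreal (real (card F) * 2 powr (- (s * real L)))"
proof -
  have "emeasure (word_measure s) F = emeasure (word_measure s) (\<Union>w\<in>F. {w})" by simp
  also have "\<dots> \<le> (\<Sum>w\<in>F. emeasure (word_measure s) {w})"
    by (rule emeasure_subadditive_finite[OF assms(1)]) auto
  also have "\<dots> \<le> (\<Sum>w\<in>F. ennreal (2 powr (- (s * real L))))"
    unfolding emeasure_word_measure_singleton
    by (intro sum_mono ennreal_leI) (use assms in \<open>auto intro!: mult_left_mono\<close>)
  also have "\<dots> = ennreal (real (card F) * 2 powr (- (s * real L)))"
    by (simp add: ennreal_mult ennreal_of_nat_eq_real_of_nat)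
  finally show ?thesis .
qed

lemma thin_mono: "thin s B \<Longrightarrow> A \<subseteq> B \<Longrightarrow> thin s A"
  unfolding thin_def by (meson subsetD)

lemma thin_UN_nat:
  assumes "\<And>i :: nat. thin s (A i)" shows "thin s (\<Union>i. A i)"
  unfolding thin_def
proof (intro allI impI)
  fix \<epsilon> :: real assume "\<epsilon> > 0"
  then have "\<forall>i. \<exists>F. (\<forall>x\<in>A i. \<exists>w\<in>F. \<exists>y. x = w @- y) \<and>
     emeasure (word_measure s) F \<le> ennreal (\<epsilon> * (1/2) ^ Suc i)"
    using assms unfolding thin_def by (metis mult_pos_pos zero_less_power zero_less_divide_1_iff zero_less_numeral)
  then obtain F where F: "\<And>i x. x \<in> A i \<Longrightarrow> \<exists>w\<in>F i. \<exists>y. x = w @- y"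
    "\<And>i. emeasure (word_measure s) (F i) \<le> ennreal (\<epsilon> * (1/2) ^ Suc i)" by metis
  have "emeasure (word_measure s) (\<Union>i. F i) \<le> (\<Sum>i. emeasure (word_measure s) (F i))"
    by (rule emeasure_subadditive_countably) auto
  also have "\<dots> \<le> (\<Sum>i. ennreal (\<epsilon> * (1/2) ^ Suc i))"
    by (intro suminf_le F(2)) auto
  also have "\<dots> = ennreal \<epsilon>"
  proof -
    have "(\<lambda>i. \<epsilon> * (1/2) ^ Suc i) sums (\<epsilon> * 1)" by (intro sums_mult power_half_series)
    then show ?thesis using \<open>\<epsilon> > 0\<close> by (intro suminf_ennreal_eq) auto
  qed
  finally show "\<exists>F. (\<forall>x\<in>\<Union>i. A i. \<exists>w\<in>F. \<exists>y. x = w @- y) \<and> emeasure (word_measure s) F \<le> ennreal \<epsilon>"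
    using F(1) by (intro exI[of _ "\<Union>i. F i"]) blast
qed

lemma thin_empty: "thin s {}"
  unfolding thin_def by (intro allI impI exI[of _ "{}"]) auto

lemma thin_UN:
  assumes "countable I" "\<And>i. i \<in> I \<Longrightarrow> thin s (A i)" shows "thin s (\<Union>i\<in>I. A i)"
proof (cases "I = {}")
  case False
  have "thin s (\<Union>n. A (from_nat_into I n))"
    using False assms(2) by (intro thin_UN_nat) (auto intro: from_nat_into)
  moreover have "(\<Union>i\<in>I. A i) \<subseteq> (\<Union>n. A (from_nat_into I n))"
    using from_nat_into_surj[OF assms(1)] by blast
  ultimately show ?thesis by (rule thin_mono)
qed (simp add: thin_empty)

lemma thin_Un:
  assumes "thin s A" "thin s B" shows "thin s (A \<union> B)"
proof -
  have "thin s (\<Union>b\<in>UNIV. if b then A else B)" using assms by (intro thin_UN) auto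
  then show ?thesis by (rule thin_mono) (auto simp: UNIV_bool)
qed

lemma powr_neg_tendsto_0: "0 < s \<Longrightarrow> (\<lambda>n. 2 powr (- (s * real n))) \<longlonglongrightarrow> 0"
proof -
  assume "0 < s"
  then have "(\<lambda>n. (2 powr (- s)) ^ n) \<longlonglongrightarrow> 0" by (intro LIMSEQ_realpow_zero) (auto simp: powr_less_one)
  then show ?thesis by (simp add: powr_powr flip: powr_realpow)
qed

lemma thin_countable:
  assumes "countable A" "0 < s" shows "thin s A"
proof -
  have "thin s {x}" for x
    unfolding thin_def
  proof (intro allI impI)
    fix \<epsilon> :: real assume "0 < \<epsilon>"
    then obtain n where "2 powr (- (s * real n)) < \<epsilon>"
      using order_tendstoD(2)[OF powr_neg_tendsto_0[OF assms(2)], of \<epsilon>] by (auto simp: eventually_sequentially)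
    then have "emeasure (word_measure s) {stake n x} \<le> ennreal \<epsilon>"
      by (auto simp: emeasure_word_measure_singleton intro!: ennreal_leI)
    then show "\<exists>F. (\<forall>x\<in>{x}. \<exists>w\<in>F. \<exists>y. x = w @- y) \<and> emeasure (word_measure s) F \<le> ennreal \<epsilon>"
      using stake_sdrop[of n x, symmetric] by blast
  qed
  then have "thin s (\<Union>x\<in>A. {x})" using assms(1) by (intro thin_UN) auto
  then show ?thesis by simp
qed

lemma ennreal_eq_0_if_le:
  assumes "\<And>\<epsilon>. 0 < \<epsilon> \<Longrightarrow> x \<le> ennreal \<epsilon>" shows "x = (0 :: ennreal)"
proof -
  have "x \<le> 0" by (rule ennreal_le_epsilon) (simp add: assms)
  then show ?thesis by simp
qed

lemma hausdorff_measure_thin: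
  assumes "thin s A" "0 < s" shows "hausdorff_measure s (inf_val ` A) = 0"
proof -
  have "(INF U\<in>fine_covers \<delta> (inf_val ` A). \<Sum>i. hausdorff_weight s (U i)) \<le> ennreal \<epsilon>"
    if "0 < \<delta>" "0 < \<epsilon>" for \<delta> \<epsilon> :: real
  proof -
    \<comment> \<open>The bound \<open>\<delta> powr s\<close> on the total weight bounds each
      single weight too, which makes the cover \<open>\<delta>\<close>-fine.\<close>
    obtain F where F: "\<And>x. x \<in> A \<Longrightarrow> \<exists>w\<in>F. \<exists>y. x = w @- y"
      "emeasure (word_measure s) F \<le> ennreal (min \<epsilon> (\<delta> powr s))"
      using assms(1)[unfolded thin_def, rule_format, of "min \<epsilon> (\<delta> powr s)"] \<open>0 < \<delta>\<close> \<open>0 < \<epsilon>\<close> by auto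
    define iv where "iv w = {fin_val w .. fin_val w + 1 / 2 ^ length w}" for w
    have diam: "diameter (iv w) = 1 / 2 ^ length w" for w
      unfolding iv_def by (simp add: diameter_closed_interval)
    have pw: "(1 / 2 ^ length w) powr s = 2 powr (- (s * real (length w)))" for w :: "bool list"
    proof -
      have "1 / 2 ^ length w = 2 powr (- real (length w))"
        by (simp add: powr_minus powr_realpow divide_inverse)
      then show ?thesis by (simp add: powr_powr mult.commute)
    qed
    have small: "1 / 2 ^ length w \<le> \<delta>" if "w \<in> F" for w
    proof (rule ccontr)
      assume "\<not> ?thesis"
      then have "\<delta> powr s < (1 / 2 ^ length w) powr s" using assms(2) \<open>0 < \<delta>\<close> by (intro powr_less_mono2) auto
      moreover have "ennreal ((1 / 2 ^ length w) powr s) \<le> emeasure (word_measure s) F"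
        unfolding pw emeasure_word_measure_singleton[symmetric] using that by (intro emeasure_mono) auto
      then have "ennreal ((1 / 2 ^ length w) powr s) \<le> ennreal (\<delta> powr s)"
        using F(2) by (meson ennreal_leI min.cobounded2 order_trans)
      ultimately show False using assms(2) by (simp add: ennreal_le_iff)
    qed
    obtain e :: "nat \<Rightarrow> bool list" where e: "bij e"
      using bij_betw_from_nat_into[of "UNIV :: bool list set"] infinite_UNIV_listI by auto
    define U where "U i = (if e i \<in> F then iv (e i) else {})" for i
    have "U \<in> fine_covers \<delta> (inf_val ` A)"
      unfolding fine_covers_def
    proof (intro CollectI conjI allI subsetI)
      fix v assume "v \<in> inf_val ` A"
      then obtain x where x: "x \<in> A" "v = inf_val x" by blast
      from F(1)[OF x(1)] obtain w y where w: "w \<in> F" "x = w @- y" by blast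
      then have "v \<in> iv w" unfolding x iv_def
        by (auto simp: inf_val_shift divide_right_mono)
      moreover obtain i where "w = e i" using e by (metis bij_pointE)
      ultimately show "v \<in> (\<Union>i. U i)" using w(1) unfolding U_def by auto
    next
      fix i show "bounded (U i)" unfolding U_def iv_def by auto
      show "diameter (U i) \<le> \<delta>" unfolding U_def using diam small \<open>0 < \<delta>\<close> by auto
    qed
    moreover have "(\<Sum>i. hausdorff_weight s (U i)) = emeasure (word_measure s) F"
    proof -
      have "hausdorff_weight s (U i) = ennreal (2 powr (- (s * real (length (e i))))) * indicator F (e i)" for i
        using assms(2) diam[of "e i"] pw[of "e i"]
        by (auto simp: hausdorff_weight_def U_def indicator_def iv_def)
      then have "(\<Sum>i. hausdorff_weight s (U i)) =
        (\<integral>\<^sup>+ i. ennreal (2 powr (- (s * real (length (e i))))) * indicator F (e i) \<partial>count_space UNIV)"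
        by (simp add: nn_integral_count_space_nat)
      also have "\<dots> = emeasure (word_measure s) F"
        unfolding emeasure_word_measure using e by (rule nn_integral_bij_count_space)
      finally show ?thesis .
    qed
    ultimately have "(INF U\<in>fine_covers \<delta> (inf_val ` A). \<Sum>i. hausdorff_weight s (U i)) \<le> emeasure (word_measure s) F"
      by (intro INF_lower2[of U]) simp_all
    also have "\<dots> \<le> ennreal \<epsilon>" using F(2) by (meson ennreal_leI min.cobounded1 order_trans)
    finally show ?thesis .
  qed
  then have "(INF U\<in>fine_covers \<delta> (inf_val ` A). \<Sum>i. hausdorff_weight s (U i)) = 0" if "0 < \<delta>" for \<delta>
    using that by (intro ennreal_eq_0_if_le)
  then have "hausdorff_measure s (inf_val ` A) \<le> 0"
    unfolding hausdorff_measure_def by (intro SUP_least) simp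
  then show ?thesis by simp
qed

lemma hausdorff_measure_mono: "A \<subseteq> B \<Longrightarrow> hausdorff_measure s A \<le> hausdorff_measure s B"
  unfolding hausdorff_measure_def fine_covers_def by (intro SUP_mono' INF_superset_mono) auto

lemma hausdorff_dim_eq_0:
  assumes "\<And>s. 0 < s \<Longrightarrow> \<exists>A. thin s A \<and> B \<subseteq> inf_val ` A" shows "hausdorff_dim B = 0"
proof -
  have "hausdorff_dim B \<le> ennreal s" if s: "0 < s" for s
  proof -
    from assms[OF s] obtain A where "thin s A" "B \<subseteq> inf_val ` A" by blast
    then have "hausdorff_measure s B = 0"
      using hausdorff_measure_mono hausdorff_measure_thin[OF _ s] by (metis le_zero_eq)
    then show ?thesis unfolding hausdorff_dim_def using s by (intro INF_lower) auto
  qed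
  then show ?thesis by (rule ennreal_eq_0_if_le)
qed

text \<open>The map \<open>E c \<mapsto> inf_val c\<close> is Hoelder continuous with exponent \<open>1/m\<close> and has
  range \<open>[0, 1]\<close>, which has Lebesgue measure \<open>1\<close>.\<close>

lemma hausdorff_dim_pos:
  fixes E :: "bool stream \<Rightarrow> real"
  assumes "0 < m" "0 < \<kappa>"
    and sep: "\<And>w c c'. \<kappa> / (2 ^ m) ^ length w \<le> \<bar>E (w @- False ## c) - E (w @- True ## c')\<bar>"
    and sub: "range E \<subseteq> B"
  shows "0 < hausdorff_dim B"
proof -
  define \<sigma> where "\<sigma> = 1 / real m"
  define K where "K = (1 / \<kappa>) powr \<sigma>"
  have "0 < \<sigma>" "0 < K" using assms(1,2) by (auto simp: \<sigma>_def K_def)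
  have less: "\<bar>inf_val c - inf_val c'\<bar> \<le> K * \<bar>E c - E c'\<bar> powr \<sigma>" if "c < c'" for c c'
  proof -
    from that obtain w d d' where w: "c = w @- False ## d" "c' = w @- True ## d'" by (rule less_streamE)
    have "\<bar>inf_val c - inf_val c'\<bar> \<le> 1 / 2 ^ length w" unfolding w by (rule inf_val_dist_prefix)
    also have "\<dots> = (1 / (2 ^ m) ^ length w) powr \<sigma>"
    proof -
      have "1 / (2 ^ m) ^ length w = (2 :: real) powr (- (real m * real (length w)))"
        using powr_realpow[of "2 :: real" "m * length w"] by (simp add: powr_minus divide_inverse power_mult)
      then have "(1 / (2 ^ m) ^ length w) powr \<sigma> = (2 :: real) powr (- real (length w))"
        using assms(1) by (simp add: powr_powr \<sigma>_def)
      then show ?thesis by (simp add: powr_minus divide_inverse powr_realpow)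
    qed
    also have "\<dots> \<le> (1 / \<kappa> * \<bar>E c - E c'\<bar>) powr \<sigma>"
    proof (rule powr_mono2)
      show "1 / (2 ^ m) ^ length w \<le> 1 / \<kappa> * \<bar>E c - E c'\<bar>"
        using sep[of w d d'] assms(2) unfolding w by (simp add: field_simps)
    qed (use \<open>0 < \<sigma>\<close> in auto)
    also have "\<dots> = K * \<bar>E c - E c'\<bar> powr \<sigma>"
      unfolding K_def by (rule powr_mult)
    finally show ?thesis .
  qed
  have hoelder: "\<bar>inf_val c - inf_val c'\<bar> \<le> K * \<bar>E c - E c'\<bar> powr \<sigma>" for c c'
  proof (cases c c' rule: linorder_cases)
    case greater
    from less[OF this] show ?thesis by (simp add: abs_minus_commute)
  qed (use less in auto)
  have cover: "ennreal (1 / (2 * K)) \<le> (\<Sum>i. hausdorff_weight s (U i))"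
    if U: "U \<in> fine_covers 1 B" and s: "0 \<le> s" "s \<le> \<sigma>" for U s
  proof -
    define D where "D i = {c. E c \<in> U i}" for i
    \<comment> \<open>By the Hoelder bound, the values of all codes in \<open>D i\<close> are close
      to that of one chosen code, so an interval around it covers them.\<close>
    define J where "J i = (if D i = {} then {} else
      {inf_val (SOME c. c \<in> D i) - K * diameter (U i) powr \<sigma> ..
       inf_val (SOME c. c \<in> D i) + K * diameter (U i) powr \<sigma>})" for i
    have bd: "bounded (U i)" "diameter (U i) \<le> 1" for i using U by (auto simp: fine_covers_def)
    have "{0..1} \<subseteq> (\<Union>i. J i)"
    proof
      fix v :: real assume "v \<in> {0..1}"
      then have v: "v = inf_val (expansion v)" by (simp add: inf_val_expansion)
      have "E (expansion v) \<in> (\<Union>i. U i)" using U sub unfolding fine_covers_def by blast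
      then obtain i where i: "expansion v \<in> D i" unfolding D_def by blast
      define c where "c = (SOME c. c \<in> D i)"
      have c: "c \<in> D i" unfolding c_def using i by (rule someI)
      have "\<bar>E (expansion v) - E c\<bar> \<le> diameter (U i)"
        using diameter_bounded_bound[OF bd(1)[of i]] i c by (auto simp: D_def dist_real_def)
      then have "K * \<bar>E (expansion v) - E c\<bar> powr \<sigma> \<le> K * diameter (U i) powr \<sigma>"
        using \<open>0 < \<sigma>\<close> \<open>0 < K\<close> by (intro mult_left_mono powr_mono2) auto
      with hoelder[of "expansion v" c] have "\<bar>v - inf_val c\<bar> \<le> K * diameter (U i) powr \<sigma>"
        using v by simp
      then have "v \<in> J i" using i unfolding J_def c_def[symmetric] by (auto simp: abs_le_iff)
      then show "v \<in> (\<Union>i. J i)" by blast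
    qed
    have weight: "emeasure lborel (J i) \<le> ennreal (2 * K) * hausdorff_weight s (U i)" for i
    proof (cases "D i = {}")
      case False
      then have ne: "U i \<noteq> {}" by (auto simp: D_def)
      have d0: "0 \<le> diameter (U i)" by (rule diameter_ge_0[OF bd(1)])
      have "emeasure lborel (J i) = ennreal (2 * K * diameter (U i) powr \<sigma>)"
        unfolding J_def using False \<open>0 < K\<close> by simp
      also have "\<dots> = ennreal (2 * K) * ennreal (diameter (U i) powr \<sigma>)"
        using \<open>0 < K\<close> by (intro ennreal_mult) auto
      \<comment> \<open>Diameters are at most 1, so a smaller exponent gives a larger weight; for
        \<open>s = 0\<close> the weight is 1 by convention.\<close>
      also have "ennreal (diameter (U i) powr \<sigma>) \<le> hausdorff_weight s (U i)"
      proof (cases "s = 0")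
        case True
        have "diameter (U i) powr \<sigma> \<le> 1 powr \<sigma>" using d0 bd(2) \<open>0 < \<sigma>\<close> by (intro powr_mono2) auto
        then show ?thesis unfolding hausdorff_weight_def using True ne
          by (simp add: ennreal_le_1)
      next
        case False
        have "diameter (U i) powr \<sigma> \<le> diameter (U i) powr s"
          using d0 bd(2)[of i] s by (cases "diameter (U i) = 0") (auto intro!: powr_mono')
        then show ?thesis unfolding hausdorff_weight_def using False ne by (simp add: ennreal_leI)
      qed
      finally show ?thesis by (simp add: mult_left_mono)
    qed (simp add: J_def)
    have "1 = emeasure lborel {0..1::real}" by simp
    also have "\<dots> \<le> emeasure lborel (\<Union>i. J i)"
      using \<open>{0..1} \<subseteq> (\<Union>i. J i)\<close> by (intro emeasure_mono) (auto simp: J_def)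
    also have "\<dots> \<le> (\<Sum>i. emeasure lborel (J i))"
      by (rule emeasure_subadditive_countably) (auto simp: J_def)
    also have "\<dots> \<le> (\<Sum>i. ennreal (2 * K) * hausdorff_weight s (U i))"
      by (intro suminf_le weight) auto
    also have "\<dots> = ennreal (2 * K) * (\<Sum>i. hausdorff_weight s (U i))" by simp
    finally have "ennreal (1 / (2 * K)) * 1 \<le> ennreal (1 / (2 * K)) * (ennreal (2 * K) * (\<Sum>i. hausdorff_weight s (U i)))"
      by (rule mult_left_mono) simp
    also have "\<dots> = (\<Sum>i. hausdorff_weight s (U i))"
      using \<open>0 < K\<close> by (simp add: ennreal_mult[symmetric] mult.assoc[symmetric])
    finally show ?thesis by simp
  qed
  have "ennreal \<sigma> \<le> hausdorff_dim B"
    unfolding hausdorff_dim_def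
  proof (rule INF_greatest)
    fix s assume s: "s \<in> {s. 0 \<le> s \<and> hausdorff_measure s B = 0}"
    show "ennreal \<sigma> \<le> ennreal s"
    proof (rule ccontr)
      assume "\<not> ?thesis"
      then have "s \<le> \<sigma>" using \<open>0 < \<sigma>\<close> by (meson ennreal_leI linear)
      have "ennreal (1 / (2 * K)) \<le> (INF U\<in>fine_covers 1 B. \<Sum>i. hausdorff_weight s (U i))"
        using cover s \<open>s \<le> \<sigma>\<close> by (intro INF_greatest) auto
      also have "\<dots> \<le> hausdorff_measure s B"
        unfolding hausdorff_measure_def by (rule SUP_upper) simp
      finally show False using s \<open>0 < K\<close> by (simp add: ennreal_eq_0_iff)
    qed
  qed
  moreover have "0 < ennreal \<sigma>" using \<open>0 < \<sigma>\<close> by simp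
  ultimately show ?thesis by (rule less_le_trans[rotated])
qed

section \<open>Survivor sets\<close>

lemma funpow_doubling_bounds: "x \<in> {0..1} \<Longrightarrow> (doubling ^^ n) x \<in> {0..1}"
  by (induction n) (simp_all add: doubling_bounds del: atLeastAtMost_iff)

text \<open>Inequalities of values pass to words unless some shift has value 1/2. This cannot happen
  here, because 1/2 lies in the hole and the shifts of the expansion have the values of the
  orbit.\<close>

lemma survivor_set_subset:
  assumes "a < 1/2" "1/2 < b" "a \<le> inf_val \<alpha>" "inf_val \<beta> \<le> b"
  shows "survivor_set a b \<subseteq> inf_val ` {x. avoids \<alpha> \<beta> x}"
proof
  fix v assume v: "v \<in> survivor_set a b"
  then have v01: "v \<in> {0..1}" by (simp add: survivor_set_def)
  define e where "e = expansion v"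
  have val: "inf_val (sdrop n e) = (doubling ^^ n) v" for n
    unfolding e_def sdrop_expansion by (rule inf_val_expansion[OF funpow_doubling_bounds[OF v01]])
  have out: "(doubling ^^ n) v \<le> a \<or> b \<le> (doubling ^^ n) v" for n
    using v by (auto simp: survivor_set_def not_less)
  have half: "(doubling ^^ n) v \<noteq> 1/2" for n using out[of n] assms(1,2) by auto
  have "avoids \<alpha> \<beta> e"
    unfolding avoids_def
  proof
    fix n
    have digit: "e !! n \<longleftrightarrow> (doubling ^^ n) v > 1/2" by (simp add: e_def expansion_def)
    have no: "inf_val (sdrop k (sdrop n e)) \<noteq> 1/2" for k
      using half[of "n + k"] by (simp add: val)
    show "if e !! n then \<beta> \<le> sdrop n e else sdrop n e \<le> \<alpha>"
    proof (cases "e !! n")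
      case True
      then have "inf_val \<beta> \<le> inf_val (sdrop n e)"
        using out[of n] digit assms unfolding val by linarith
      then have "\<not> sdrop n e < \<beta>" using inf_val_eq_half(1)[of "sdrop n e" \<beta>] no by blast
      with True show ?thesis by simp
    next
      case False
      then have "inf_val (sdrop n e) \<le> inf_val \<alpha>"
        using out[of n] digit assms unfolding val by linarith
      then have "\<not> \<alpha> < sdrop n e" using inf_val_eq_half(2)[of \<alpha> "sdrop n e"] no by blast
      with False show ?thesis by simp
    qed
  qed
  moreover have "v = inf_val e" using val[of 0] by simp
  ultimately show "v \<in> inf_val ` {x. avoids \<alpha> \<beta> x}" by blast
qed

text \<open>A letter 1 forces a value of at least b, above 1/2, and a letter 0 a value of at most
  1/2. So along this word \<open>doubling\<close> always takes the branch of the letter, even if the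
  word is not the \<open>expansion\<close> of its value.\<close>

lemma inf_val_in_survivor_set:
  assumes "1/2 < b" "\<And>n. if x !! n then b \<le> inf_val (sdrop n x) else inf_val (sdrop n x) \<le> a"
  shows "inf_val x \<in> survivor_set a b"
proof -
  have "(doubling ^^ n) (inf_val x) = inf_val (sdrop n x)" for n
  proof (induction n)
    case (Suc n)
    have x: "sdrop n x = x !! n ## sdrop (Suc n) x" by (rule sdrop_Cons_eq)
    have "doubling (inf_val (sdrop n x)) = inf_val (sdrop (Suc n) x)"
    proof (cases "x !! n")
      case True
      then have "1/2 < inf_val (sdrop n x)" using assms(1) assms(2)[of n] by simp
      moreover have "inf_val (sdrop n x) = (1 + inf_val (sdrop (Suc n) x)) / 2"
        by (subst x) (simp add: True del: sdrop.simps)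
      ultimately show ?thesis unfolding doubling_def by simp
    next
      case False
      have "inf_val (sdrop n x) = inf_val (sdrop (Suc n) x) / 2"
        by (subst x) (simp add: False del: sdrop.simps)
      moreover have "inf_val (sdrop (Suc n) x) \<le> 1" by (rule inf_val_le_1)
      ultimately show ?thesis unfolding doubling_def by auto
    qed
    with Suc show ?case by simp
  qed simp
  moreover have "inf_val (sdrop n x) \<notin> {a<..<b}" for n
    using assms(2)[of n] by (cases "x !! n") auto
  ultimately show ?thesis by (simp add: survivor_set_def)
qed

text \<open>Every word has its shifts between 0^\<infinity> and 1^\<infinity>, so
  \<open>pres\<close> applies to every \<open>y\<close>. It bounds the tail after each letter, and
  the letter is then put back in front.\<close>

lemma (in renorm) smor_survives:
  assumes "inf_val (u @- cycle v) \<le> a" "b \<le> inf_val (v @- cycle u)"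
  shows "if smor u v y !! n then b \<le> inf_val (sdrop n (smor u v y))
    else inf_val (sdrop n (smor u v y)) \<le> a"
proof -
  let ?x = "smor u v y"
  have top: "smor u v (False ## sconst True) = u @- cycle v" and bot: "smor u v (True ## sconst False) = v @- cycle u"
    by (simp_all add: smor_sconst)
  have p: "stl (v @- cycle u) \<le> sdrop (Suc n) ?x \<and> sdrop (Suc n) ?x \<le> stl (u @- cycle v)"
    using pres[of "sconst False" y "sconst True" "Suc n"] unfolding top bot by (simp del: sdrop.simps)
  have x: "sdrop n ?x = ?x !! n ## sdrop (Suc n) ?x" by (rule sdrop_Cons_eq)
  have heads: "v @- cycle u = True ## stl (v @- cycle u)" "u @- cycle v = False ## stl (u @- cycle v)"
    using hd_u hd_v by auto
  show ?thesis
  proof (cases "?x !! n")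
    case True
    then have "v @- cycle u \<le> sdrop n ?x" using p unfolding x by (subst heads(1)) simp
    then show ?thesis using True assms(2) inf_val_mono by fastforce
  next
    case False
    then have "sdrop n ?x \<le> u @- cycle v" using p unfolding x by (subst heads(2)) simp
    then show ?thesis using False assms(1) inf_val_mono by fastforce
  qed
qed

text \<open>The blocks \<open>u @ v\<close> and \<open>v @ u\<close> are used instead of
  \<open>u\<close> and \<open>v\<close> because they have equal length, so the coding has a uniform
  contraction rate. Words starting with the first have value at most a, those starting with the
  second at least b, which gives the separation.\<close>

lemma hausdorff_dim_survivor_set_pos:
  assumes "renorm u v" "inf_val (u @- cycle v) \<le> a" "b \<le> inf_val (v @- cycle u)" "a < b" "1/2 < b"
  shows "0 < hausdorff_dim (survivor_set a b)"
proof -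
  interpret renorm u v by fact
  interpret h: renorm "[False, True]" "[True, False]" by (rule renorm_half)
  have comp: "smor (u @ v) (v @ u) x = smor u v (smor [False, True] [True, False] x)" for x
    by (simp add: smor_smor)
  note surv = smor_survives[OF assms(2,3)]
  show ?thesis
  proof (rule hausdorff_dim_pos)
    show "0 < length u + length v" by simp
    show "0 < b - a" using assms(4) by simp
    fix w c c'
    let ?P = "lmor (u @ v) (v @ u) w"
    let ?x = "smor (u @ v) (v @ u) (False ## c)" and ?x' = "smor (u @ v) (v @ u) (True ## c')"
    have len: "length ?P = (length u + length v) * length w" by (induction w) auto
    have "inf_val ?x \<le> a" "b \<le> inf_val ?x'"
      using surv[of "smor [False, True] [True, False] (False ## c)" 0]
        surv[of "smor [False, True] [True, False] (True ## c')" 0]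
      unfolding comp by (simp_all del: smor_Cons)
    then have "(b - a) / 2 ^ length ?P \<le> (inf_val ?x' - inf_val ?x) / 2 ^ length ?P"
      by (intro divide_right_mono) auto
    also have "\<dots> = inf_val (?P @- ?x') - inf_val (?P @- ?x)"
      by (simp only: inf_val_shift diff_divide_distrib)
    finally show "(b - a) / (2 ^ (length u + length v)) ^ length w \<le>
      \<bar>inf_val (smor (u @ v) (v @ u) (w @- False ## c)) - inf_val (smor (u @ v) (v @ u) (w @- True ## c'))\<bar>"
      unfolding len power_mult by (simp add: smor_shift)
  next
    show "range (\<lambda>c. inf_val (smor (u @ v) (v @ u) c)) \<subseteq> survivor_set a b"
      unfolding comp using surv by (auto intro!: inf_val_in_survivor_set[OF assms(5)])
  qed
qed

section \<open>Criteria for dimension zero\<close>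

lemma (in renorm) avoids_cases:
  assumes "avoids \<alpha> \<beta> x" "\<alpha> \<le> smor u v (False ## sconst True)" "smor u v (True ## sconst False) \<le> \<beta>"
  shows "evper x \<or> (\<exists>w y. x = w @- smor u v y \<and> avoids \<alpha> \<beta> (smor u v y))"
proof -
  have "avoids (smor u v (False ## sconst True)) (smor u v (True ## sconst False)) x"
    using assms by (rule avoids_mono)
  from desub[OF this] show ?thesis using assms(1) by (auto dest: avoids_shiftD)
qed

lemma (in ordered_sub) avoids_smor_block:
  assumes "avoids \<alpha> \<beta> (smor u v y)"
  shows "if y !! n then \<beta> \<le> smor u v (sdrop n y) else smor u v (sdrop n y) \<le> \<alpha>"
proof -
  have "avoids \<alpha> \<beta> (smor u v (sdrop n y))"
    using assms unfolding smor_split[OF ne, of y n] by (rule avoids_shiftD)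
  from this[unfolded avoids_def, rule_format, of 0] show ?thesis by (simp split: if_splits)
qed

lemma thin_evper: "0 < s \<Longrightarrow> thin s {x. evper x}"
  by (rule thin_countable[OF countable_evper])

lemma evper_not_increasing:
  assumes "\<And>n. x !! Suc n \<Longrightarrow> x !! n" shows "evper (x :: bool stream)"
proof (cases "\<exists>k. \<not> x !! k")
  case False
  then have "x = sconst True" by (intro stream_eqI_stake nth_equalityI) auto
  then show ?thesis by simp
next
  case True
  then obtain k where k: "\<not> x !! k" by blast
  have "\<not> x !! (k + n)" for n
  proof (induction n)
    case (Suc n)
    then show ?case using assms[of "k + n"] by auto
  qed (use k in simp)
  then have "sdrop k x = sconst False" by (intro stream_eqI_stake nth_equalityI) (auto simp: sdrop_snth)
  then show ?thesis by (metis evper_sconst evper_sdropD)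
qed

text \<open>The end words are the images of 010^\<infinity> and 10^\<infinity>. Once a preimage
  contains 01, the first bound leaves only 0s after it; without 01 its letters never
  increase.\<close>

lemma hausdorff_dim_survivor_set_plateau:
  assumes "renorm u v" "a \<le> inf_val (u @- v @- cycle u)" "inf_val (v @- cycle u) \<le> b" "a < 1/2" "1/2 < b"
  shows "hausdorff_dim (survivor_set a b) = 0"
proof -
  interpret renorm u v by fact
  let ?\<alpha> = "False ## True ## sconst False" and ?\<beta> = "True ## sconst False"
  have \<alpha>: "smor u v ?\<alpha> = u @- v @- cycle u" and \<beta>: "smor u v ?\<beta> = v @- cycle u"
    by (simp_all add: smor_sconst)
  have "evper x" if x: "avoids (smor u v ?\<alpha>) (smor u v ?\<beta>) x" for x
  proof -
    have "?\<alpha> \<le> False ## sconst True" by (subst (2) sconst_eq) (simp only: le_stream_Cons sconst_False_le simp_thms)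
    then have "smor u v ?\<alpha> \<le> smor u v (False ## sconst True)" by (simp only: smor_le)
    from avoids_cases[OF x this order_refl] consider "evper x" |
      w y where "x = w @- smor u v y" "avoids ?\<alpha> ?\<beta> y"
      by (blast dest: avoids_smorD)
    then show ?thesis
    proof cases
      case 2
      have "evper y"
      proof (cases "\<exists>k. \<not> y !! k \<and> y !! Suc k")
        case True
        then obtain k where k: "\<not> y !! k" "y !! Suc k" by blast
        have yk: "sdrop k y = False ## True ## sdrop (Suc (Suc k)) y"
          using k sdrop_Cons_eq[of k y] sdrop_Cons_eq[of "Suc k" y] by simp
        have "sdrop k y \<le> ?\<alpha>" using 2(2) k(1) unfolding avoids_def by (auto dest: spec[of _ k])
        then have "sdrop (Suc (Suc k)) y \<le> sconst False" unfolding yk by (simp del: sdrop.simps)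
        then have "sdrop (Suc (Suc k)) y = sconst False" by (simp add: antisym del: sdrop.simps)
        then show ?thesis by (metis evper_sconst evper_sdropD)
      qed (use evper_not_increasing in blast)
      then show ?thesis unfolding 2(1) by (simp add: evper_shift evper_smor)
    qed
  qed
  then have "{x. avoids (smor u v ?\<alpha>) (smor u v ?\<beta>) x} \<subseteq> {x. evper x}" by blast
  moreover have "survivor_set a b \<subseteq> inf_val ` {x. avoids (smor u v ?\<alpha>) (smor u v ?\<beta>) x}"
    using assms unfolding \<alpha> \<beta> by (intro survivor_set_subset)
  ultimately show ?thesis by (intro hausdorff_dim_eq_0) (meson thin_evper thin_mono)
qed

text \<open>For a fixed prefix, \<open>c n\<close> cylinders of depth at least \<open>Q * n\<close>
  suffice for every n, and there are only countably many prefixes.\<close>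

lemma thin_smor:
  assumes "u \<noteq> []" "v \<noteq> []" "Q \<le> length u" "Q \<le> length v" "0 \<le> s"
    and card: "\<And>n. card (stake n ` Y) \<le> c n"
    and lim: "(\<lambda>n. real (c n) * 2 powr (- (s * (real Q * real n)))) \<longlonglongrightarrow> 0"
  shows "thin s {x. \<exists>w y. x = w @- smor u v y \<and> y \<in> Y}"
proof -
  have "thin s ((\<lambda>y. w @- smor u v y) ` Y)" for w
    unfolding thin_def
  proof (intro allI impI)
    fix \<epsilon> :: real assume "0 < \<epsilon>"
    then obtain n where n: "real (c n) * 2 powr (- (s * (real Q * real n))) < \<epsilon>"
      using order_tendstoD(2)[OF lim, of \<epsilon>] by (auto simp: eventually_sequentially)
    let ?F = "(\<lambda>z. w @ lmor u v z) ` stake n ` Y"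
    have "finite (stake n ` Y)"
    proof (rule finite_subset)
      show "finite {z. set z \<subseteq> (UNIV :: bool set) \<and> length z = n}" by (rule finite_lists_length_eq) simp
    qed auto
    then have fin: "finite ?F" and "card ?F \<le> c n"
      using card[of n] card_image_le[of "stake n ` Y"] by (auto intro: order_trans)
    have "Q * n \<le> length z" if z: "z \<in> ?F" for z
    proof -
      from z obtain y where "z = w @ lmor u v (stake n y)" by blast
      with length_lmor_ge[OF assms(3,4), of "stake n y"] show ?thesis by simp
    qed
    from emeasure_word_measure_finite[OF fin this assms(5)]
    have "emeasure (word_measure s) ?F \<le> ennreal (real (card ?F) * 2 powr (- (s * real (Q * n))))" .
    also have "\<dots> \<le> ennreal \<epsilon>"
    proof (rule ennreal_leI)
      have "real (card ?F) * 2 powr (- (s * real (Q * n))) \<le> real (c n) * 2 powr (- (s * real (Q * n)))"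
        using \<open>card ?F \<le> c n\<close> by (intro mult_right_mono) auto
      with n show "real (card ?F) * 2 powr (- (s * real (Q * n))) \<le> \<epsilon>" unfolding of_nat_mult by linarith
    qed
    finally have "emeasure (word_measure s) ?F \<le> ennreal \<epsilon>" .
    moreover have "\<exists>z\<in>?F. \<exists>y'. x = z @- y'" if "x \<in> (\<lambda>y. w @- smor u v y) ` Y" for x
    proof -
      from that obtain y where y: "y \<in> Y" "x = w @- smor u v y" by blast
      then have "x = (w @ lmor u v (stake n y)) @- smor u v (sdrop n y)"
        unfolding shift_append smor_split[OF assms(1,2), of y n, symmetric] by blast
      with y(1) show ?thesis by blast
    qed
    ultimately show "\<exists>F. (\<forall>x\<in>(\<lambda>y. w @- smor u v y) ` Y. \<exists>w\<in>F. \<exists>y. x = w @- y) \<and>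
      emeasure (word_measure s) F \<le> ennreal \<epsilon>" by blast
  qed
  then have "thin s (\<Union>w\<in>UNIV. (\<lambda>y. w @- smor u v y) ` Y)" by (intro thin_UN) auto
  then show ?thesis by (rule thin_mono) auto
qed

lemma shift_le_shiftD:
  fixes u v :: "'a :: linorder list"
  assumes "length u = length v" "u @- x \<le> v @- y" shows "u \<le> v"
  using assms by (induction u v rule: list_induct2) auto

text \<open>At most one word of each length extends to the left in both ways.\<close>

lemma card_stake_le:
  assumes stl: "\<And>y. y \<in> Y \<Longrightarrow> stl y \<in> Y"
    and order: "\<And>y z. False ## y \<in> Y \<Longrightarrow> True ## z \<in> Y \<Longrightarrow> z \<le> (y :: bool stream)"
  shows "card (stake n ` Y) \<le> n + 1"
proof (induction n)
  case 0
  have "stake 0 ` Y \<subseteq> {[]}" by auto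
  from card_mono[OF _ this] show ?case by simp
next
  case (Suc n)
  define A where "A b = {w. b # w \<in> stake (Suc n) ` Y}" for b
  have fin: "finite (stake n ` Y)"
  proof (rule finite_subset)
    show "finite {z. set z \<subseteq> (UNIV :: bool set) \<and> length z = n}" by (rule finite_lists_length_eq) simp
  qed auto
  have mem: "\<exists>y. b ## y \<in> Y \<and> w = stake n y" if "w \<in> A b" for b w
  proof -
    from that obtain y where y: "y \<in> Y" "b # w = stake (Suc n) y" unfolding A_def by blast
    then have "b = shd y" "w = stake n (stl y)" by simp_all
    with y(1) have "b ## stl y \<in> Y" by simp
    with \<open>w = stake n (stl y)\<close> show ?thesis by blast
  qed
  have sub: "A b \<subseteq> stake n ` Y" for b
  proof
    fix w assume "w \<in> A b"
    from mem[OF this] obtain y where "b ## y \<in> Y" "w = stake n y" by blast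
    with stl[of "b ## y"] show "w \<in> stake n ` Y" by simp
  qed
  have finA: "finite (A b)" for b using sub fin by (rule finite_subset)
  have "stake (Suc n) ` Y \<subseteq> (#) False ` A False \<union> (#) True ` A True"
  proof
    fix w assume w: "w \<in> stake (Suc n) ` Y"
    then obtain c w' where cw: "w = c # w'" by auto
    with w have "w' \<in> A c" by (simp add: A_def)
    with cw show "w \<in> (#) False ` A False \<union> (#) True ` A True" by (cases c) auto
  qed
  then have "card (stake (Suc n) ` Y) \<le> card ((#) False ` A False \<union> (#) True ` A True)"
    by (intro card_mono) (simp_all only: finite_Un finite_imageI finA simp_thms)
  also have "\<dots> \<le> card ((#) False ` A False) + card ((#) True ` A True)" by (rule card_Un_le)
  also have "\<dots> = card (A False) + card (A True)" by (simp add: card_image)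
  also have "\<dots> = card (A False \<union> A True) + card (A False \<inter> A True)"
    by (intro card_Un_Int finA)
  also have "card (A False \<union> A True) \<le> card (stake n ` Y)"
    by (intro card_mono fin) (use sub in blast)
  also have "card (A False \<inter> A True) \<le> 1"
  proof -
    have le: "w' \<le> w" if "w \<in> A False" "w' \<in> A True" for w w'
    proof -
      from mem[OF that(1)] mem[OF that(2)] obtain y z where yz: "False ## y \<in> Y" "w = stake n y"
        "True ## z \<in> Y" "w' = stake n z" by blast
      have "stake n z @- sdrop n z \<le> stake n y @- sdrop n y"
        using order[OF yz(1,3)] by (simp add: stake_sdrop)
      then show ?thesis unfolding yz(2,4) by (rule shift_le_shiftD[rotated]) simp
    qed
    have "finite (A False \<inter> A True)" using finA by simp
    moreover have "w = w'" if "w \<in> A False \<inter> A True" "w' \<in> A False \<inter> A True" for w w'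
      using that le[of w w'] le[of w' w] by auto
    ultimately have "card (A False \<inter> A True) \<le> Suc 0" by (subst card_le_Suc0_iff_eq) auto
    then show ?thesis by simp
  qed
  finally show ?case using Suc by simp
qed

text \<open>Cancelling a block in the avoidance bounds shows that the rest has image at most v
  \<gamma> after a 0, and at least u \<gamma> after a 1. Once both letters have occurred, all shifts
  have images between u \<gamma> and v \<gamma>; cancelling once more, \<gamma> separates what
  follows a 1 from what follows a 0. This is membership in \<open>Y\<close>, and it yields the order
  hypothesis of \<open>card_stake_le\<close>.\<close>

lemma hausdorff_dim_survivor_set_sturmian:
  assumes "renorm u v" "cycle u \<le> \<gamma>" "\<gamma> \<le> cycle v"
    and "a \<le> inf_val (u @- v @- \<gamma>)" "inf_val (v @- u @- \<gamma>) \<le> b" "a < 1/2" "1/2 < b"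
  shows "hausdorff_dim (survivor_set a b) = 0"
proof -
  interpret renorm u v by fact
  define Y where "Y = {y. \<forall>n. if y !! n then smor u v (sdrop (Suc n) y) \<le> \<gamma> else \<gamma> \<le> smor u v (sdrop (Suc n) y)}"
  have card: "card (stake n ` Y) \<le> n + 1" for n
  proof (rule card_stake_le)
    fix y assume y: "y \<in> Y"
    show "stl y \<in> Y" unfolding Y_def
    proof (intro CollectI allI)
      fix n show "if stl y !! n then smor u v (sdrop (Suc n) (stl y)) \<le> \<gamma> else \<gamma> \<le> smor u v (sdrop (Suc n) (stl y))"
        using y[unfolded Y_def, THEN CollectD, THEN spec, of "Suc n"] by (simp only: sdrop.simps snth.simps)
    qed
  next
    fix y z assume "False ## y \<in> Y" "True ## z \<in> Y"
    then have "\<gamma> \<le> smor u v y" "smor u v z \<le> \<gamma>" unfolding Y_def by (auto dest!: spec[of _ 0])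
    then have "smor u v z \<le> smor u v y" by (rule order_trans[rotated])
    then show "z \<le> y" by simp
  qed
  have main: "evper x \<or> (\<exists>w y. x = w @- smor u v y \<and> y \<in> Y)" if x: "avoids (u @- v @- \<gamma>) (v @- u @- \<gamma>) x" for x
  proof -
    have "u @- v @- \<gamma> \<le> smor u v (False ## sconst True)" "smor u v (True ## sconst False) \<le> v @- u @- \<gamma>"
      using assms(2,3) cycle_decomp[of u] cycle_decomp[of v] le_stream_shift[of u "cycle u" \<gamma>] le_stream_shift[of v \<gamma> "cycle v"]
      by (simp_all add: smor_sconst)
    from avoids_cases[OF x this] consider "evper x" | w y where "x = w @- smor u v y"
      "avoids (u @- v @- \<gamma>) (v @- u @- \<gamma>) (smor u v y)" by blast
    then show ?thesis
    proof cases
      case 2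
      note blk = avoids_smor_block[OF 2(2)]
      have spl: "smor u v (sdrop n y) = (if y !! n then v else u) @- smor u v (sdrop (Suc n) y)" for n
        by (subst sdrop_Cons_eq) simp
      show ?thesis
      proof (cases "(\<exists>i. y !! i) \<and> (\<exists>j. \<not> y !! j)")
        case False
        then have "y = sconst True \<or> y = sconst False"
          by (auto intro!: stream_eqI_stake nth_equalityI)
        then have "evper y" by auto
        then show ?thesis unfolding 2(1) by (simp add: evper_shift evper_smor)
      next
        case True
        then obtain i j where i: "y !! i" and j: "\<not> y !! j" by blast
        \<comment> \<open>A letter 1 renews the bound for the rest directly from avoidance, and
          removing a leading 0 only increases a word. The bound \<open>up\<close> is
          symmetric.\<close>
        have lo: "u @- \<gamma> \<le> smor u v (sdrop n y)" if "Suc i \<le> n" for n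
          using that
        proof (induction rule: dec_induct)
          case base
          then show ?case using blk[of i] i unfolding spl[of i] by simp
        next
          case (step n)
          show ?case
          proof (cases "y !! n")
            case True
            then show ?thesis using blk[of n] unfolding spl[of n] by simp
          next
            case False
            have "smor u v (sdrop n y) \<le> smor u v (sdrop (Suc n) y)"
              by (subst smor_le, subst sdrop_Cons_eq[of n y]) (simp add: False del: sdrop.simps)
            with step show ?thesis by (meson order_trans)
          qed
        qed
        have up: "smor u v (sdrop n y) \<le> v @- \<gamma>" if "Suc j \<le> n" for n
          using that
        proof (induction rule: dec_induct)
          case base
          then show ?case using blk[of j] j unfolding spl[of j] by simp
        next
          case (step n)
          show ?case
          proof (cases "y !! n")
            case False
            then show ?thesis using blk[of n] unfolding spl[of n] by simp
          next
            case True
            have "smor u v (sdrop (Suc n) y) \<le> smor u v (sdrop n y)"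
              by (subst smor_le, subst sdrop_Cons_eq[of n y]) (simp add: True del: sdrop.simps)
            with step show ?thesis by (meson order_trans)
          qed
        qed
        define k where "k = Suc (max i j)"
        have "sdrop k y \<in> Y"
          unfolding Y_def
        proof (intro CollectI allI)
          fix n
          have "Suc i \<le> k + n" "Suc j \<le> k + n" by (auto simp: k_def)
          from lo[OF this(1)] up[OF this(2)]
          show "if sdrop k y !! n then smor u v (sdrop (Suc n) (sdrop k y)) \<le> \<gamma>
            else \<gamma> \<le> smor u v (sdrop (Suc n) (sdrop k y))"
            unfolding spl[of "k + n"] by (cases "y !! (k + n)") (simp_all add: sdrop_snth del: sdrop.simps)
        qed
        moreover have "x = (w @ lmor u v (stake k y)) @- smor u v (sdrop k y)"
          unfolding 2(1) using smor_split[OF ne, of y k] by simp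
        ultimately show ?thesis by blast
      qed
    qed simp
  qed
  have "thin s {x. avoids (u @- v @- \<gamma>) (v @- u @- \<gamma>) x}" if "0 < s" for s
  proof -
    have "thin s {x. \<exists>w y. x = w @- smor u v y \<and> y \<in> Y}"
    proof (rule thin_smor[where Q = 1 and c = "\<lambda>n. n + 1"])
      show "1 \<le> length u" "1 \<le> length v" by (simp_all add: Suc_le_eq)
      have "(\<lambda>n. real n * (2 powr (- s)) ^ n) \<longlonglongrightarrow> 0"
        using that by (intro powser_times_n_limit_0) (simp add: powr_less_one)
      moreover have "(\<lambda>n. (2 powr (- s)) ^ n) \<longlonglongrightarrow> 0"
        using that by (intro LIMSEQ_realpow_zero) (auto simp: powr_less_one)
      ultimately have "(\<lambda>n. real n * (2 powr (- s)) ^ n + (2 powr (- s)) ^ n) \<longlonglongrightarrow> 0 + 0"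
        by (rule tendsto_add)
      then show "(\<lambda>n. real (n + 1) * 2 powr (- (s * (real 1 * real n)))) \<longlonglongrightarrow> 0"
        by (simp add: powr_powr distrib_right add.commute flip: powr_realpow)
    qed (use card that in auto)
    then have "thin s ({x. evper x} \<union> {x. \<exists>w y. x = w @- smor u v y \<and> y \<in> Y})"
      using thin_evper[OF that] by (rule thin_Un[rotated])
    then show ?thesis by (rule thin_mono) (use main in blast)
  qed
  moreover have "survivor_set a b \<subseteq> inf_val ` {x. avoids (u @- v @- \<gamma>) (v @- u @- \<gamma>) x}"
    using assms by (intro survivor_set_subset)
  ultimately show ?thesis by (intro hausdorff_dim_eq_0) blast
qed

text \<open>There are at most 2^n preimages of length n, and their images have length at least Q n.
  Once s Q exceeds 1, the total weight 2^(n(1 - s Q)) tends to 0, so the crude count of all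
  preimages is good enough.\<close>

lemma hausdorff_dim_survivor_set_limit:
  assumes "\<And>Q. \<exists>u v. renorm u v \<and> Q \<le> length u \<and> Q \<le> length v \<and>
      a \<le> inf_val (u @- cycle v) \<and> inf_val (v @- cycle u) \<le> b"
    and "a < 1/2" "1/2 < b"
  shows "hausdorff_dim (survivor_set a b) = 0"
proof (rule hausdorff_dim_eq_0)
  fix s :: real assume "0 < s"
  obtain Q :: nat where Q: "1 / s < real Q" using reals_Archimedean2 by blast
  obtain u v where uv: "renorm u v" "Q \<le> length u" "Q \<le> length v"
    "a \<le> inf_val (u @- cycle v)" "inf_val (v @- cycle u) \<le> b" using assms(1) by blast
  interpret renorm u v by fact
  let ?\<alpha> = "smor u v (False ## sconst True)" and ?\<beta> = "smor u v (True ## sconst False)"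
  have "thin s {x. \<exists>w y. x = w @- smor u v y \<and> y \<in> UNIV}"
  proof (rule thin_smor[where Q = Q and c = "\<lambda>n. 2 ^ n"])
    fix n
    have "range (stake n) \<subseteq> {z. set z \<subseteq> (UNIV :: bool set) \<and> length z = n}" by auto
    from card_mono[OF finite_lists_length_eq this]
    have "card (range (stake n :: bool stream \<Rightarrow> _)) \<le> card {z. set z \<subseteq> (UNIV :: bool set) \<and> length z = n}" by simp
    also have "\<dots> = 2 ^ n" by (subst card_lists_length_eq) simp_all
    finally show "card (range (stake n :: bool stream \<Rightarrow> _)) \<le> 2 ^ n" .
  next
    have "1 < s * real Q" using Q \<open>0 < s\<close> by (simp add: field_simps)
    then have "2 powr (1 - s * real Q) < 1" by (simp add: powr_less_one)
    then have "(\<lambda>n. (2 powr (1 - s * real Q)) ^ n) \<longlonglongrightarrow> 0" by (intro LIMSEQ_realpow_zero) auto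
    moreover have "(2 powr (1 - s * real Q)) ^ n = real (2 ^ n) * 2 powr (- (s * (real Q * real n)))" for n
      by (simp add: powr_powr algebra_simps flip: powr_realpow powr_add)
    ultimately show "(\<lambda>n. real (2 ^ n) * 2 powr (- (s * (real Q * real n)))) \<longlonglongrightarrow> 0" by simp
  qed (use uv \<open>0 < s\<close> in auto)
  then have "thin s ({x. evper x} \<union> {x. \<exists>w y. x = w @- smor u v y \<and> y \<in> UNIV})"
    using thin_evper[OF \<open>0 < s\<close>] by (rule thin_Un[rotated])
  then have "thin s {x. avoids ?\<alpha> ?\<beta> x}"
    by (rule thin_mono) (use avoids_cases[OF _ order_refl order_refl] in blast)
  moreover have "survivor_set a b \<subseteq> inf_val ` {x. avoids ?\<alpha> ?\<beta> x}"
    using assms(2,3) uv(4,5) by (intro survivor_set_subset) (simp_all add: smor_sconst)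
  ultimately show "\<exists>A. thin s A \<and> survivor_set a b \<subseteq> inf_val ` A" by blast
qed

section \<open>Positive dimension below the threshold\<close>

lemma renorm_left: "renorm u v \<Longrightarrow> renorm u (v @ u)"
  using renorm_comp[OF _ renorm_tau0, of u v] by simp

lemma renorm_right: "renorm u v \<Longrightarrow> renorm (u @ v) v"
  using renorm_comp[OF _ renorm_tau1, of u v] by simp

lemma renorm_both: "renorm u v \<Longrightarrow> renorm (u @ v) (v @ u)"
  using renorm_comp[OF _ renorm_half, of u v] by simp

lemma renorm_right_power: "renorm u v \<Longrightarrow> renorm (u @ concat (replicate k v)) v"
proof (induction k)
  case (Suc k)
  from renorm_right[OF Suc.IH[OF Suc.prems]] show ?case
    by (simp only: replicate_Suc replicate_append_same[symmetric] concat_append append_assoc concat.simps append_Nil2)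
qed simp

lemma renorm_ne: "renorm u v \<Longrightarrow> u \<noteq> [] \<and> v \<noteq> []"
  by (meson ordered_sub.ne renorm_def)

lemma shift_cycle_rotate:
  assumes "u \<noteq> []" shows "u @- cycle (v @ u) = cycle (u @ v)"
proof (rule stream_eq_cycleI)
  show "u @- cycle (v @ u) = (u @ v) @- u @- cycle (v @ u)"
    by (subst cycle_decomp) (use assms in simp_all)
qed (use assms in simp)

lemma inf_val_dist_common:
  assumes "x = w @- x'" "y = w @- y'" "n \<le> length w"
  shows "\<bar>inf_val x - inf_val y\<bar> \<le> (1/2) ^ n"
proof -
  have "\<bar>inf_val x - inf_val y\<bar> \<le> (1/2) ^ length w"
    unfolding assms(1,2) using inf_val_dist_prefix[of w x' y'] by (simp add: power_one_over)
  also have "\<dots> \<le> (1/2) ^ n" using assms(3) by (intro power_decreasing) auto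
  finally show ?thesis .
qed

lemma half_power_small: "0 < (e :: real) \<Longrightarrow> \<exists>n. (1/2) ^ n < e"
  by (rule real_arch_pow_inv) simp_all

lemma half_power_le_imp_le:
  assumes "\<And>n. x \<le> y + (1/2 :: real) ^ n" shows "x \<le> y"
proof (rule field_le_epsilon)
  fix e :: real assume "0 < e"
  then obtain n where "(1/2) ^ n < e" using half_power_small by blast
  with assms[of n] show "x \<le> y + e" by linarith
qed

text \<open>The end points of the plateau are approached by the end points for the pairs
  \<open>(u (v u)\<^sup>k, v u)\<close>.\<close>

lemma survivor_pos_plateau:
  assumes "renorm u v" "inf_val (cycle (u @ v)) \<le> a" "b < inf_val (v @- u @- cycle (u @ v))"
    "a < 1/2" "1/2 < b"
  shows "0 < hausdorff_dim (survivor_set a b)"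
proof -
  have ne: "u \<noteq> []" "v \<noteq> []" using renorm_ne[OF assms(1)] by auto
  obtain k where k: "(1/2) ^ k < inf_val (v @- u @- cycle (u @ v)) - b"
    using half_power_small[of "inf_val (v @- u @- cycle (u @ v)) - b"] assms(3) by auto
  let ?t = "v @ u" let ?P = "concat (replicate k ?t)" let ?s = "u @ ?P"
  have ren: "renorm ?s ?t" by (rule renorm_right_power[OF renorm_left[OF assms(1)]])
  have uv: "u @- cycle ?t = cycle (u @ v)" by (rule shift_cycle_rotate[OF ne(1)])
  have t: "?P @- cycle ?t = cycle ?t" by (rule replicate_shift_cycle) (use ne in simp)
  show ?thesis
  \<comment> \<open>The lower end u (v u)^k (v u)^\<infinity> equals (u v)^\<infinity> exactly; only
    the upper end is approximated, through a common prefix of length at least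
    \<open>k\<close>.\<close>
  proof (rule hausdorff_dim_survivor_set_pos[OF ren])
    show "inf_val (?s @- cycle ?t) \<le> a"
      unfolding shift_append[of u] t uv by (rule assms(2))
    have 1: "?t @- cycle ?s = (?t @ ?s) @- cycle ?s"
      using cycle_decomp[of ?s] ne by simp
    have 2: "v @- u @- cycle (u @ v) = (?t @ ?s) @- cycle ?t"
      unfolding shift_append t uv ..
    have "k \<le> length (?t @ ?s)"
    proof -
      have "k * 1 \<le> k * length ?t" using ne by (intro mult_le_mono2) (simp add: Suc_le_eq)
      also have "\<dots> = length ?P" by (simp add: length_concat sum_list_replicate)
      finally show ?thesis by simp
    qed
    from inf_val_dist_common[OF 1 2 this] show "b \<le> inf_val (?t @- cycle ?s)" using k by linarith
  qed (use assms in auto)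
qed

text \<open>Descent in the Stern--Brocot tree towards \<open>a\<close>. At each node, \<open>a\<close> lies below or above
  the plateau of the node. If it lies above infinitely often, then the corresponding upper ends
  approach \<open>v u \<gamma>\<close>; otherwise \<open>a\<close> is an end point of the last plateau below it.\<close>

locale descent = renorm +
  fixes a b :: real and \<gamma> :: "bool stream"
  assumes a_eq: "a = inf_val (u @- v @- \<gamma>)" and b_less: "b < inf_val (v @- u @- \<gamma>)"
    and a_half: "a < 1/2" and b_half: "1/2 < b"
begin

definition A :: "bool list \<Rightarrow> bool list" where "A ds = lmor u v (sb ds [False])"
definition B :: "bool list \<Rightarrow> bool list" where "B ds = lmor u v (sb ds [True])"

lemma A_B_Nil [simp]: "A [] = u" "B [] = v"
  by (simp_all add: A_def B_def)

lemma A_B_snoc: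
  "A (ds @ [False]) = A ds" "B (ds @ [False]) = B ds @ A ds"
  "A (ds @ [True]) = A ds @ B ds" "B (ds @ [True]) = B ds"
proof -
  have *: "sb (ds @ [d]) w = lmor (sb ds [False]) (sb ds [True]) (lmor (sb_step0 d) (sb_step1 d) w)" for d w
    by (subst sb_eq_lmor[symmetric]) (simp add: sb_append sb_Cons)
  show "A (ds @ [False]) = A ds" "B (ds @ [False]) = B ds @ A ds"
    "A (ds @ [True]) = A ds @ B ds" "B (ds @ [True]) = B ds"
    unfolding A_def B_def * by (simp_all add: sb_step0_def sb_step1_def)
qed

lemma renorm_A_B: "renorm (A ds) (B ds)"
proof (induction ds rule: rev_induct)
  case Nil
  show ?case by simp (unfold_locales)
next
  case (snoc d ds)
  then show ?case using renorm_left[OF snoc] renorm_right[OF snoc] by (cases d) (simp_all add: A_B_snoc)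
qed

lemma A_B_ne [simp]: "A ds \<noteq> []" "B ds \<noteq> []"
  using renorm_ne[OF renorm_A_B] by auto

text \<open>Both orders of concatenation continue with the same \<open>W\<close>, since each step
  appends the same block to both. Hence information on \<gamma> gained at the lower ends, near
  \<open>a\<close>, transfers to the upper ends.\<close>

lemma A_B_prefix: "\<exists>W. A ds @ B ds = u @ v @ W \<and> B ds @ A ds = v @ u @ W \<and> length ds \<le> length W"
proof (induction ds rule: rev_induct)
  case (snoc d ds)
  then obtain W where W: "A ds @ B ds = u @ v @ W" "B ds @ A ds = v @ u @ W" "length ds \<le> length W" by blast
  have len: "1 \<le> length (A ds)" "1 \<le> length (B ds)" by (simp_all add: Suc_le_eq)
  show ?case
  proof (cases d)
    case True
    then have d: "d = True" by simp
    have "A (ds @ [d]) @ B (ds @ [d]) = u @ v @ W @ B ds" "B (ds @ [d]) @ A (ds @ [d]) = v @ u @ W @ B ds"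
      unfolding d A_B_snoc using W(1,2) by (metis append_assoc)+
    then show ?thesis using W(3) len by (intro exI[of _ "W @ B ds"]) simp
  next
    case False
    then have d: "d = False" by simp
    have "A (ds @ [d]) @ B (ds @ [d]) = u @ v @ W @ A ds" "B (ds @ [d]) @ A (ds @ [d]) = v @ u @ W @ A ds"
      unfolding d A_B_snoc using W(1,2) by (metis append_assoc)+
    then show ?thesis using W(3) len by (intro exI[of _ "W @ A ds"]) simp
  qed
qed simp

text \<open>\<open>lo\<close> and \<open>hi\<close> are the ends of the \<open>Delta_tilde\<close>
  interval for the pair (A, B) of the node; the gap is the \<open>Delta\<close> interval for the
  pair (A B, B A). Removing the gap leaves the ranges of the two children.\<close>

definition lo :: "bool list \<Rightarrow> real" where "lo ds = inf_val (A ds @- B ds @- cycle (A ds))"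
definition hi :: "bool list \<Rightarrow> real" where "hi ds = inf_val (A ds @- cycle (B ds))"
definition gap_lo :: "bool list \<Rightarrow> real" where "gap_lo ds = inf_val (cycle (A ds @ B ds))"
definition gap_hi :: "bool list \<Rightarrow> real" where "gap_hi ds = inf_val (A ds @- B ds @- cycle (B ds @ A ds))"

lemma cycle_A: "A ds @- cycle (A ds) = cycle (A ds)"
  using cycle_decomp[of "A ds"] by simp

lemma cycle_B: "B ds @- cycle (B ds) = cycle (B ds)"
  using cycle_decomp[of "B ds"] by simp

lemma lo_hi_snoc:
  "lo (ds @ [False]) = lo ds" "hi (ds @ [False]) = gap_lo ds"
  "lo (ds @ [True]) = gap_hi ds" "hi (ds @ [True]) = hi ds"
  unfolding lo_def hi_def gap_lo_def gap_hi_def A_B_snoc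
  by (simp_all add: cycle_A cycle_B shift_cycle_rotate)

lemma gap_lo_le_hi: "gap_lo ds \<le> gap_hi ds"
proof -
  interpret r: renorm "A ds" "B ds" by (rule renorm_A_B)
  have "cycle (A ds @ B ds) = A ds @- B ds @- cycle (A ds @ B ds)"
    using cycle_decomp[of "A ds @ B ds"] by simp
  moreover obtain x y where "A ds = False # x" "B ds = True # y" using r.hd_u r.hd_v by blast
  then have "cycle (A ds @ B ds) \<le> cycle (B ds @ A ds)"
    by (subst (1 2) cycle_decomp) auto
  then have "A ds @- B ds @- cycle (A ds @ B ds) \<le> A ds @- B ds @- cycle (B ds @ A ds)" by simp
  ultimately have "cycle (A ds @ B ds) \<le> A ds @- B ds @- cycle (B ds @ A ds)" by simp
  then show ?thesis unfolding gap_lo_def gap_hi_def by (rule inf_val_mono)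
qed

text \<open>From \<open>a \<le> hi ds\<close>, the value of \<gamma> is at most that of W
  B^\<infinity>. Any other continuation of \<open>W\<close> changes this by at most 2^-|ds|, and a
  common prefix in front only shrinks the error.\<close>

lemma close:
  assumes "lo ds \<le> a" "a \<le> hi ds"
  shows "inf_val (v @- u @- \<gamma>) \<le> inf_val (B ds @- A ds @- x) + (1/2) ^ length ds"
proof -
  obtain W where W: "A ds @ B ds = u @ v @ W" "B ds @ A ds = v @ u @ W" "length ds \<le> length W"
    using A_B_prefix by blast
  have AB: "A ds @- B ds @- y = u @- v @- W @- y" "B ds @- A ds @- y = v @- u @- W @- y" for y
    using W(1,2) by (metis shift_append)+
  have hi: "hi ds = inf_val (u @- v @- W @- cycle (B ds))"
    unfolding hi_def AB[symmetric] cycle_B ..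
  have val: "inf_val (w @- w' @- y) = fin_val w + (fin_val w' + inf_val y / 2 ^ length w') / 2 ^ length w" for w w' y
    by (simp add: inf_val_shift)
  have "inf_val \<gamma> \<le> inf_val (W @- cycle (B ds))"
    using assms(2) unfolding a_eq hi val by (simp add: divide_le_cancel)
  then have "inf_val \<gamma> \<le> inf_val (W @- x) + (1/2) ^ length ds"
    using inf_val_dist_common[OF refl refl W(3), of x "cycle (B ds)"] by linarith
  then have "inf_val \<gamma> - inf_val (W @- x) \<le> (1/2) ^ length ds" by linarith
  moreover have "inf_val (v @- u @- \<gamma>) - inf_val (v @- u @- W @- x) =
      (inf_val \<gamma> - inf_val (W @- x)) / 2 ^ (length v + length u)"
    unfolding val by (simp add: diff_divide_distrib add_divide_distrib power_add mult.commute)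
  moreover have "d / 2 ^ n \<le> e" if "d \<le> e" "0 \<le> e" for d e :: real and n
  proof -
    have "d / 2 ^ n \<le> e / 2 ^ n" using that by (simp add: divide_right_mono)
    also have "\<dots> \<le> e / 1" using that by (intro divide_left_mono) auto
    finally show ?thesis by simp
  qed
  ultimately have "inf_val (v @- u @- \<gamma>) - inf_val (v @- u @- W @- x) \<le> (1/2) ^ length ds" by simp
  then show ?thesis unfolding AB(2) by linarith
qed

lemma lo_cases: "lo ds = lo [] \<or> (\<exists>ds'. lo ds = gap_hi ds')"
proof (induction ds rule: rev_induct)
  case (snoc d ds)
  then show ?case by (cases d) (auto simp: lo_hi_snoc)
qed simp

lemma survivor_pos:
  assumes "lo [] < a" "a \<le> hi []" "\<And>ds. \<not> (gap_lo ds \<le> a \<and> a \<le> gap_hi ds)"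
  shows "0 < hausdorff_dim (survivor_set a b)"
proof -
  define In where "In ds \<longleftrightarrow> lo ds \<le> a \<and> a \<le> hi ds" for ds
  have step: "In (ds @ [False]) \<or> In (ds @ [True]) \<and> gap_hi ds < a" if "In ds" for ds
    using that assms(3)[of ds] gap_lo_le_hi[of ds] unfolding In_def lo_hi_snoc by linarith
  have ex: "\<exists>ds. length ds = n \<and> In ds" for n
  proof (induction n)
    case 0
    show ?case using assms(1,2) by (auto simp: In_def)
  next
    case (Suc n)
    then obtain ds where "length ds = n" "In ds" by blast
    with step[of ds] show ?case by (metis length_append_singleton)
  qed
  obtain N where N: "(1/2) ^ N < inf_val (v @- u @- \<gamma>) - b"
    using half_power_small[of "inf_val (v @- u @- \<gamma>) - b"] b_less by auto
  show ?thesis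
  proof (cases "\<exists>ds. N \<le> length ds \<and> In ds \<and> gap_hi ds < a")
    case True
    then obtain ds where ds: "N \<le> length ds" "In ds" "gap_hi ds < a" by blast
    show ?thesis
    proof (rule hausdorff_dim_survivor_set_pos[OF renorm_both[OF renorm_A_B[of ds]]])
      show "inf_val ((A ds @ B ds) @- cycle (B ds @ A ds)) \<le> a" using ds(3) by (simp add: gap_hi_def)
      have "(1/2 :: real) ^ length ds \<le> (1/2) ^ N" using ds(1) by (intro power_decreasing) auto
      then show "b \<le> inf_val ((B ds @ A ds) @- cycle (A ds @ B ds))"
        using close[of ds "cycle (A ds @ B ds)"] N ds(2) unfolding In_def shift_append by linarith
    qed (use a_half b_half in auto)
  next
    case False
    obtain ds where ds: "length ds = N" "In ds" using ex by blast
    have iter: "In (ds @ replicate k False)" for k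
    proof (induction k)
      case (Suc k)
      have "N \<le> length (ds @ replicate k False)" using ds(1) by simp
      with step[OF Suc] False have "In ((ds @ replicate k False) @ [False])" using Suc by blast
      then show ?case by (simp only: append_assoc replicate_append_same replicate_Suc)
    qed (use ds in simp)
    have snoc: "ds @ replicate (Suc k) False = (ds @ replicate k False) @ [False]" for k
      by (simp only: append_assoc replicate_append_same replicate_Suc)
    have Ak: "A (ds @ replicate k False) = A ds" for k
      by (induction k) (simp_all only: snoc A_B_snoc, simp)
    have Bk: "B (ds @ replicate k False) = B ds @ concat (replicate k (A ds))" for k
    proof (induction k)
      case (Suc k)
      then show ?case unfolding snoc A_B_snoc Ak
        by (simp only: append_assoc replicate_Suc replicate_append_same[symmetric] concat_append concat.simps append_Nil2)
    qed simp
    \<comment> \<open>After k left turns A is unchanged and B has become B A^k, so \<open>hi\<close>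
      there agrees with \<open>lo\<close> on the prefix A B A^k. This squeezes \<open>a\<close> to
      \<open>lo\<close>, which is \<open>gap_hi\<close> of an earlier node unless no right turn was
      ever made.\<close>
    have "a \<le> lo ds + (1/2) ^ k" for k
    proof -
      let ?P = "concat (replicate k (A ds))" let ?ds = "ds @ replicate k False"
      have "a \<le> hi ?ds" using iter by (simp add: In_def)
      moreover have "hi ?ds = inf_val ((A ds @ B ds @ ?P) @- cycle (B ?ds))"
        unfolding hi_def by (subst cycle_decomp) (simp_all add: Ak Bk)
      moreover have "lo ds = inf_val ((A ds @ B ds @ ?P) @- cycle (A ds))"
        unfolding lo_def shift_append replicate_shift_cycle[OF A_B_ne(1)] ..
      moreover have "k \<le> length (A ds @ B ds @ ?P)"
      proof -
        have "k * 1 \<le> k * length (A ds)" by (intro mult_le_mono2) (simp add: Suc_le_eq)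
        also have "\<dots> = length ?P" by (simp add: length_concat sum_list_replicate)
        finally show ?thesis by simp
      qed
      ultimately show ?thesis
        using inf_val_dist_common[OF refl refl, of k "A ds @ B ds @ ?P" "cycle (B ?ds)" "cycle (A ds)"] by linarith
    qed
    then have "a \<le> lo ds" by (rule half_power_le_imp_le)
    with ds(2) have "a = lo ds" by (simp add: In_def)
    with lo_cases[of ds] assms(1) obtain ds' where "a = gap_hi ds'" by auto
    with assms(3)[of ds'] gap_lo_le_hi[of ds'] show ?thesis by simp
  qed
qed

end

section \<open>The substitution words\<close>

lemma rho_eq_lmor: "rho r = lmor (omega_minus r) (omega_plus r)"
  by (rule ext) (simp add: rho_def lmor_def)

lemma foldr_rho: "foldr rho rs w = lmor (s_word rs) (t_word rs) w"
  using foldr_lmor[of omega_minus omega_plus rs w] unfolding s_word_def t_word_def rho_eq_lmor .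

lemma s_word_append: "s_word (rs @ rs') = lmor (s_word rs) (t_word rs) (s_word rs')"
  unfolding foldr_rho[symmetric] by (simp add: s_word_def)

lemma t_word_append: "t_word (rs @ rs') = lmor (s_word rs) (t_word rs) (t_word rs')"
  unfolding foldr_rho[symmetric] by (simp add: t_word_def)

lemma word_Nil [simp]: "s_word [] = [False]" "t_word [] = [True]"
  by (simp_all add: s_word_def t_word_def)

lemma word_singleton: "s_word [r] = omega_minus r" "t_word [r] = omega_plus r"
  by (simp_all add: s_word_def t_word_def rho_eq_lmor)

lemma renorm_sb: "renorm (sb ds [False]) (sb ds [True])"
proof (induction ds)
  case Nil
  show ?case using renorm_id by simp
next
  case (Cons d ds)
  have "renorm (sb_step0 d) (sb_step1 d)"
    using renorm_tau0 renorm_tau1 by (cases d) (simp_all add: sb_step0_def sb_step1_def)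
  from renorm_comp[OF this Cons] show ?case by (simp add: sb_Cons)
qed

lemma renorm_omega:
  assumes "r \<in> unit_rats" shows "renorm (omega_minus r) (omega_plus r)"
proof -
  obtain ds where ds: "omega_minus r = sb ds [False, True]" "omega_plus r = sb ds [True, False]"
    by (rule omega_eq_sb[OF assms])
  show ?thesis unfolding ds sb_eq_lmor[of ds "[False, True]"] sb_eq_lmor[of ds "[True, False]"]
    by (rule renorm_comp[OF renorm_sb renorm_half])
qed

lemma renorm_words: "set rs \<subseteq> unit_rats \<Longrightarrow> renorm (s_word rs) (t_word rs)"
proof (induction rs rule: rev_induct)
  case Nil
  show ?case using renorm_id by simp
next
  case (snoc r rs)
  then have "renorm (s_word rs) (t_word rs)" "renorm (omega_minus r) (omega_plus r)"
    using renorm_omega by auto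
  from renorm_comp[OF this] show ?case by (simp add: s_word_append t_word_append word_singleton)
qed

lemma length_lmor_eq:
  assumes "length u = Q" "length v = Q" shows "length (lmor u v w) = Q * length w"
  using assms by (induction w) auto

lemma length_words: "set rs \<subseteq> unit_rats \<Longrightarrow> length (s_word rs) = Q_len rs \<and> length (t_word rs) = Q_len rs"
proof (induction rs rule: rev_induct)
  case (snoc r rs)
  then show ?case
    by (simp add: s_word_append t_word_append word_singleton length_lmor_eq length_omega Q_len_def)
qed (simp add: Q_len_def)

lemma length_less_Q_len: "set rs \<subseteq> unit_rats \<Longrightarrow> length rs < Q_len rs"
proof (induction rs)
  case (Cons r rs)
  then have "2 * Suc (length rs) \<le> denom r * Q_len rs"
    using length_omega(3)[of r] by (intro mult_le_mono) auto
  then show ?case by (simp add: Q_len_def)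
qed (simp add: Q_len_def)

lemma word_snoc_eq_sb:
  assumes "r \<in> unit_rats"
  obtains ds where
    "s_word (rs @ [r]) = lmor (s_word rs) (t_word rs) (sb ds [False]) @ lmor (s_word rs) (t_word rs) (sb ds [True])"
    "t_word (rs @ [r]) = lmor (s_word rs) (t_word rs) (sb ds [True]) @ lmor (s_word rs) (t_word rs) (sb ds [False])"
proof -
  obtain ds where ds: "omega_minus r = sb ds [False, True]" "omega_plus r = sb ds [True, False]"
    by (rule omega_eq_sb[OF assms])
  show ?thesis
    by (rule that[of ds]) (simp_all add: s_word_append t_word_append word_singleton ds
        sb_eq_lmor[of ds "[False, True]"] sb_eq_lmor[of ds "[True, False]"])
qed

text \<open>Every node of the tree below \<open>rs\<close> occurs here. So a point outside all
  intervals \<open>Delta (rs @ [r])\<close> lies in no gap of the descent.\<close>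

lemma sb_eq_word_snoc:
  obtains r where "r \<in> unit_rats"
    "s_word (rs @ [r]) = lmor (s_word rs) (t_word rs) (sb ds [False]) @ lmor (s_word rs) (t_word rs) (sb ds [True])"
    "t_word (rs @ [r]) = lmor (s_word rs) (t_word rs) (sb ds [True]) @ lmor (s_word rs) (t_word rs) (sb ds [False])"
proof -
  obtain r where r: "r \<in> unit_rats" "omega_minus r = sb ds [False, True]" "omega_plus r = sb ds [True, False]"
    by (rule sb_eq_omega)
  show ?thesis
    by (rule that[OF r(1)]) (simp_all add: s_word_append t_word_append word_singleton r(2,3)
        sb_eq_lmor[of ds "[False, True]"] sb_eq_lmor[of ds "[True, False]"])
qed

section \<open>Limit words\<close>

lemma word_tendsto_unique:
  assumes "word_tendsto w x" "word_tendsto w y" shows "x = y"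
proof (intro stream_eqI_stake nth_equalityI)
  fix n k assume "k < length (stake n x)"
  have "\<forall>\<^sub>F n in sequentially. x !! k = y !! k"
    using assms[unfolded word_tendsto_def, rule_format, of k] by eventually_elim auto
  then show "stake n x ! k = stake n y ! k" using \<open>k < length (stake n x)\<close> by simp
qed simp

text \<open>Each word extends the previous ones and the n-th has more than n letters, so the limit
  can be read off the diagonal.\<close>

lemma word_tendsto_chain:
  assumes ext: "\<And>n. \<exists>z. w (Suc n) = w n @ z" and len: "\<And>n. n < length (w n)"
  shows "word_tendsto w (THE x. word_tendsto w x)" "\<exists>y. (THE x. word_tendsto w x) = w n @- y"
proof -
  have pre: "\<exists>z. w (n + k) = w n @ z" for n k
  proof (induction k)
    case (Suc k)
    with ext[of "n + k"] show ?case by auto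
  qed simp
  have nth: "w m ! k = w n ! k" if "n \<le> m" "k < length (w n)" for m n k
    using pre[of n "m - n"] that by (auto simp: nth_append)
  define x where "x = smap (\<lambda>k. w k ! k) nats"
  have x: "x !! k = w m ! k" if "k \<le> m" for k m
    using nth[OF that len] by (simp add: x_def)
  have lim: "word_tendsto w x"
    unfolding word_tendsto_def
  proof
    fix k
    show "\<forall>\<^sub>F n in sequentially. k < length (w n) \<and> w n ! k = x !! k"
      unfolding eventually_sequentially using x len by (intro exI[of _ k]) (auto intro: le_less_trans)
  qed
  then have the: "(THE x. word_tendsto w x) = x" by (rule the_equality) (rule word_tendsto_unique[OF _ lim])
  show "word_tendsto w (THE x. word_tendsto w x)" unfolding the by (rule lim)
  have "stake (length (w n)) x = w n"
  proof (rule nth_equalityI)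
    fix k assume k: "k < length (stake (length (w n)) x)"
    then have "x !! k = w (max n k) ! k" using x[of k "max n k"] by simp
    also have "\<dots> = w n ! k" using k by (intro nth) auto
    finally show "stake (length (w n)) x ! k = w n ! k" using k by simp
  qed simp
  then show "\<exists>y. (THE x. word_tendsto w x) = w n @- y" unfolding the by (metis stake_sdrop)
qed

context
  fixes r :: "nat \<Rightarrow> rat"
  assumes r: "range r \<subseteq> unit_rats"
begin

lemma set_map_r: "set (map r ns) \<subseteq> unit_rats"
  using r by auto

abbreviation (input) "S n \<equiv> s_word (map r [0..<n])"
abbreviation (input) "T n \<equiv> t_word (map r [0..<n])"

lemma renorm_S_T: "renorm (S n) (T n)"
  by (rule renorm_words[OF set_map_r])

lemma length_S_T: "n < length (S n)" "n < length (T n)"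
  using length_words[OF set_map_r, of "[0..<n]"] length_less_Q_len[OF set_map_r, of "[0..<n]"] by simp_all

lemma S_T_add:
  "\<exists>z. S (n + k) = lmor (S n) (T n) (False # z)" "\<exists>z. T (n + k) = lmor (S n) (T n) (True # z)"
proof -
  interpret o: renorm "s_word (map r [n..<n + k])" "t_word (map r [n..<n + k])"
    by (rule renorm_words[OF set_map_r])
  have "map r [0..<n + k] = map r [0..<n] @ map r [n..<n + k]"
    unfolding map_append[symmetric] by (simp only: upt_add_eq_append[of 0 n k, OF le0])
  then show "\<exists>z. S (n + k) = lmor (S n) (T n) (False # z)" "\<exists>z. T (n + k) = lmor (S n) (T n) (True # z)"
    using o.hd_u o.hd_v by (auto simp only: s_word_append t_word_append)
qed

lemma s_limit_prefix: "\<exists>y. s_limit r = S n @- y"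
  unfolding s_limit_def
proof (rule word_tendsto_chain(2))
  fix n show "\<exists>z. S (Suc n) = S n @ z" using S_T_add(1)[of n 1] by auto
qed (rule length_S_T)

lemma t_limit_prefix: "\<exists>y. t_limit r = T n @- y"
  unfolding t_limit_def
proof (rule word_tendsto_chain(2))
  fix n show "\<exists>z. T (Suc n) = T n @ z" using S_T_add(2)[of n 1] by auto
qed (rule length_S_T)

text \<open>Since \<open>S (n + k)\<close> is the image of a word beginning with 0, continuing it by
  \<open>cycle (T n)\<close> gives the image of a word between 0^\<infinity> and 01^\<infinity>. The
  limit is within 2^-k of this, for every k.\<close>

lemma s_limit_bounds:
  "inf_val (cycle (S n)) \<le> inf_val (s_limit r)" "inf_val (s_limit r) \<le> inf_val (S n @- cycle (T n))"
proof -
  interpret renorm "S n" "T n" by (rule renorm_S_T)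
  have bounds: "inf_val (cycle (S n)) \<le> inf_val (s_limit r) + (1/2) ^ k \<and>
      inf_val (s_limit r) \<le> inf_val (S n @- cycle (T n)) + (1/2) ^ k" for k
  proof -
    obtain y where y: "s_limit r = S (n + k) @- y" using s_limit_prefix by blast
    obtain z where z: "S (n + k) = lmor (S n) (T n) (False # z)" using S_T_add(1) by blast
    have k: "k \<le> length (S (n + k))" using length_S_T(1)[of "n + k"] by linarith
    have "smor (S n) (T n) (sconst False) \<le> smor (S n) (T n) ((False # z) @- sconst True)"
      by (simp only: smor_le sconst_False_le)
    then have "cycle (S n) \<le> S (n + k) @- cycle (T n)"
      unfolding z smor_shift[OF ne] smor_sconst[OF ne] by simp
    moreover have "smor (S n) (T n) ((False # z) @- sconst True) \<le> smor (S n) (T n) (False ## sconst True)"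
      by (simp only: smor_le shift.simps le_stream_Cons le_sconst_True simp_thms)
    then have "S (n + k) @- cycle (T n) \<le> S n @- cycle (T n)"
      unfolding z smor_shift[OF ne] smor_Cons[OF ne] smor_sconst[OF ne] by simp
    ultimately have "inf_val (cycle (S n)) \<le> inf_val (S (n + k) @- cycle (T n))"
      "inf_val (S (n + k) @- cycle (T n)) \<le> inf_val (S n @- cycle (T n))"
      by (simp_all only: inf_val_mono)
    then show ?thesis using inf_val_dist_common[OF y refl k, of "cycle (T n)"] by linarith
  qed
  show "inf_val (cycle (S n)) \<le> inf_val (s_limit r)"
    by (rule half_power_le_imp_le) (use bounds in blast)
  show "inf_val (s_limit r) \<le> inf_val (S n @- cycle (T n))"
    by (rule half_power_le_imp_le) (use bounds in blast)
qed

lemma t_limit_lower: "inf_val (T n @- cycle (S n)) \<le> inf_val (t_limit r)"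
proof (rule half_power_le_imp_le)
  interpret renorm "S n" "T n" by (rule renorm_S_T)
  fix k
  obtain y where y: "t_limit r = T (n + k) @- y" using t_limit_prefix by blast
  obtain z where z: "T (n + k) = lmor (S n) (T n) (True # z)" using S_T_add(2) by blast
  have k: "k \<le> length (T (n + k))" using length_S_T(2)[of "n + k"] by linarith
  have "smor (S n) (T n) (True ## sconst False) \<le> smor (S n) (T n) ((True # z) @- sconst False)"
    by (simp only: smor_le shift.simps le_stream_Cons sconst_False_le simp_thms)
  then have "T n @- cycle (S n) \<le> T (n + k) @- cycle (S n)"
    unfolding z smor_shift[OF ne] smor_Cons[OF ne] smor_sconst[OF ne] by simp
  then have "inf_val (T n @- cycle (S n)) \<le> inf_val (T (n + k) @- cycle (S n))" by (rule inf_val_mono)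
  then show "inf_val (T n @- cycle (S n)) \<le> inf_val (t_limit r) + (1/2) ^ k"
    using inf_val_dist_common[OF y refl k, of "cycle (S n)"] by linarith
qed

lemma t_limit_upper: "inf_val (t_limit r) \<le> inf_val (T n @- cycle (S n)) + (1/2) ^ n"
proof -
  obtain y where y: "t_limit r = T n @- y" using t_limit_prefix by blast
  have "n \<le> length (T n)" using length_S_T(2)[of n] by linarith
  from inf_val_dist_common[OF y refl this, of "cycle (S n)"] show ?thesis by linarith
qed

end

section \<open>The threshold\<close>

lemma inf_val_t_word_ge: "set rs \<subseteq> unit_rats \<Longrightarrow> 1/2 \<le> inf_val (t_word rs @- x)"
proof -
  assume "set rs \<subseteq> unit_rats"
  then interpret renorm "s_word rs" "t_word rs" by (rule renorm_words)
  show ?thesis using hd_v by auto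
qed

text \<open>Only holes with b in (1/2, 1) are tested; the bounds on \<open>y\<close> are what makes
  it unique.\<close>

definition threshold :: "real \<Rightarrow> real \<Rightarrow> bool" where
  "threshold a y \<longleftrightarrow> 1/2 \<le> y \<and> y \<le> 1 \<and>
    (\<forall>b. 1/2 < b \<longrightarrow> b < 1 \<longrightarrow> (0 < hausdorff_dim (survivor_set a b) \<longleftrightarrow> b < y))"

lemma threshold_unique:
  assumes "threshold a y" "threshold a y'" shows "y = y'"
proof -
  have "\<not> y < y'" if "threshold a y" "threshold a y'" for y y'
  proof
    assume "y < y'"
    then obtain b where b: "y < b" "b < y'" using dense by blast
    moreover have "1/2 \<le> y" "y' \<le> 1" using that by (simp_all add: threshold_def)
    ultimately have "1/2 < b" "b < 1" by linarith+
    then have "b < y \<longleftrightarrow> b < y'" using that by (simp add: threshold_def)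
    with b show False by simp
  qed
  with assms show ?thesis by (meson linorder_neqE)
qed

text \<open>For nonempty \<open>rs\<close> the two words are A B and B A for a renormalizing pair
  (A, B), so \<open>survivor_pos_plateau\<close> applies. No upper bound by the plateau is imposed
  on \<open>a\<close>, which lets the limit case use it as well.\<close>

lemma survivor_pos_words:
  assumes "rs \<noteq> []" "set rs \<subseteq> unit_rats" "inf_val (cycle (s_word rs)) \<le> a"
    "b < inf_val (t_word rs @- cycle (s_word rs))" "a < 1/2" "1/2 < b"
  shows "0 < hausdorff_dim (survivor_set a b)"
proof -
  obtain rs' q where rs: "rs = rs' @ [q]" using assms(1) by (metis rev_exhaust)
  then have q: "q \<in> unit_rats" "set rs' \<subseteq> unit_rats" using assms(2) by auto
  obtain ds where ds:
    "s_word rs = lmor (s_word rs') (t_word rs') (sb ds [False]) @ lmor (s_word rs') (t_word rs') (sb ds [True])"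
    "t_word rs = lmor (s_word rs') (t_word rs') (sb ds [True]) @ lmor (s_word rs') (t_word rs') (sb ds [False])"
    using word_snoc_eq_sb[OF q(1), of rs'] unfolding rs by blast
  show ?thesis
    by (rule survivor_pos_plateau[OF renorm_comp[OF renorm_words[OF q(2)] renorm_sb[of ds]]])
      (use assms(3-6) in \<open>simp_all only: ds shift_append\<close>)
qed

lemma threshold_plateau:
  assumes "rs \<noteq> []" "set rs \<subseteq> unit_rats" "a < 1/2"
    "a \<in> {inf_val (cycle (s_word rs)) .. inf_val (s_word rs @- t_word rs @- cycle (s_word rs))}"
  shows "threshold a (inf_val (t_word rs @- cycle (s_word rs)))"
  unfolding threshold_def
proof (intro conjI allI impI iffI)
  fix b :: real assume b: "1/2 < b"
  show "0 < hausdorff_dim (survivor_set a b)" if "b < inf_val (t_word rs @- cycle (s_word rs))"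
    using assms that b by (intro survivor_pos_words[of rs]) auto
  show "b < inf_val (t_word rs @- cycle (s_word rs))" if "0 < hausdorff_dim (survivor_set a b)"
  proof (rule ccontr)
    assume "\<not> ?thesis"
    then have "hausdorff_dim (survivor_set a b) = 0"
      using assms b by (intro hausdorff_dim_survivor_set_plateau[OF renorm_words[OF assms(2)]]) auto
    with that show False by simp
  qed
qed (use inf_val_t_word_ge[OF assms(2)] in auto)

text \<open>Writing a = s t \<gamma>, the threshold is the value of t s \<gamma>, which gives the
  formula. From above this is the complexity bound, from below the descent.\<close>

lemma threshold_gap:
  assumes rs: "set rs \<subseteq> unit_rats" and a: "1/4 < a" "a < 1/2" "a \<in> Delta_tilde rs"
    and no: "\<And>q. q \<in> unit_rats \<Longrightarrow> a \<notin> Delta (rs @ [q])"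
  shows "threshold a (a + (1 - 1 / 2 ^ Q_len rs) * (fin_val (t_word rs) - fin_val (s_word rs)))"
proof -
  let ?s = "s_word rs" and ?t = "t_word rs"
  interpret renorm ?s ?t by (rule renorm_words[OF rs])
  define Q where "Q = Q_len rs"
  have len: "length ?s = Q" "length ?t = Q" using length_words[OF rs] by (auto simp: Q_def)
  have val: "inf_val (w @- w' @- x) = fin_val w + (fin_val w' + inf_val x / 2 ^ Q) / 2 ^ Q"
    if "length w = Q" "length w' = Q" for w w' x using that by (simp add: inf_val_shift)
  have cyc: "?s @- cycle ?s = cycle ?s" "?t @- cycle ?t = cycle ?t"
    using cycle_decomp[of ?s] cycle_decomp[of ?t] by simp_all
  have bd: "inf_val (?s @- ?t @- cycle ?s) \<le> a" "a \<le> inf_val (?s @- ?t @- cycle ?t)"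
    using a(3) by (simp_all add: Delta_tilde_def cyc)
  define g where "g = (a - fin_val ?s - fin_val ?t / 2 ^ Q) * 2 ^ Q * 2 ^ Q"
  have a_g: "a = fin_val ?s + (fin_val ?t + g / 2 ^ Q) / 2 ^ Q" by (simp add: g_def field_simps)
  have g: "inf_val (cycle ?s) \<le> g" "g \<le> inf_val (cycle ?t)"
    using bd unfolding val[OF len] a_g by (simp_all add: divide_le_cancel)
  \<comment> \<open>The expansion of \<open>g\<close> may lie outside the bounds in the order of
    words. Then the bound it violates has the value \<open>g\<close> itself and is taken
    instead.\<close>
  have "\<exists>\<gamma>. inf_val \<gamma> = g \<and> cycle ?s \<le> \<gamma> \<and> \<gamma> \<le> cycle ?t"
  proof -
    have "cycle ?s \<le> cycle ?t" using smor_le[of "sconst False" "sconst True"] by (simp add: smor_sconst)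
    moreover have "inf_val (expansion g) = g"
      using order_trans[OF inf_val_nonneg g(1)] order_trans[OF g(2) inf_val_le_1]
      by (intro inf_val_expansion) simp
    moreover have "inf_val (cycle ?s) = g" if "expansion g \<le> cycle ?s" "inf_val (expansion g) = g"
      using inf_val_mono[OF that(1)] that(2) g(1) by linarith
    moreover have "inf_val (cycle ?t) = g" if "cycle ?t \<le> expansion g" "inf_val (expansion g) = g"
      using inf_val_mono[OF that(1)] that(2) g(2) by linarith
    ultimately show ?thesis by (meson linear order_refl)
  qed
  then obtain \<gamma> where \<gamma>: "inf_val \<gamma> = g" "cycle ?s \<le> \<gamma>" "\<gamma> \<le> cycle ?t" by blast
  define y where "y = inf_val (?t @- ?s @- \<gamma>)"
  have a_eq: "a = inf_val (?s @- ?t @- \<gamma>)" unfolding val[OF len] \<gamma>(1) by (rule a_g)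
  have y_eq: "y = a + (1 - 1 / 2 ^ Q) * (fin_val ?t - fin_val ?s)"
    unfolding y_def a_eq val[OF len] val[OF len(2,1)]
    by (simp add: add_divide_distrib diff_divide_distrib left_diff_distrib right_diff_distrib)
  have "threshold a y"
    unfolding threshold_def
  proof (intro conjI allI impI iffI)
    fix b :: real assume b: "1/2 < b"
    show "b < y" if "0 < hausdorff_dim (survivor_set a b)"
    proof (rule ccontr)
      assume "\<not> b < y"
      then have "hausdorff_dim (survivor_set a b) = 0"
        using a b a_eq by (intro hausdorff_dim_survivor_set_sturmian[OF renorm_axioms \<gamma>(2,3)]) (auto simp: y_def)
      with that show False by simp
    qed
    show "0 < hausdorff_dim (survivor_set a b)" if "b < y"
    proof -
      interpret d: descent ?s ?t a b \<gamma>
        by unfold_locales (use a_eq a(2) b that in \<open>auto simp: y_def\<close>)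
      have "d.A [] = ?s" "d.B [] = ?t" by simp_all
      then have lo: "d.lo [] = inf_val (?s @- ?t @- cycle ?s)" and hi: "d.hi [] = inf_val (?s @- cycle ?t)"
        by (simp_all add: d.lo_def d.hi_def)
      show ?thesis
      \<comment> \<open>The descent needs \<open>a\<close> strictly above its left end. At that end
        y is the value of t s^\<infinity>, as on the plateau of \<open>rs\<close>; for empty
        \<open>rs\<close> it would be 1/4, which is excluded.\<close>
      proof (cases "a = d.lo []")
        case False
        show ?thesis
        proof (rule d.survivor_pos)
          show "d.lo [] < a" "a \<le> d.hi []" using False bd unfolding lo hi cyc by auto
          fix ds
          obtain q where q: "q \<in> unit_rats" "s_word (rs @ [q]) = d.A ds @ d.B ds" "t_word (rs @ [q]) = d.B ds @ d.A ds"
            unfolding d.A_def d.B_def by (rule sb_eq_word_snoc)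
          show "\<not> (d.gap_lo ds \<le> a \<and> a \<le> d.gap_hi ds)"
            using no[OF q(1)] unfolding Delta_def q(2,3) d.gap_lo_def d.gap_hi_def by simp
        qed
      next
        case True
        then have "g = inf_val (cycle ?s)" unfolding lo val[OF len] a_g by simp
        moreover have "inf_val (?t @- cycle ?s) = inf_val (?t @- ?s @- cycle ?s)" unfolding cyc ..
        ultimately have y: "y = inf_val (?t @- cycle ?s)"
          unfolding y_def val[OF len(2,1)] \<gamma>(1) by (simp only:)
        show ?thesis
        proof (cases "rs = []")
          case True
          with \<open>a = d.lo []\<close> have "a = 1/4" unfolding lo by (simp flip: sconst_cycle)
          with a(1) show ?thesis by simp
        next
          case False
          have "cycle ?s \<le> ?s @- ?t @- cycle ?s"
            using smor_le[of "sconst False" "False ## True ## sconst False"] by (simp add: smor_sconst)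
          from inf_val_mono[OF this] bd(1) have "inf_val (cycle ?s) \<le> a" by linarith
          with False rs show ?thesis using that a(2) b unfolding y by (intro survivor_pos_words[of rs]) auto
        qed
      qed
    qed
  qed (use inf_val_t_word_ge[OF rs] in \<open>auto simp: y_def\<close>)
  then show ?thesis unfolding y_eq Q_def .
qed

lemma threshold_limit:
  assumes "range r \<subseteq> unit_rats" "a = inf_val (s_limit r)" "a < 1/2"
  shows "threshold a (inf_val (t_limit r))"
  unfolding threshold_def
proof (intro conjI allI impI iffI)
  fix b :: real assume b: "1/2 < b"
  show "0 < hausdorff_dim (survivor_set a b)" if less: "b < inf_val (t_limit r)"
  proof -
    obtain n where n: "(1/2) ^ n < inf_val (t_limit r) - b"
      using half_power_small[of "inf_val (t_limit r) - b"] less by auto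
    \<comment> \<open>The index \<open>Suc n\<close> makes the list of rationals nonempty, as
      \<open>survivor_pos_words\<close> requires.\<close>
    have "(1/2 :: real) ^ Suc n \<le> (1/2) ^ n" by (intro power_decreasing) auto
    with n have "b < inf_val (t_word (map r [0..<Suc n]) @- cycle (s_word (map r [0..<Suc n])))"
      using t_limit_upper[OF assms(1), of "Suc n"] by linarith
    moreover have "inf_val (cycle (s_word (map r [0..<Suc n]))) \<le> a"
      unfolding assms(2) by (rule s_limit_bounds(1)[OF assms(1)])
    ultimately show ?thesis
      using assms(3) b set_map_r[OF assms(1), of "[0..<Suc n]"]
      by (intro survivor_pos_words[of "map r [0..<Suc n]"]) simp_all
  qed
  show "b < inf_val (t_limit r)" if pos: "0 < hausdorff_dim (survivor_set a b)"
  proof (rule ccontr)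
    assume "\<not> ?thesis"
    then have ge: "inf_val (t_limit r) \<le> b" by simp
    have "hausdorff_dim (survivor_set a b) = 0"
    proof (rule hausdorff_dim_survivor_set_limit)
      fix n
      let ?s = "s_word (map r [0..<n])" and ?t = "t_word (map r [0..<n])"
      have "renorm ?s ?t" by (rule renorm_S_T[OF assms(1)])
      moreover have "n \<le> length ?s" "n \<le> length ?t" using length_S_T[OF assms(1), of n] by simp_all
      moreover have "a \<le> inf_val (?s @- cycle ?t)" unfolding assms(2) by (rule s_limit_bounds(2)[OF assms(1)])
      moreover have "inf_val (?t @- cycle ?s) \<le> b" using t_limit_lower[OF assms(1), of n] ge by linarith
      ultimately show "\<exists>u v. renorm u v \<and> n \<le> length u \<and> n \<le> length v \<and>
        a \<le> inf_val (u @- cycle v) \<and> inf_val (v @- cycle u) \<le> b" by blast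
    qed (use assms(3) b in auto)
    with pos show False by simp
  qed
next
  obtain y where "t_limit r = t_word (map r [0..<0]) @- y" using t_limit_prefix[OF assms(1)] by blast
  then show "1/2 \<le> inf_val (t_limit r)" by simp
qed simp

lemma chi_graph_threshold:
  assumes "chi_graph a y" "1/4 < a" "a < 1/2" shows "threshold a y"
  using assms
proof (induction rule: chi_graph.induct)
  case (plateau rs a)
  then show ?case by (intro threshold_plateau)
next
  case (first a)
  \<comment> \<open>For the empty list \<open>Delta_tilde\<close> is [1/4, 1/2] and the added
    constant is (1 - 1/2)(1/2 - 0) = 1/4.\<close>
  have "a \<in> Delta_tilde []" using first by (simp add: S_first_def Delta_tilde_def flip: sconst_cycle)
  moreover have "a \<notin> Delta ([] @ [q])" if "q \<in> unit_rats" for q using first that by (auto simp: S_first_def)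
  ultimately have "threshold a (a + (1 - 1 / 2 ^ Q_len []) * (fin_val (t_word []) - fin_val (s_word [])))"
    using first by (intro threshold_gap) auto
  then show ?case by (simp add: Q_len_def)
next
  case (next_level rs a)
  then show ?case by (intro threshold_gap) (auto simp: S_next_def)
next
  case (limit r a)
  then show ?case by (intro threshold_limit)
qed

text \<open>If cases (i) to (iii) fail at every level, \<open>a\<close> can be followed through
  nested intervals \<open>Delta\<close>, choosing one rational at a time. Their lengths tend to 0
  and they all contain \<open>s_limit\<close>, so case (iv) applies.\<close>

lemma chi_graph_exists:
  assumes "1/4 < a" "a < 1/2" shows "\<exists>y. chi_graph a y"
proof (rule ccontr)
  assume contr: "\<nexists>y. chi_graph a y"
  have deeper: "\<exists>q\<in>unit_rats. a \<in> Delta (rs @ [q])" if "set rs \<subseteq> unit_rats" "rs \<noteq> [] \<Longrightarrow> a \<in> Delta rs" for rs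
  proof (cases "rs = []")
    case True
    have "a \<notin> S_first" using contr chi_graph.first by blast
    with True assms show ?thesis by (auto simp: S_first_def)
  next
    case False
    have "a \<notin> S_next rs" using contr chi_graph.next_level[OF False that(1)] by blast
    moreover have "a \<notin> {inf_val (cycle (s_word rs)) .. inf_val (s_word rs @- t_word rs @- cycle (s_word rs))}"
      using contr chi_graph.plateau[OF False that(1)] by blast
    with that(2)[OF False] have "a \<in> Delta_tilde rs" by (auto simp: Delta_def Delta_tilde_def)
    ultimately show ?thesis by (auto simp: S_next_def)
  qed
  define g where "g rs = (SOME q. q \<in> unit_rats \<and> a \<in> Delta (rs @ [q]))" for rs
  define L where "L n = ((\<lambda>rs. rs @ [g rs]) ^^ n) []" for n
  define r where "r n = g (L n)" for n
  have L_Suc: "L (Suc n) = L n @ [g (L n)]" for n by (simp add: L_def)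
  have L: "L n = map r [0..<n]" for n
  proof (induction n)
    case (Suc n)
    have "L (Suc n) = L n @ [r n]" unfolding L_Suc r_def ..
    with Suc show ?case by simp
  qed (simp add: L_def)
  have inv: "set (L n) \<subseteq> unit_rats \<and> (L n \<noteq> [] \<longrightarrow> a \<in> Delta (L n))" for n
  proof (induction n)
    case (Suc n)
    then have "\<exists>q. q \<in> unit_rats \<and> a \<in> Delta (L n @ [q])" using deeper[of "L n"] by blast
    then have "g (L n) \<in> unit_rats \<and> a \<in> Delta (L n @ [g (L n)])" unfolding g_def by (rule someI_ex)
    with Suc show ?case unfolding L_Suc by simp
  qed (simp add: L_def)
  have r: "range r \<subseteq> unit_rats"
  proof
    fix q assume "q \<in> range r"
    then obtain n where "q = r n" by blast
    then show "q \<in> unit_rats" using inv[of "Suc n"] unfolding L by simp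
  qed
  have "\<bar>a - inf_val (s_limit r)\<bar> \<le> (1/2) ^ n" for n
  proof -
    let ?s = "s_word (map r [0..<Suc n])" and ?t = "t_word (map r [0..<Suc n])"
    interpret renorm ?s ?t by (rule renorm_S_T[OF r])
    have "a \<in> Delta (map r [0..<Suc n])" using inv[of "Suc n"] unfolding L by simp
    then have "inf_val (cycle ?s) \<le> a" "a \<le> inf_val (?s @- cycle ?t)" by (auto simp: Delta_def)
    moreover have "\<bar>inf_val (cycle ?s) - inf_val (?s @- cycle ?t)\<bar> \<le> (1/2) ^ n"
      using length_S_T(1)[OF r, of "Suc n"]
      by (intro inf_val_dist_common[OF cycle_decomp[OF ne(1)] refl]) linarith
    ultimately show ?thesis using s_limit_bounds[OF r, of "Suc n"] by linarith
  qed
  then have "\<bar>a - inf_val (s_limit r)\<bar> \<le> 0"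
    using half_power_le_imp_le[of "\<bar>a - inf_val (s_limit r)\<bar>" 0] by simp
  then have "a = inf_val (s_limit r)" by simp
  with chi_graph.limit[OF r] contr show False by blast
qed

lemma threshold_chi:
  assumes "1/4 < a" "a < 1/2" shows "threshold a (chi a)"
proof -
  obtain y where y: "chi_graph a y" using chi_graph_exists[OF assms] by blast
  have "chi a = y"
    unfolding chi_def using y chi_graph_threshold[OF _ assms] threshold_unique by blast
  with chi_graph_threshold[OF y assms] show ?thesis by simp
qed

text \<open>The plateau criterion for the identity substitution: 010^\<infinity> has value 1/4 and
  10^\<infinity> has value 1/2.\<close>

lemma hausdorff_dim_survivor_set_eq_0:
  assumes "a \<le> 1/4" "1/2 < b" shows "hausdorff_dim (survivor_set a b) = 0"
  using assms by (intro hausdorff_dim_survivor_set_plateau[OF renorm_id]) (simp_all flip: sconst_cycle)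

theorem theorem1p2:
  shows "{(a, b). a \<in> {0<..<1/2} \<and> b \<in> {1/2<..<1} \<and> hausdorff_dim (survivor_set a b) > 0} =
         {(a, b). a \<in> {1/4<..<1/2} \<and> b \<in> {1/2<..<1} \<and> b < chi a}"
proof -
  have "0 < a \<and> 0 < hausdorff_dim (survivor_set a b) \<longleftrightarrow> 1/4 < a \<and> b < chi a"
    if "a < 1/2" "1/2 < b" "b < 1" for a b
  proof (cases "1/4 < a")
    case True
    with threshold_chi[OF True that(1)] that show ?thesis unfolding threshold_def by auto
  next
    case False
    with hausdorff_dim_survivor_set_eq_0[of a b] that show ?thesis by simp
  qed
  then show ?thesis by auto
qed

end
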